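(* Let $\Bbbk$ be a field, let $q\in\Bbbk^*$ be not a root of unity, let $n\ge 1$, and let $\alpha_1,\ldots,\alpha_n,\tilde\alpha_1,\ldots,\tilde\alpha_n\in\Bbbk^*$. Then every $\Bbbk$-algebra homomorphism $$\mathscr{A}_{\alpha_1,q}\otimes\cdots\otimes\mathscr{A}_{\alpha_n,q}\longrightarrow \mathscr{A}_{\tilde\alpha_1,q}\otimes\cdots\otimes\mathscr{A}_{\tilde\alpha_n,q}$$ (tensor products over $\Bbbk$) is invertible.
   Context: For $\alpha,q\in\Bbbk^*$, $\mathscr{A}_{\alpha,q}$ denotes the $\Bbbk$-algebra generated by $e_1,e_2,e_3$ subject to the relations $e_1e_3=q^{-1}e_3e_1$, $e_2e_3=qe_3e_2+\alpha$, $e_2e_1=q^{-1}e_1e_2-q^{-1}e_3$, and $e_3^2+(q^2-1)e_3e_1e_2+\alpha q(q+1)e_1=0$. *)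

theory Defs
  imports "HOL-Algebra.QuotRing"
begin

definition free_alg :: "'g set \<Rightarrow> ('g list \<Rightarrow> 'k::field) ring" where
  "free_alg X = \<lparr> carrier = {f. finite {w. f w \<noteq> 0} \<and> (\<forall>w. f w \<noteq> 0 \<longrightarrow> set w \<subseteq> X)},
                 mult = (\<lambda>f g w. \<Sum>k\<le>length w. f (take k w) * g (drop k w)),
                 one = (\<lambda>w. if w = [] then 1 else 0),
                 zero = (\<lambda>w. 0),
                 add = (\<lambda>f g w. f w + g w) \<rparr>"

definition gen :: "'g \<Rightarrow> ('g list \<Rightarrow> 'k::field)" where
  "gen x = (\<lambda>w. if w = [x] then 1 else 0)"

definition scal :: "'k::field \<Rightarrow> ('g list \<Rightarrow> 'k)" where
  "scal c = (\<lambda>w. if w = [] then c else 0)"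

definition pres_alg :: "'g set \<Rightarrow> ('g list \<Rightarrow> 'k::field) set \<Rightarrow> ('g list \<Rightarrow> 'k) set ring" where
  "pres_alg X Rels = free_alg X Quot genideal (free_alg X) Rels"

definition pres_scal :: "'g set \<Rightarrow> ('g list \<Rightarrow> 'k::field) set \<Rightarrow> 'k \<Rightarrow> ('g list \<Rightarrow> 'k) set" where
  "pres_scal X Rels c = genideal (free_alg X) Rels +>\<^bsub>free_alg X\<^esub> scal c"

text \<open>k-algebra homomorphisms between presented algebras: unital ring homomorphisms
  commuting with the structure maps from k (equivalently: k-linear ring homomorphisms).\<close>
definition pres_alg_hom ::
  "'g set \<Rightarrow> ('g list \<Rightarrow> 'k::field) set \<Rightarrow> 'h set \<Rightarrow> ('h list \<Rightarrow> 'k) set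
    \<Rightarrow> (('g list \<Rightarrow> 'k) set \<Rightarrow> ('h list \<Rightarrow> 'k) set) set" where
  "pres_alg_hom X R Y S =
     {h. h \<in> ring_hom (pres_alg X R) (pres_alg Y S) \<and> (\<forall>c. h (pres_scal X R c) = pres_scal Y S c)}"

text \<open>Generator (i, j) stands for e_j of the i-th tensor factor (i < n, j in {1,2,3}).\<close>
definition E :: "nat \<Rightarrow> nat \<Rightarrow> ((nat \<times> nat) list \<Rightarrow> 'k::field)" where
  "E i j = gen (i, j)"

definition tens_gens :: "nat \<Rightarrow> (nat \<times> nat) set" where
  "tens_gens n = {0..<n} \<times> {1, 2, 3}"

definition A_rels :: "(nat \<times> nat) set \<Rightarrow> nat \<Rightarrow> 'k::field \<Rightarrow> 'k \<Rightarrow> ((nat \<times> nat) list \<Rightarrow> 'k) set" where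
  "A_rels X i \<alpha> q = (let F = free_alg X in
     { E i 1 \<otimes>\<^bsub>F\<^esub> E i 3 \<ominus>\<^bsub>F\<^esub> scal (inverse q) \<otimes>\<^bsub>F\<^esub> E i 3 \<otimes>\<^bsub>F\<^esub> E i 1,
       E i 2 \<otimes>\<^bsub>F\<^esub> E i 3 \<ominus>\<^bsub>F\<^esub> (scal q \<otimes>\<^bsub>F\<^esub> E i 3 \<otimes>\<^bsub>F\<^esub> E i 2 \<oplus>\<^bsub>F\<^esub> scal \<alpha>),
       E i 2 \<otimes>\<^bsub>F\<^esub> E i 1 \<ominus>\<^bsub>F\<^esub> (scal (inverse q) \<otimes>\<^bsub>F\<^esub> E i 1 \<otimes>\<^bsub>F\<^esub> E i 2
                                     \<ominus>\<^bsub>F\<^esub> scal (inverse q) \<otimes>\<^bsub>F\<^esub> E i 3),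
       E i 3 \<otimes>\<^bsub>F\<^esub> E i 3 \<oplus>\<^bsub>F\<^esub> scal (q ^ 2 - 1) \<otimes>\<^bsub>F\<^esub> E i 3 \<otimes>\<^bsub>F\<^esub> E i 1 \<otimes>\<^bsub>F\<^esub> E i 2
         \<oplus>\<^bsub>F\<^esub> scal (\<alpha> * q * (q + 1)) \<otimes>\<^bsub>F\<^esub> E i 1 })"

text \<open>Relations of A_{alpha_0,q} (x) ... (x) A_{alpha_(n-1),q} (tensor over k):
  the relations of each factor, plus: generators of distinct factors commute.\<close>
definition tens_rels :: "nat \<Rightarrow> (nat \<Rightarrow> 'k::field) \<Rightarrow> 'k \<Rightarrow> ((nat \<times> nat) list \<Rightarrow> 'k) set" where
  "tens_rels n \<alpha> q = (let X = tens_gens n; F = free_alg X in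
     (\<Union>i<n. A_rels X i (\<alpha> i) q) \<union>
     {gen x \<otimes>\<^bsub>F\<^esub> gen y \<ominus>\<^bsub>F\<^esub> gen y \<otimes>\<^bsub>F\<^esub> gen x | x y. x \<in> X \<and> y \<in> X \<and> fst x \<noteq> fst y})"

definition tens_A :: "nat \<Rightarrow> (nat \<Rightarrow> 'k::field) \<Rightarrow> 'k \<Rightarrow> ((nat \<times> nat) list \<Rightarrow> 'k) set ring" where
  "tens_A n \<alpha> q = pres_alg (tens_gens n) (tens_rels n \<alpha> q)"

definition tens_A_hom :: "nat \<Rightarrow> (nat \<Rightarrow> 'k::field) \<Rightarrow> (nat \<Rightarrow> 'k) \<Rightarrow> 'k
    \<Rightarrow> (((nat \<times> nat) list \<Rightarrow> 'k) set \<Rightarrow> ((nat \<times> nat) list \<Rightarrow> 'k) set) set" where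
  "tens_A_hom n \<alpha> \<beta> q = pres_alg_hom (tens_gens n) (tens_rels n \<alpha> q) (tens_gens n) (tens_rels n \<beta> q)"

end

theory Submission
  imports Defs "HOL-Library.Poly_Mapping"
begin

text \<open>
  In \<open>A\<^sub>\<alpha>\<close> put \<open>x = e\<^sub>3\<close>, \<open>y = e\<^sub>2\<close>, \<open>u = (q - 1) x y + \<alpha>\<close>. Then \<open>u x = q x u\<close>, \<open>y u = q u y\<close>, the element
  \<open>u\<close> is invertible and \<open>e\<^sub>1\<close> is a multiple of \<open>x\<^sup>2 u\<^sup>-\<^sup>1\<close>, so \<open>A\<^sub>\<alpha>\<close> is a quantum Weyl algebra localised at
  \<open>u\<close>. The tensor product maps to a quantum torus, which is a domain whose units are the monomials.

  Under any homomorphism to the torus the \<open>u\<^sub>i\<close> therefore become monomials, and their commutation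
  relations with the images of \<open>x\<^sub>j\<close>, \<open>y\<^sub>j\<close> force the PBW monomials to have distinct leading exponents; hence every
  such homomorphism is injective. For surjectivity, the action on functions on a lattice shows that
  \<open>u\<^sub>i\<close> goes to a monomial \<open>c u\<^sup>m\<close> in the \<open>u\<^sub>k\<close> alone. As \<open>x\<^sub>i y\<^sub>i\<close> and \<open>y\<^sub>i x\<^sub>i\<close> are binomials in \<open>u\<^sub>i\<close>, comparing
  Newton polytopes makes the images of \<open>x\<^sub>i\<close>, \<open>y\<^sub>i\<close> homogeneous, and the one of negative degree in \<open>x\<^sub>k\<close> vanishes at a
  root of \<open>y\<^sub>k\<close>, so \<open>c u\<^sup>m - \<alpha>\<^sub>i\<close> does too. This leaves only \<open>m = \<plusminus>\<epsilon>\<^sub>k\<close>, and \<open>x\<^sub>i\<close>, \<open>y\<^sub>i\<close> are sent to unit multiples of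
  \<open>x\<^sub>k\<close>, \<open>y\<^sub>k\<close> in some order.
\<close>

section \<open>Twisted group algebras\<close>

text \<open>Homomorphisms into the torus alone are not rigid enough: for two factors,
  \<open>u_1 -> u_1 u_2\<close>, \<open>u_2 -> u_2\<close>, \<open>x_1 -> x_1\<close>,
  \<open>x_2 -> x_2 x_1^-1\<close> extends to one. What distinguishes the target algebra inside the
  torus is that \<open>y_k\<close> is \<open>x_k^-1\<close> times a binomial in \<open>u_k\<close>
  which vanishes at the edge of a half-lattice. So the algebra stabilises the functions supported on
  the half-lattice, whereas \<open>x_k^-1\<close> alone does not.

  This vanishing confines \<open>m\<close> to one coordinate \<open>k\<close>. Its size comes from
  \<open>u_i x_i = q x_i u_i\<close>: if the image of \<open>x_i\<close> has degrees
  \<open>D_l\<close> in the \<open>x_l\<close>, the relation says that the sum of the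
  \<open>D_l m_l\<close> is 1, so \<open>D_k m_k = 1\<close>. The images of \<open>x_i\<close> and
  \<open>y_i\<close> change places when \<open>m_k = -1\<close>.

  No basis theorem is proved for the presented algebras beforehand: PBW monomials are only shown to
  span, and their independence comes from the leading exponents in the torus. This applies also to
  the map from the target algebra, which is thereby an embedding, so surjectivity can be checked
  inside the torus.\<close>

abbreviation "lookup \<equiv> Poly_Mapping.lookup"
abbreviation "keys \<equiv> Poly_Mapping.keys"
abbreviation "single \<equiv> Poly_Mapping.single"

declare single_one [simp del] single_numeral [simp del] single_of_nat [simp del] single_of_int [simp del]

lemma sum_single_lookup:
  fixes f :: "'a \<Rightarrow>\<^sub>0 'b::comm_monoid_add"
  shows "(\<Sum>a\<in>keys f. single a (lookup f a)) = f"
  by (rule poly_mapping_eqI)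
    (auto simp: lookup_sum lookup_single when_def in_keys_iff sum.delta[OF finite_keys])

text \<open>Reduces additive statements to monomials. Restricting \<open>single\<close> to exponents
  of \<open>f\<close> lets a condition on the support of \<open>f\<close> enter the
  induction.\<close>

lemma poly_mapping_additive_induct [case_names zero single add]:
  fixes f :: "'a \<Rightarrow>\<^sub>0 'b::comm_monoid_add"
  assumes "P 0" and "\<And>a c. a \<in> keys f \<Longrightarrow> P (single a c)" and "\<And>g h. P g \<Longrightarrow> P h \<Longrightarrow> P (g + h)"
  shows "P f"
proof -
  have "P (\<Sum>a\<in>A. single a (lookup f a))" if "finite A" "A \<subseteq> keys f" for A
    using that by (induction A rule: finite_induct) (auto intro: assms)
  from this[OF finite_keys order_refl] show ?thesis by (simp add: sum_single_lookup)
qed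

lemma obtain_max_on_keys:
  fixes \<phi> :: "'g \<Rightarrow> 'b::linorder"
  assumes "f \<noteq> 0"
  obtains a where "a \<in> keys f" "\<And>b. b \<in> keys f \<Longrightarrow> \<phi> b \<le> \<phi> a"
proof -
  have ne: "\<phi> ` keys f \<noteq> {}" "finite (\<phi> ` keys f)" using assms by auto
  obtain a where "a \<in> keys f" "\<phi> a = Max (\<phi> ` keys f)"
    using Max_in[OF ne(2,1)] by auto
  with Max_ge[OF ne(2)] show ?thesis by (intro that[of a]) auto
qed

text \<open>A bicharacter is a 2-cocycle, which makes the twisted product associative; the order on
  the exponent group provides leading terms.\<close>

locale twisted_group_algebra =
  fixes \<sigma> :: "'g::linordered_ab_group_add \<Rightarrow> 'g \<Rightarrow> 'k::field"
  assumes \<sigma>_add_left: "\<sigma> (a + b) c = \<sigma> a c * \<sigma> b c"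
    and \<sigma>_add_right: "\<sigma> a (b + c) = \<sigma> a b * \<sigma> a c"
    and \<sigma>_nonzero [simp]: "\<sigma> a b \<noteq> 0"
begin

lemma \<sigma>_zero [simp]: "\<sigma> 0 a = 1" "\<sigma> a 0 = 1"
  using \<sigma>_add_left[of 0 0 a] \<sigma>_add_right[of a 0 0] by auto

text \<open>A separate operation, because the type class product of
  \<open>\<Rightarrow>\<^sub>0\<close> is the untwisted convolution. The unit is kept in the form
  \<open>single 0 1\<close>.\<close>

definition tmul :: "('g \<Rightarrow>\<^sub>0 'k) \<Rightarrow> ('g \<Rightarrow>\<^sub>0 'k) \<Rightarrow> ('g \<Rightarrow>\<^sub>0 'k)" (infixl \<open>\<star>\<close> 70) where
  "f \<star> g = (\<Sum>a\<in>keys f. \<Sum>b\<in>keys g. single (a + b) (lookup f a * lookup g b * \<sigma> a b))"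

lemma tmul_superset:
  assumes "finite A" "finite B" "keys f \<subseteq> A" "keys g \<subseteq> B"
  shows "f \<star> g = (\<Sum>a\<in>A. \<Sum>b\<in>B. single (a + b) (lookup f a * lookup g b * \<sigma> a b))"
proof -
  have "(\<Sum>b\<in>keys g. single (a + b) (lookup f a * lookup g b * \<sigma> a b)) =
        (\<Sum>b\<in>B. single (a + b) (lookup f a * lookup g b * \<sigma> a b))" for a
    by (rule sum.mono_neutral_left) (use assms in \<open>auto simp: in_keys_iff\<close>)
  then show ?thesis unfolding tmul_def
    by (simp only:) (rule sum.mono_neutral_left, use assms in \<open>auto simp: in_keys_iff\<close>)
qed

lemma tmul_zero [simp]: "0 \<star> f = 0" "f \<star> 0 = 0"
  by (simp_all add: tmul_def)

lemma tmul_add_left: "(f + g) \<star> h = f \<star> h + g \<star> h"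
  by (simp add: tmul_superset[of "keys f \<union> keys g" "keys h"] Poly_Mapping.keys_add
      lookup_add single_add distrib_right sum.distrib)

lemma tmul_add_right: "h \<star> (f + g) = h \<star> f + h \<star> g"
  by (simp add: tmul_superset[of "keys h" "keys f \<union> keys g"] Poly_Mapping.keys_add
      lookup_add single_add distrib_left distrib_right sum.distrib)

lemma tmul_single [simp]: "single a c \<star> single b d = single (a + b) (c * d * \<sigma> a b)"
  by (simp add: tmul_superset[of "{a}" "{b}"])

lemma tmul_assoc: "(f \<star> g) \<star> h = f \<star> (g \<star> h)"
proof (induction f rule: poly_mapping_additive_induct)
  case (single a c)
  show ?case
  proof (induction g rule: poly_mapping_additive_induct)
    case (single b d)
    show ?case
      by (induction h rule: poly_mapping_additive_induct)
        (auto simp: tmul_add_left tmul_add_right \<sigma>_add_left \<sigma>_add_right add.assoc mult_ac)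
  qed (auto simp: tmul_add_left tmul_add_right)
qed (auto simp: tmul_add_left)

lemma tmul_one [simp]: "single 0 1 \<star> f = f" "f \<star> single 0 1 = f"
  by (induction f rule: poly_mapping_additive_induct) (auto simp: tmul_add_left tmul_add_right)

lemma scalar_commute: "single 0 c \<star> f = f \<star> single 0 c"
  by (induction f rule: poly_mapping_additive_induct)
    (auto simp: tmul_add_left tmul_add_right mult.commute)

lemma lookup_scalar [simp]: "lookup (single 0 c \<star> f) a = c * lookup f a"
  by (induction f rule: poly_mapping_additive_induct)
    (auto simp: tmul_add_right lookup_add algebra_simps lookup_single when_def)

lemma lookup_monomial_left: "lookup (single a c \<star> f) (a + b) = c * lookup f b * \<sigma> a b"
  by (induction f rule: poly_mapping_additive_induct)
    (auto simp: tmul_add_right lookup_add algebra_simps lookup_single when_def)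

lemma lookup_monomial_right: "lookup (f \<star> single a c) (b + a) = lookup f b * c * \<sigma> b a"
  by (induction f rule: poly_mapping_additive_induct)
    (auto simp: tmul_add_left lookup_add algebra_simps lookup_single when_def)

lemma tmul_minus_left: "(- f) \<star> h = - (f \<star> h)"
  by (rule sym, rule minus_unique) (simp flip: tmul_add_left)

lemma tmul_minus_right: "h \<star> (- f) = - (h \<star> f)"
  by (rule sym, rule minus_unique) (simp flip: tmul_add_right)

lemma tmul_diff_left: "(f - g) \<star> h = f \<star> h - g \<star> h"
  using tmul_add_left[of f "- g" h] by (simp add: tmul_minus_left)

lemma tmul_diff_right: "h \<star> (f - g) = h \<star> f - h \<star> g"
  using tmul_add_right[of h f "- g"] by (simp add: tmul_minus_right)

lemma keys_tmul: "keys (f \<star> g) \<subseteq> {a + b | a b. a \<in> keys f \<and> b \<in> keys g}"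
proof -
  have "keys (f \<star> g) \<subseteq> (\<Union>a\<in>keys f. \<Union>b\<in>keys g. keys (single (a + b) (lookup f a * lookup g b * \<sigma> a b)))"
    unfolding tmul_def by (intro order_trans[OF keys_sum] UN_mono order_refl)
  also have "\<dots> \<subseteq> {a + b | a b. a \<in> keys f \<and> b \<in> keys g}" by auto
  finally show ?thesis .
qed

lemma lookup_tmul:
  "lookup (f \<star> g) c = (\<Sum>a\<in>keys f. \<Sum>b\<in>keys g. lookup f a * lookup g b * \<sigma> a b when a + b = c)"
  by (simp add: tmul_def lookup_sum lookup_single)

section \<open>Leading exponents and Newton polytopes\<close>

definition lead :: "('g \<Rightarrow>\<^sub>0 'k) \<Rightarrow> 'g" where
  "lead f = Max (keys f)"

lemma lead_in_keys: "f \<noteq> 0 \<Longrightarrow> lead f \<in> keys f"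
  by (simp add: lead_def)

lemma le_lead: "a \<in> keys f \<Longrightarrow> a \<le> lead f"
  by (simp add: lead_def)

lemma lead_eqI: "a \<in> keys f \<Longrightarrow> (\<And>b. b \<in> keys f \<Longrightarrow> b \<le> a) \<Longrightarrow> lead f = a"
  unfolding lead_def by (rule Max_eqI) auto

lemma lead_single [simp]: "c \<noteq> 0 \<Longrightarrow> lead (single a c) = a"
  by (simp add: lead_def)

text \<open>The sum of the two maxima decomposes in only one way, so its coefficient is one product
  of nonzero scalars and nothing cancels.\<close>

lemma lead_tmul_in_keys:
  assumes "f \<noteq> 0" "g \<noteq> 0"
  shows "lead f + lead g \<in> keys (f \<star> g)"
proof -
  have unique: "a = lead f \<and> b = lead g" if "a \<in> keys f" "b \<in> keys g" "a + b = lead f + lead g" for a b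
    using le_lead[OF that(1)] le_lead[OF that(2)] that(3)
    by (metis add_le_less_mono add_less_le_mono less_irrefl order_le_less)
  have "lookup (f \<star> g) (lead f + lead g) =
      (\<Sum>a\<in>keys f. \<Sum>b\<in>keys g. lookup f a * lookup g b * \<sigma> a b when (b = lead g \<and> a = lead f))"
    unfolding lookup_tmul by (intro sum.cong refl) (auto simp: when_def dest: unique)
  also have "\<dots> = (\<Sum>a\<in>keys f. lookup f a * lookup g (lead g) * \<sigma> a (lead g) when a = lead f)"
    using lead_in_keys[OF assms(2)]
    by (intro sum.cong refl) (auto simp: when_def sum.delta)
  also have "\<dots> = lookup f (lead f) * lookup g (lead g) * \<sigma> (lead f) (lead g)"
    using lead_in_keys[OF assms(1)] by (auto simp: when_def sum.delta)
  finally show ?thesis using assms[THEN lead_in_keys] by (simp add: in_keys_iff)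
qed

lemma tmul_nonzero: "f \<noteq> 0 \<Longrightarrow> g \<noteq> 0 \<Longrightarrow> f \<star> g \<noteq> 0"
  using lead_tmul_in_keys by fastforce

lemma lead_tmul: "f \<noteq> 0 \<Longrightarrow> g \<noteq> 0 \<Longrightarrow> lead (f \<star> g) = lead f + lead g"
  using keys_tmul[of f g] by (intro lead_eqI lead_tmul_in_keys) (auto intro!: add_mono le_lead)

text \<open>The largest of the leading exponents occurs in exactly one summand and therefore
  survives.\<close>

lemma nonzero_of_distinct_leads:
  assumes "p \<noteq> 0" and nz: "\<And>i. i \<in> keys p \<Longrightarrow> b i \<noteq> 0" and inj: "inj_on (\<lambda>i. lead (b i)) (keys p)"
  shows "(\<Sum>i\<in>keys p. single 0 (lookup p i) \<star> b i) \<noteq> 0"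
proof -
  obtain j where j: "j \<in> keys p" "\<And>i. i \<in> keys p \<Longrightarrow> lead (b i) \<le> lead (b j)"
    using obtain_max_on_keys[OF assms(1), of "\<lambda>i. lead (b i)"] by blast
  have "lookup (b i) (lead (b j)) = 0" if "i \<in> keys p" "i \<noteq> j" for i
  proof -
    have "lead (b i) < lead (b j)"
      using j that inj by (metis inj_onD order_le_less)
    then show ?thesis using le_lead[of "lead (b j)" "b i"] by (meson in_keys_iff leD)
  qed
  then have "lookup (\<Sum>i\<in>keys p. single 0 (lookup p i) \<star> b i) (lead (b j)) =
      (\<Sum>i\<in>keys p. if i = j then lookup p j * lookup (b j) (lead (b j)) else 0)"
    unfolding lookup_sum by (intro sum.cong refl) auto
  also have "\<dots> \<noteq> 0"
    using j(1) lead_in_keys[OF nz[OF j(1)]] by (simp add: in_keys_iff)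
  finally show ?thesis by fastforce
qed

text \<open>The functional \<phi> need not separate exponents, so its maximum may be attained
  several times. The parts of \<open>f\<close> and \<open>g\<close> of top \<phi>-degree have a
  nonzero product, since there are no zero divisors, and no other pair of terms reaches that
  degree.\<close>

lemma max_in_keys_tmul:
  fixes \<phi> :: "'g \<Rightarrow> int"
  assumes add: "\<And>a b. \<phi> (a + b) = \<phi> a + \<phi> b"
    and a: "a \<in> keys f" "\<And>a'. a' \<in> keys f \<Longrightarrow> \<phi> a' \<le> \<phi> a"
    and b: "b \<in> keys g" "\<And>b'. b' \<in> keys g \<Longrightarrow> \<phi> b' \<le> \<phi> b"
  shows "\<exists>c\<in>keys (f \<star> g). \<phi> c = \<phi> a + \<phi> b"
proof -
  define top where "top h m = Abs_poly_mapping (\<lambda>x. lookup h x when \<phi> x = m)" for h :: "'g \<Rightarrow>\<^sub>0 'k" and m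
  have look: "lookup (top h m) x = (lookup h x when \<phi> x = m)" for h m x
    unfolding top_def
    by (subst lookup_Abs_poly_mapping) (auto intro: finite_subset[OF _ finite_keys[of h]] simp: in_keys_iff)
  let ?f = "top f (\<phi> a)" and ?g = "top g (\<phi> b)"
  have keys: "keys (top h m) = {x \<in> keys h. \<phi> x = m}" for h m
    by (auto simp: in_keys_iff look)
  have "?f \<noteq> 0" "?g \<noteq> 0"
    using a(1) b(1) keys by (metis (mono_tags, lifting) empty_iff keys_zero mem_Collect_eq)+
  from tmul_nonzero[OF this] obtain c where c: "c \<in> keys (?f \<star> ?g)"
    by (metis keys_eq_empty ex_in_conv)
  have phi_c: "\<phi> c = \<phi> a + \<phi> b"
    using c keys_tmul[of ?f ?g] by (auto simp: keys add)
  have pair: "\<phi> x = \<phi> a \<and> \<phi> y = \<phi> b" if "x \<in> keys f" "y \<in> keys g" "x + y = c" for x y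
    using a(2)[OF that(1)] b(2)[OF that(2)] phi_c add[of x y] that(3) by simp
  have "lookup (f \<star> g) c = lookup (?f \<star> ?g) c"
  proof -
    have "lookup (?f \<star> ?g) c = (\<Sum>x\<in>keys f. \<Sum>y\<in>keys g.
        lookup ?f x * lookup ?g y * \<sigma> x y when x + y = c)"
      by (subst tmul_superset[of "keys f" "keys g"]) (auto simp: keys lookup_sum lookup_single)
    also have "\<dots> = lookup (f \<star> g) c"
      unfolding lookup_tmul by (intro sum.cong refl) (auto simp: look when_def dest: pair)
    finally show ?thesis by simp
  qed
  with c phi_c show ?thesis by (auto simp: in_keys_iff)
qed

text \<open>Widths of Newton polytopes add under multiplication: the maxima of \<phi> and of its
  negative are both additive. Quantifying over arbitrary exponents spares the callers from choosing
  extremal ones.\<close>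

lemma span_tmul_le:
  fixes \<phi> :: "'g \<Rightarrow> int"
  assumes add: "\<And>a b. \<phi> (a + b) = \<phi> a + \<phi> b"
    and bounds: "\<And>c. c \<in> keys (f \<star> g) \<Longrightarrow> L \<le> \<phi> c \<and> \<phi> c \<le> H"
    and a: "a \<in> keys f" "a' \<in> keys f" and b: "b \<in> keys g" "b' \<in> keys g"
  shows "(\<phi> a - \<phi> a') + (\<phi> b - \<phi> b') \<le> H - L"
proof -
  have nz: "f \<noteq> 0" "g \<noteq> 0" using a b by auto
  have upper: "\<psi> a + \<psi> b \<le> M"
    if \<psi>: "\<And>a b. \<psi> (a + b) = \<psi> a + \<psi> b" and M: "\<And>c. c \<in> keys (f \<star> g) \<Longrightarrow> \<psi> c \<le> M"
      and ab: "a \<in> keys f" "b \<in> keys g" for \<psi> :: "'g \<Rightarrow> int" and M a b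
  proof -
    obtain a0 where a0: "a0 \<in> keys f" "\<And>b. b \<in> keys f \<Longrightarrow> \<psi> b \<le> \<psi> a0"
      using obtain_max_on_keys[OF nz(1), of \<psi>] by blast
    obtain b0 where b0: "b0 \<in> keys g" "\<And>b. b \<in> keys g \<Longrightarrow> \<psi> b \<le> \<psi> b0"
      using obtain_max_on_keys[OF nz(2), of \<psi>] by blast
    from max_in_keys_tmul[of \<psi>, OF \<psi> a0 b0] M have "\<psi> a0 + \<psi> b0 \<le> M" by fastforce
    with a0(2)[OF ab(1)] b0(2)[OF ab(2)] show ?thesis by simp
  qed
  have "\<phi> a + \<phi> b \<le> H" by (rule upper) (use assms in auto)
  moreover have "- \<phi> a' + - \<phi> b' \<le> - L"
    by (rule upper[of "\<lambda>x. - \<phi> x"]) (use assms in auto)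
  ultimately show ?thesis by simp
qed

definition tring :: "('g \<Rightarrow>\<^sub>0 'k) ring" where
  "tring = \<lparr>carrier = UNIV, mult = (\<star>), one = single 0 1, zero = 0, add = (+)\<rparr>"

lemma tring_simps [simp]:
  "carrier tring = UNIV" "mult tring = (\<star>)" "one tring = single 0 1" "zero tring = 0" "add tring = (+)"
  by (simp_all add: tring_def)

lemma ring_tring: "ring tring"
proof (rule ringI)
  show "abelian_group tring"
  proof (rule abelian_groupI)
    show "\<exists>y\<in>carrier tring. y \<oplus>\<^bsub>tring\<^esub> x = \<zero>\<^bsub>tring\<^esub>" for x
      by (auto intro: exI[of _ "- x"])
  qed (auto simp: add_ac)
  show "Group.monoid tring" by (rule monoidI) (auto simp: tmul_assoc)
qed (auto simp: tmul_add_left tmul_add_right)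

lemma tring_a_inv [simp]: "\<ominus>\<^bsub>tring\<^esub> f = - f"
proof -
  interpret ring tring by (rule ring_tring)
  show ?thesis by (rule minus_equality) auto
qed

end

section \<open>Presented algebras\<close>

lemma free_alg_simps:
  "mult (free_alg X) f g = (\<lambda>w. \<Sum>k\<le>length w. f (take k w) * g (drop k w))"
  "one (free_alg X) = scal 1" "zero (free_alg X) = (\<lambda>w. 0)"
  "add (free_alg X) f g = (\<lambda>w. f w + g w)"
  by (auto simp: free_alg_def scal_def)

lemma carrier_free_alg:
  "f \<in> carrier (free_alg X) \<longleftrightarrow> finite {w. f w \<noteq> 0} \<and> (\<forall>w. f w \<noteq> 0 \<longrightarrow> set w \<subseteq> X)"
  by (simp add: free_alg_def)

definition word :: "'g list \<Rightarrow> 'k::field \<Rightarrow> ('g list \<Rightarrow> 'k)" where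
  "word w c = (\<lambda>v. if v = w then c else 0)"

lemma scal_eq_word: "scal c = word [] c"
  and gen_eq_word: "gen x = word [x] 1"
  by (simp_all add: scal_def gen_def word_def)

lemma word_closed: "set w \<subseteq> X \<Longrightarrow> word w c \<in> carrier (free_alg X)"
  by (auto simp: carrier_free_alg word_def)

lemma scal_closed [simp]: "scal c \<in> carrier (free_alg X)"
  and gen_closed: "x \<in> X \<Longrightarrow> gen x \<in> carrier (free_alg X)"
  by (auto simp: scal_eq_word gen_eq_word intro: word_closed)

lemma word_mult:
  "word w c \<otimes>\<^bsub>free_alg X\<^esub> word v d = word (w @ v) (c * d)"
proof -
  have "(\<Sum>k\<le>length u. word w c (take k u) * word v d (drop k u)) = word (w @ v) (c * d) u" for u
  proof (cases "u = w @ v")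
    case True
    have "(\<Sum>k\<le>length u. word w c (take k u) * word v d (drop k u)) =
        (\<Sum>k\<le>length u. if k = length w then c * d else 0)"
      by (intro sum.cong refl) (use True in \<open>auto simp: word_def min_def dest: arg_cong[of _ _ length]\<close>)
    then show ?thesis using True by (simp add: word_def)
  next
    case False
    then have "word w c (take k u) * word v d (drop k u) = 0" for k
      by (auto simp: word_def)
    then have "(\<Sum>k\<le>length u. word w c (take k u) * word v d (drop k u)) = 0"
      by (intro sum.neutral) blast
    then show ?thesis using False by (simp add: word_def)
  qed
  then show ?thesis by (auto simp: free_alg_simps)
qed

lemma free_alg_mult_closed:
  assumes "f \<in> carrier (free_alg X)" "g \<in> carrier (free_alg X)"
  shows "f \<otimes>\<^bsub>free_alg X\<^esub> g \<in> carrier (free_alg X)"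
proof -
  let ?h = "f \<otimes>\<^bsub>free_alg X\<^esub> g"
  have factor: "\<exists>u v. w = u @ v \<and> f u \<noteq> 0 \<and> g v \<noteq> 0" if nz: "?h w \<noteq> 0" for w
  proof -
    obtain k where "f (take k w) * g (drop k w) \<noteq> 0"
      using nz unfolding free_alg_simps by (rule sum.not_neutral_contains_not_neutral)
    then show ?thesis by (intro exI[of _ "take k w"] exI[of _ "drop k w"]) auto
  qed
  have "{w. ?h w \<noteq> 0} \<subseteq> (\<lambda>(u, v). u @ v) ` ({u. f u \<noteq> 0} \<times> {v. g v \<noteq> 0})"
    using factor by fast
  moreover have "finite \<dots>"
    using assms by (auto simp: carrier_free_alg)
  moreover have "set w \<subseteq> X" if "?h w \<noteq> 0" for w
    using factor[OF that] assms unfolding carrier_free_alg by (metis le_sup_iff set_append)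
  ultimately show ?thesis unfolding carrier_free_alg by (auto intro: finite_subset)
qed

lemma free_alg_add_closed:
  assumes "f \<in> carrier (free_alg X)" "g \<in> carrier (free_alg X)"
  shows "f \<oplus>\<^bsub>free_alg X\<^esub> g \<in> carrier (free_alg X)"
proof -
  have "finite ({w. f w \<noteq> 0} \<union> {w. g w \<noteq> 0})"
    using assms by (simp add: carrier_free_alg)
  then have "finite {w. f w + g w \<noteq> 0}"
    by (rule rev_finite_subset) auto
  moreover have "f w \<noteq> 0 \<or> g w \<noteq> 0" if "f w + g w \<noteq> 0" for w
    using that by auto
  ultimately show ?thesis using assms by (auto simp: carrier_free_alg free_alg_simps)
qed

text \<open>Both sides sum over the ways to cut \<open>w\<close> into three consecutive pieces, the
  first two of lengths \<open>l\<close> and \<open>m\<close>; only the order of summation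
  differs.\<close>

lemma free_alg_mult_assoc:
  "(f \<otimes>\<^bsub>free_alg X\<^esub> g) \<otimes>\<^bsub>free_alg X\<^esub> h = f \<otimes>\<^bsub>free_alg X\<^esub> (g \<otimes>\<^bsub>free_alg X\<^esub> h)"
proof (rule ext)
  fix w
  let ?t = "\<lambda>l m. f (take l w) * g (take m (drop l w)) * h (drop (l + m) w)"
  have "((f \<otimes>\<^bsub>free_alg X\<^esub> g) \<otimes>\<^bsub>free_alg X\<^esub> h) w = (\<Sum>k\<le>length w. \<Sum>l\<le>k. ?t l (k - l))"
    by (auto simp: sum_distrib_right min_def take_drop free_alg_simps intro!: sum.cong)
  also have "\<dots> = (\<Sum>(l, m)\<in>{(l, m). l + m \<le> length w}. ?t l m)"
    by (rule sum.triangle_reindex_eq[symmetric])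
  also have "\<dots> = (\<Sum>(l, m)\<in>(SIGMA l:{..length w}. {..length w - l}). ?t l m)"
    by (intro sum.cong) auto
  also have "\<dots> = (f \<otimes>\<^bsub>free_alg X\<^esub> (g \<otimes>\<^bsub>free_alg X\<^esub> h)) w"
    by (simp add: free_alg_simps sum.Sigma[symmetric] sum_distrib_left mult.assoc add.commute)
  finally show "((f \<otimes>\<^bsub>free_alg X\<^esub> g) \<otimes>\<^bsub>free_alg X\<^esub> h) w = (f \<otimes>\<^bsub>free_alg X\<^esub> (g \<otimes>\<^bsub>free_alg X\<^esub> h)) w" .
qed

lemma scal_mult: "mult (free_alg X) (scal c) f = (\<lambda>w. c * f w)"
proof
  fix w
  have "(\<Sum>k\<le>length w. scal c (take k w) * f (drop k w)) = (\<Sum>k\<le>length w. if k = 0 then c * f w else 0)"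
    by (intro sum.cong refl) (auto simp: scal_def)
  then show "mult (free_alg X) (scal c) f w = c * f w" by (simp add: free_alg_simps)
qed

lemma mult_scal: "mult (free_alg X) f (scal c) = (\<lambda>w. f w * c)"
proof
  fix w
  have "(\<Sum>k\<le>length w. f (take k w) * scal c (drop k w)) = (\<Sum>k\<le>length w. if k = length w then f w * c else 0)"
    by (intro sum.cong refl) (auto simp: scal_def)
  then show "mult (free_alg X) f (scal c) w = f w * c" by (simp add: free_alg_simps)
qed

lemma scal_add: "scal (c + d) = scal c \<oplus>\<^bsub>free_alg X\<^esub> scal d"
  by (auto simp: scal_def free_alg_simps)

lemma ring_free_alg: "ring (free_alg X :: ('g list \<Rightarrow> 'k::field) ring)"
proof (rule ringI)
  let ?F = "free_alg X :: ('g list \<Rightarrow> 'k) ring"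
  show "abelian_group ?F"
  proof (rule abelian_groupI)
    show "\<exists>y\<in>carrier ?F. y \<oplus>\<^bsub>?F\<^esub> x = \<zero>\<^bsub>?F\<^esub>" if "x \<in> carrier ?F" for x
      using that by (intro bexI[of _ "\<lambda>w. - x w"]) (auto simp: carrier_free_alg free_alg_simps)
    show "x \<oplus>\<^bsub>?F\<^esub> y \<in> carrier ?F" if "x \<in> carrier ?F" "y \<in> carrier ?F" for x y
      using that by (rule free_alg_add_closed)
  qed (auto simp: carrier_free_alg free_alg_simps add_ac)
  show "Group.monoid ?F"
  proof (rule monoidI)
    show "x \<otimes>\<^bsub>?F\<^esub> y \<in> carrier ?F" if "x \<in> carrier ?F" "y \<in> carrier ?F" for x y
      using that by (rule free_alg_mult_closed)
    show "(x \<otimes>\<^bsub>?F\<^esub> y) \<otimes>\<^bsub>?F\<^esub> z = x \<otimes>\<^bsub>?F\<^esub> (y \<otimes>\<^bsub>?F\<^esub> z)" for x y z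
      by (rule free_alg_mult_assoc)
    show "\<one>\<^bsub>?F\<^esub> \<in> carrier ?F" by (simp add: free_alg_simps)
  qed (simp_all add: free_alg_simps(2) scal_mult mult_scal)
qed (auto simp: free_alg_simps distrib_left distrib_right sum.distrib)

lemma free_alg_word_induct [consumes 1, case_names zero word add]:
  assumes "f \<in> carrier (free_alg X)"
    and zero: "P (\<lambda>w. 0)" and word: "\<And>w c. set w \<subseteq> X \<Longrightarrow> P (word w c)"
    and add: "\<And>g h. g \<in> carrier (free_alg X) \<Longrightarrow> h \<in> carrier (free_alg X) \<Longrightarrow> P g \<Longrightarrow> P h \<Longrightarrow>
      P (g \<oplus>\<^bsub>free_alg X\<^esub> h)"
  shows "P f"
proof -
  have "P f" if "finite A" "A = {w. f w \<noteq> 0}" "f \<in> carrier (free_alg X)" for A and f :: "'a list \<Rightarrow> 'b"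
    using that
  proof (induction A arbitrary: f rule: finite_induct)
    case empty
    then have "f = (\<lambda>w. 0)" by auto
    with zero show ?case by simp
  next
    case (insert w A)
    have eq: "f = word w (f w) \<oplus>\<^bsub>free_alg X\<^esub> f(w := 0)"
      by (auto simp: word_def free_alg_simps)
    have w: "set w \<subseteq> X" using insert by (auto simp: carrier_free_alg)
    have "f(w := 0) \<in> carrier (free_alg X)"
      using insert.prems by (auto simp: carrier_free_alg elim!: rev_finite_subset)
    moreover have "A = {v. (f(w := 0)) v \<noteq> 0}"
      using insert.hyps(2) insert.prems(1) by auto
    ultimately have "f(w := 0) \<in> carrier (free_alg X)" "P (f(w := 0))"
      by (auto intro: insert.IH simp del: fun_upd_apply)
    then show ?case
      by (subst eq) (intro add word word_closed w)
  qed
  with assms(1) show ?thesis by (auto simp: carrier_free_alg)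
qed

lemma free_alg_gen_induct [consumes 1, case_names scal gen add mult]:
  assumes "f \<in> carrier (free_alg X)"
    and scal: "\<And>c. P (scal c)" and gen: "\<And>x. x \<in> X \<Longrightarrow> P (gen x)"
    and add: "\<And>g h. g \<in> carrier (free_alg X) \<Longrightarrow> h \<in> carrier (free_alg X) \<Longrightarrow> P g \<Longrightarrow> P h \<Longrightarrow>
      P (g \<oplus>\<^bsub>free_alg X\<^esub> h)"
    and mult: "\<And>g h. g \<in> carrier (free_alg X) \<Longrightarrow> h \<in> carrier (free_alg X) \<Longrightarrow> P g \<Longrightarrow> P h \<Longrightarrow>
      P (g \<otimes>\<^bsub>free_alg X\<^esub> h)"
  shows "P f"
  using assms(1)
proof (induction f rule: free_alg_word_induct)
  case zero
  show ?case using scal[of 0] by (simp add: scal_def)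
next
  case (word w c)
  then show ?case
  proof (induction w)
    case Nil
    then show ?case using scal[of c] by (simp add: scal_eq_word)
  next
    case (Cons x w)
    then have "P (gen x \<otimes>\<^bsub>free_alg X\<^esub> word w c)"
      by (intro mult gen gen_closed word_closed) auto
    then show ?case by (simp only: gen_eq_word word_mult) simp
  qed
qed (rule add)

text \<open>An algebra over the field, encoded by its central structure map; this is the form in
  which \<open>pres_alg_hom\<close> expresses linearity.\<close>

locale scalar_ring = ring R for R (structure) +
  fixes sc :: "'k::field \<Rightarrow> 'a"
  assumes sc_closed [simp]: "sc c \<in> carrier R"
    and sc_add: "sc (c + d) = sc c \<oplus> sc d"
    and sc_mult: "sc (c * d) = sc c \<otimes> sc d"
    and sc_one: "sc 1 = \<one>"
    and sc_central: "x \<in> carrier R \<Longrightarrow> sc c \<otimes> x = x \<otimes> sc c"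

lemma zero_pres_alg: "\<zero>\<^bsub>pres_alg X R\<^esub> = genideal (free_alg X) R"
  by (simp add: pres_alg_def FactRing_def)

lemma carrier_pres_alg: "carrier (pres_alg X R) = a_rcosets\<^bsub>free_alg X\<^esub> (genideal (free_alg X) R)"
  by (simp add: pres_alg_def FactRing_def)

locale presentation =
  fixes X :: "'g set" and Rels :: "('g list \<Rightarrow> 'k::field) set"
  assumes Rels_closed: "Rels \<subseteq> carrier (free_alg X)"
begin

abbreviation "F \<equiv> free_alg X :: ('g list \<Rightarrow> 'k) ring"
abbreviation "I \<equiv> genideal F Rels"
abbreviation "cls f \<equiv> I +>\<^bsub>F\<^esub> f"

sublocale F: ring F by (rule ring_free_alg)

lemma ideal_I: "ideal I F"
  using Rels_closed by (rule F.genideal_ideal)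

lemma cls_hom: "ring_hom_ring F (pres_alg X Rels) cls"
  unfolding pres_alg_def using ideal.rcos_ring_hom_ring[OF ideal_I] .

sublocale cls: ring_hom_ring F "pres_alg X Rels" cls by (rule cls_hom)

lemma cls_rel:
  assumes "r \<in> Rels"
  shows "cls r = \<zero>\<^bsub>pres_alg X Rels\<^esub>"
proof -
  have "abelian_subgroup I F"
    using ideal.axioms(1)[OF ideal_I] F.abelian_group_axioms by (rule abelian_subgroupI3)
  moreover have "r \<in> I" using F.genideal_self[OF Rels_closed] assms by blast
  ultimately have "cls r = I" by (rule abelian_subgroup.a_rcos_const)
  then show ?thesis by (simp only: zero_pres_alg)
qed

lemma pres_alg_cases:
  assumes "s \<in> carrier (pres_alg X Rels)"
  obtains f where "f \<in> carrier F" "s = cls f"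
  using assms by (auto simp only: carrier_pres_alg A_RCOSETS_def')

lemma scalar_ring_pres_alg: "scalar_ring (pres_alg X Rels) (pres_scal X Rels)"
proof (intro scalar_ring.intro scalar_ring_axioms.intro)
  show "ring (pres_alg X Rels)" ..
  show "pres_scal X Rels c \<in> carrier (pres_alg X Rels)" for c
    unfolding pres_scal_def by (rule cls.hom_closed) (rule scal_closed)
  show "pres_scal X Rels (c + d) = pres_scal X Rels c \<oplus>\<^bsub>pres_alg X Rels\<^esub> pres_scal X Rels d" for c d
    unfolding pres_scal_def by (subst cls.hom_add[symmetric]) (simp_all add: scal_add[of c d X])
  show "pres_scal X Rels (c * d) = pres_scal X Rels c \<otimes>\<^bsub>pres_alg X Rels\<^esub> pres_scal X Rels d" for c d
    unfolding pres_scal_def by (subst cls.hom_mult[symmetric]) (auto simp: scal_eq_word word_mult word_closed)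
  show "pres_scal X Rels 1 = \<one>\<^bsub>pres_alg X Rels\<^esub>"
    unfolding pres_scal_def using cls.hom_one by (simp add: free_alg_simps)
  show "pres_scal X Rels c \<otimes>\<^bsub>pres_alg X Rels\<^esub> s = s \<otimes>\<^bsub>pres_alg X Rels\<^esub> pres_scal X Rels c"
    if s: "s \<in> carrier (pres_alg X Rels)" for c s
  proof -
    obtain f where f: "f \<in> carrier F" "s = cls f" using s by (rule pres_alg_cases)
    have "scal c \<otimes>\<^bsub>F\<^esub> f = f \<otimes>\<^bsub>F\<^esub> scal c"
      by (simp only: scal_mult mult_scal mult.commute)
    then show ?thesis
      unfolding pres_scal_def f(2) using f(1) cls.hom_mult[of "scal c" f] cls.hom_mult[of f "scal c"]
      by simp
  qed
qed

lemma pres_alg_gen_induct [consumes 1, case_names scal gen add mult]: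
  assumes "s \<in> carrier (pres_alg X Rels)"
    and scal: "\<And>c. P (pres_scal X Rels c)" and gen: "\<And>x. x \<in> X \<Longrightarrow> P (cls (gen x))"
    and add: "\<And>s t. s \<in> carrier (pres_alg X Rels) \<Longrightarrow> t \<in> carrier (pres_alg X Rels) \<Longrightarrow> P s \<Longrightarrow> P t \<Longrightarrow>
      P (s \<oplus>\<^bsub>pres_alg X Rels\<^esub> t)"
    and mult: "\<And>s t. s \<in> carrier (pres_alg X Rels) \<Longrightarrow> t \<in> carrier (pres_alg X Rels) \<Longrightarrow> P s \<Longrightarrow> P t \<Longrightarrow>
      P (s \<otimes>\<^bsub>pres_alg X Rels\<^esub> t)"
  shows "P s"
proof -
  obtain f where f: "f \<in> carrier F" "s = cls f" using assms(1) by (rule pres_alg_cases)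
  from f(1) have "P (cls f)"
  proof (induction f rule: free_alg_gen_induct)
    case (scal c)
    show ?case using assms(2) by (simp add: pres_scal_def)
  next
    case (add g h)
    then show ?case by (subst cls.hom_add) (auto intro: assms(4))
  next
    case (mult g h)
    then show ?case by (subst cls.hom_mult) (auto intro: assms(5))
  qed (rule gen)
  with f(2) show ?thesis by simp
qed

text \<open>The universal property of the presentation: a map that kills the relators kills the
  ideal they generate and is thus constant on cosets.\<close>

lemma pres_alg_lift:
  assumes "ring R" and h: "h \<in> ring_hom F R" and rel: "\<And>r. r \<in> Rels \<Longrightarrow> h r = \<zero>\<^bsub>R\<^esub>"
  shows "\<exists>\<Phi>\<in>ring_hom (pres_alg X Rels) R. \<forall>f\<in>carrier F. \<Phi> (cls f) = h f"
proof -
  interpret R: ring R by fact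
  interpret h: ring_hom_ring F R h
    by (rule ring_hom_ringI2[OF F.ring_axioms R.ring_axioms h])
  have "I \<subseteq> a_kernel F R h"
    by (rule F.genideal_minimal[OF h.kernel_is_ideal])
      (use rel Rels_closed in \<open>unfold a_kernel_def' subset_iff mem_Collect_eq, blast\<close>)
  then have zero: "h i = \<zero>\<^bsub>R\<^esub>" if "i \<in> I" for i
    using that unfolding a_kernel_def' by blast
  have const: "h g = h f" if f: "f \<in> carrier F" and g: "g \<in> cls f" for f g
  proof -
    from g obtain i where i: "i \<in> I" "g = i \<oplus>\<^bsub>F\<^esub> f" by (auto simp: a_r_coset_def')
    moreover have "i \<in> carrier F" using i(1) ideal.Icarr[OF ideal_I] by blast
    ultimately show ?thesis using f zero by simp
  qed
  have self: "f \<in> cls f" if "f \<in> carrier F" for f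
    using that by (rule abelian_subgroup.a_rcos_self[OF abelian_subgroupI3[OF ideal.axioms(1)[OF ideal_I] F.abelian_group_axioms]])
  have eq: "the_elem (h ` cls f) = h f" if f: "f \<in> carrier F" for f
    by (rule the_elem_image_unique) (use self[OF f] const[OF f] in blast)+
  show ?thesis
  \<comment> \<open>By \<open>const\<close> the image of a coset under \<open>h\<close> is a
    singleton, so \<open>the_elem\<close> picks the common value without choosing a
    representative.\<close>
  proof (intro bexI[of _ "\<lambda>C. the_elem (h ` C)"] ballI)
    show "the_elem (h ` cls f) = h f" if "f \<in> carrier F" for f using that by (rule eq)
    have mult: "cls f \<otimes>\<^bsub>pres_alg X Rels\<^esub> cls g = cls (f \<otimes>\<^bsub>F\<^esub> g)"
      and add: "cls f \<oplus>\<^bsub>pres_alg X Rels\<^esub> cls g = cls (f \<oplus>\<^bsub>F\<^esub> g)"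
      if "f \<in> carrier F" "g \<in> carrier F" for f g
      using cls.hom_mult cls.hom_add that by metis+
    show "(\<lambda>C. the_elem (h ` C)) \<in> ring_hom (pres_alg X Rels) R"
    proof (rule ring_hom_memI)
      show "the_elem (h ` \<one>\<^bsub>pres_alg X Rels\<^esub>) = \<one>\<^bsub>R\<^esub>"
        using eq[OF F.one_closed] cls.hom_one h.hom_one by simp
    next
      fix s assume "s \<in> carrier (pres_alg X Rels)"
      then obtain f where f: "f \<in> carrier F" "s = cls f" by (rule pres_alg_cases)
      then show "the_elem (h ` s) \<in> carrier R" by (simp add: eq)
      fix t assume "t \<in> carrier (pres_alg X Rels)"
      then obtain g where g: "g \<in> carrier F" "t = cls g" by (rule pres_alg_cases)
      show "the_elem (h ` (s \<otimes>\<^bsub>pres_alg X Rels\<^esub> t)) = the_elem (h ` s) \<otimes>\<^bsub>R\<^esub> the_elem (h ` t)"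
        unfolding f g using f(1) g(1) by (simp only: eq mult F.m_closed h.hom_mult)
      show "the_elem (h ` (s \<oplus>\<^bsub>pres_alg X Rels\<^esub> t)) = the_elem (h ` s) \<oplus>\<^bsub>R\<^esub> the_elem (h ` t)"
        unfolding f g using f(1) g(1) by (simp only: eq add F.a_closed h.hom_add)
    qed
  qed
qed

end

section \<open>Evaluation of noncommutative polynomials in a twisted group algebra\<close>

context twisted_group_algebra
begin

definition word_prod :: "('x \<Rightarrow> 'g \<Rightarrow>\<^sub>0 'k) \<Rightarrow> 'x list \<Rightarrow> ('g \<Rightarrow>\<^sub>0 'k)" where
  "word_prod a w = foldr (\<lambda>x r. a x \<star> r) w (single 0 1)"

definition eval_at :: "('x \<Rightarrow> 'g \<Rightarrow>\<^sub>0 'k) \<Rightarrow> ('x list \<Rightarrow> 'k) \<Rightarrow> ('g \<Rightarrow>\<^sub>0 'k)" where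
  "eval_at a f = (\<Sum>w | f w \<noteq> 0. single 0 (f w) \<star> word_prod a w)"

lemma word_prod_append: "word_prod a (v @ w) = word_prod a v \<star> word_prod a w"
  by (induction v) (auto simp: word_prod_def tmul_assoc)

lemma eval_at_superset:
  assumes "finite A" "{w. f w \<noteq> 0} \<subseteq> A"
  shows "eval_at a f = (\<Sum>w\<in>A. single 0 (f w) \<star> word_prod a w)"
  unfolding eval_at_def using assms by (intro sum.mono_neutral_left) auto

lemma eval_at_word: "eval_at a (word w c) = single 0 c \<star> word_prod a w"
  by (subst eval_at_superset[of "{w}"]) (auto simp: word_def)

lemma eval_at_scal [simp]: "eval_at a (scal c) = single 0 c"
  and eval_at_gen [simp]: "eval_at a (gen x) = a x"
  by (simp_all add: scal_eq_word gen_eq_word eval_at_word word_prod_def)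

lemma eval_at_add:
  assumes "f \<in> carrier (free_alg X)" "g \<in> carrier (free_alg X)"
  shows "eval_at a (f \<oplus>\<^bsub>free_alg X\<^esub> g) = eval_at a f + eval_at a g"
proof -
  let ?A = "{w. f w \<noteq> 0} \<union> {w. g w \<noteq> 0}"
  have "finite ?A" using assms by (auto simp: carrier_free_alg)
  then show ?thesis
    by (subst (1 2 3) eval_at_superset[of ?A]) (auto simp: free_alg_simps single_add tmul_add_left sum.distrib)
qed

lemma eval_at_mult:
  fixes f g :: "'x list \<Rightarrow> 'k"
  assumes "f \<in> carrier (free_alg X)" "g \<in> carrier (free_alg X)"
  shows "eval_at a (f \<otimes>\<^bsub>free_alg X\<^esub> g) = eval_at a f \<star> eval_at a g"
proof -
  interpret F: ring "free_alg X :: ('x list \<Rightarrow> 'k) ring" by (rule ring_free_alg)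
  have z: "(\<lambda>w. 0) = \<zero>\<^bsub>free_alg X\<^esub>" by (simp add: free_alg_simps)
  have z0: "eval_at a \<zero>\<^bsub>free_alg X\<^esub> = 0" by (simp add: eval_at_def free_alg_simps)
  from assms(1) show ?thesis
  proof (induction f rule: free_alg_word_induct)
    case zero
    then show ?case using assms by (simp only: z F.l_null z0 tmul_zero)
  next
    case (word w c)
    note w = word
    from assms(2) show ?case
    proof (induction g rule: free_alg_word_induct)
      case zero
      then show ?case using word_closed[OF w, of c] by (simp only: z F.r_null z0 tmul_zero)
    next
      case (word v d)
      have "single 0 (c * d) \<star> (word_prod a w \<star> word_prod a v)
          = single 0 c \<star> (word_prod a w \<star> single 0 d) \<star> word_prod a v"
        by (simp add: scalar_commute[of d "word_prod a w", symmetric] flip: tmul_assoc)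
      then show ?case by (simp only: word_mult eval_at_word word_prod_append tmul_assoc)
    next
      case (add g h)
      then show ?case using word_closed[OF w, of c]
        by (simp only: F.r_distr eval_at_add[of _ X] F.m_closed tmul_add_right)
    qed
  next
    case (add f h)
    then show ?case using assms(2)
      by (simp only: F.l_distr eval_at_add[of _ X] F.m_closed tmul_add_left)
  qed
qed

lemma eval_at_hom: "eval_at a \<in> ring_hom (free_alg X) tring"
  by (rule ring_hom_memI)
    (simp_all only: tring_simps eval_at_add eval_at_mult eval_at_scal free_alg_simps(2) UNIV_I)

end

section \<open>The quantum torus\<close>

text \<open>Position \<open>2 k\<close> of an exponent vector is the exponent of \<open>u\<^sub>k\<close>, position \<open>2 k + 1\<close> that of \<open>x\<^sub>k\<close>.\<close>

type_synonym exponent = "nat \<Rightarrow>\<^sub>0 int"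

definition ue :: "exponent \<Rightarrow> nat \<Rightarrow> int" where "ue a k = lookup a (2 * k)"
definition xe :: "exponent \<Rightarrow> nat \<Rightarrow> int" where "xe a k = lookup a (Suc (2 * k))"

abbreviation \<mu> :: "nat \<Rightarrow> exponent" where "\<mu> k \<equiv> single (2 * k) 1"
abbreviation \<xi> :: "nat \<Rightarrow> exponent" where "\<xi> k \<equiv> single (Suc (2 * k)) 1"

lemma exponent_simps [simp]:
  "ue (a + b) k = ue a k + ue b k" "xe (a + b) k = xe a k + xe b k"
  "ue (- a) k = - ue a k" "xe (- a) k = - xe a k"
  "ue (a - b) k = ue a k - ue b k" "xe (a - b) k = xe a k - xe b k"
  "ue 0 k = 0" "xe 0 k = 0"
  "ue (single (2 * j) z) k = (if j = k then z else 0)" "xe (single (2 * j) z) k = 0"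
  "ue (single (Suc (2 * j)) z) k = 0" "xe (single (Suc (2 * j)) z) k = (if j = k then z else 0)"
  by (auto simp: ue_def xe_def lookup_add lookup_minus lookup_single when_def) presburger+

lemma exponent_eqI: "(\<And>k. ue a k = ue b k) \<Longrightarrow> (\<And>k. xe a k = xe b k) \<Longrightarrow> a = b"
proof (rule poly_mapping_eqI)
  fix k
  assume "\<And>k. ue a k = ue b k" "\<And>k. xe a k = xe b k"
  then show "lookup a k = lookup b k"
    by (cases "even k") (auto simp: ue_def xe_def elim!: evenE oddE)
qed

text \<open>The type of exponents has room for infinitely many factors and so serves every
  \<open>n\<close>; this is the sublattice of rank \<open>2 * n\<close> belonging to
  \<open>n\<close> factors.\<close>

definition rank_le :: "nat \<Rightarrow> exponent set" where
  "rank_le n = {a. \<forall>k\<ge>n. ue a k = 0 \<and> xe a k = 0}"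

lemma rank_leD: "a \<in> rank_le n \<Longrightarrow> k \<ge> n \<Longrightarrow> ue a k = 0" "a \<in> rank_le n \<Longrightarrow> k \<ge> n \<Longrightarrow> xe a k = 0"
  by (auto simp: rank_le_def)

lemma rank_le_simps [simp]:
  "0 \<in> rank_le n" "a \<in> rank_le n \<Longrightarrow> b \<in> rank_le n \<Longrightarrow> a + b \<in> rank_le n"
  "a \<in> rank_le n \<Longrightarrow> b \<in> rank_le n \<Longrightarrow> a - b \<in> rank_le n"
  "a \<in> rank_le n \<Longrightarrow> - a \<in> rank_le n"
  "k < n \<Longrightarrow> single (2 * k) z \<in> rank_le n" "k < n \<Longrightarrow> single (Suc (2 * k)) z \<in> rank_le n"
  by (auto simp: rank_le_def)

lemma rank_le_eqI:
  assumes "a \<in> rank_le n" "b \<in> rank_le n" "\<And>k. k < n \<Longrightarrow> ue a k = ue b k" "\<And>k. k < n \<Longrightarrow> xe a k = xe b k"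
  shows "a = b"
  by (rule exponent_eqI) (metis assms leI rank_leD)+

locale quantum_torus =
  fixes q :: "'k::field" and n :: nat
  assumes q_nonzero [simp]: "q \<noteq> 0" and q_not_root: "m > 0 \<Longrightarrow> q ^ m \<noteq> 1"
begin

lemma q_power_int_eq_1: "q powi z = 1 \<longleftrightarrow> z = 0"
proof
  assume *: "q powi z = 1"
  show "z = 0"
  proof (rule ccontr)
    assume "z \<noteq> 0"
    then have "nat \<bar>z\<bar> > 0" by simp
    moreover have "q ^ nat \<bar>z\<bar> = 1" using * by (auto simp: power_int_def abs_if power_inverse split: if_splits)
    ultimately show False using q_not_root by blast
  qed
qed simp

lemma q_power_int_inject: "q powi z = q powi z' \<longleftrightarrow> z = z'"
  using q_power_int_eq_1[of "z - z'"] by (auto simp: power_int_diff)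

lemma q_ne_1 [simp]: "q \<noteq> 1" "q - 1 \<noteq> 0" and q_plus_1 [simp]: "q + 1 \<noteq> 0" "1 + q \<noteq> 0"
proof -
  show "q \<noteq> 1" "q - 1 \<noteq> 0" using q_not_root[of 1] by auto
  have "q\<^sup>2 \<noteq> 1" using q_not_root[of 2] by simp
  then show "q + 1 \<noteq> 0" "1 + q \<noteq> 0"
    by (auto simp: add_eq_0_iff add_eq_0_iff2 minus_equation_iff[of q])
qed

text \<open>Monomials are ordered with the \<open>u\<^sub>k\<close> to the left, and \<open>x\<^sub>k u\<^sub>k = q\<^sup>-\<^sup>1 u\<^sub>k x\<^sub>k\<close>.\<close>

definition tw :: "exponent \<Rightarrow> exponent \<Rightarrow> 'k" where
  "tw a b = q powi (- (\<Sum>k<n. xe a k * ue b k))"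

sublocale twisted_group_algebra tw
  by unfold_locales
    (auto simp: tw_def distrib_left distrib_right sum.distrib power_int_add power_int_minus power_int_diff divide_simps)

notation tmul (infixl \<open>\<star>\<close> 70)

text \<open>The skew form of the torus: monomials with exponents \<open>a\<close> and
  \<open>b\<close> commute up to the factor \<open>q powi omega a b\<close>, see
  \<open>tw_swap\<close>.\<close>

definition omega :: "exponent \<Rightarrow> exponent \<Rightarrow> int" where
  "omega a b = (\<Sum>k<n. xe b k * ue a k) - (\<Sum>k<n. xe a k * ue b k)"

lemma omega_simps:
  "omega (a + b) c = omega a c + omega b c" "omega a (b + c) = omega a b + omega a c"
  "omega 0 c = 0" "omega c 0 = 0"
  by (auto simp: omega_def algebra_simps sum.distrib)

lemma tw_swap: "tw a b = q powi omega a b * tw b a"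
  by (simp add: tw_def omega_def flip: power_int_add)

text \<open>Passing a monomial multiplies each term of \<open>f\<close> by its own power of
  \<open>q\<close>. As \<open>q\<close> is not a root of unity, equal powers have equal exponents,
  so every term of \<open>f\<close> satisfies the same linear equation.\<close>

lemma omega_eq_of_q_commute:
  assumes comm: "single m c \<star> f = single 0 (q powi z) \<star> (f \<star> single m c)"
    and "c \<noteq> 0" "a \<in> keys f"
  shows "omega m a = z"
proof -
  have "(c * lookup f a) * tw m a = (c * lookup f a) * (q powi z * tw a m)"
  proof -
    have "lookup (single m c \<star> f) (m + a) = q powi z * lookup (f \<star> single m c) (a + m)"
      by (simp only: comm lookup_scalar add.commute)
    then show ?thesis by (simp only: lookup_monomial_left lookup_monomial_right mult_ac)
  qed
  then have "tw m a = q powi z * tw a m"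
    using assms(2,3) by (subst (asm) mult_left_cancel) (auto simp: in_keys_iff)
  then show ?thesis unfolding tw_swap[of m a]
    by (simp add: q_power_int_inject)
qed

lemma single_of_constant_coords:
  fixes f :: "exponent \<Rightarrow>\<^sub>0 'k"
  assumes "f \<noteq> 0" "\<And>a b k. a \<in> keys f \<Longrightarrow> b \<in> keys f \<Longrightarrow> lookup a k = lookup b k"
  obtains a c where "c \<noteq> 0" "f = single a c"
proof -
  obtain a where a: "a \<in> keys f" using assms(1) by (metis keys_eq_empty ex_in_conv)
  have "keys f = {a}" using a assms(2) by (auto intro: poly_mapping_eqI)
  then have "f = single a (lookup f a)"
    using sum_single_lookup[of f] by simp
  with a that show ?thesis by (metis in_keys_iff)
qed

text \<open>The product has width zero in every coordinate direction, and widths add, so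
  \<open>f\<close> has width zero as well.\<close>

lemma unit_is_monomial:
  assumes "f \<star> g = single 0 1"
  obtains a c where "c \<noteq> 0" "f = single a c"
proof (rule single_of_constant_coords[of f])
  show "f \<noteq> 0" using assms by (metis tmul_zero(1) single_zero lookup_single_eq lookup_zero zero_neq_one)
  have "g \<noteq> 0" using assms by (metis tmul_zero(2) single_zero lookup_single_eq lookup_zero zero_neq_one)
  then obtain b where b: "b \<in> keys g" by (metis keys_eq_empty ex_in_conv)
  have "lookup a k \<le> lookup a' k" if "a \<in> keys f" "a' \<in> keys f" for a a' k
    using span_tmul_le[of "\<lambda>a. lookup a k" f g 0 0, OF lookup_add _ that b b] by (simp add: assms)
  then show "lookup a k = lookup a' k" if "a \<in> keys f" "a' \<in> keys f" for a a' k
    using that by (simp add: order_antisym)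
qed

end

section \<open>The action on functions on a lattice\<close>

locale torus_module = quantum_torus q n for q :: "'k::field" and n +
  fixes \<beta> :: "nat \<Rightarrow> 'k"
  assumes \<beta>_nonzero: "k < n \<Longrightarrow> \<beta> k \<noteq> 0"
begin

text \<open>\<open>x\<^sub>k\<close> shifts the \<open>k\<close>-th coordinate and \<open>u\<^sub>k\<close> is diagonal with eigenvalues \<open>\<beta>\<^sub>k q\<^sup>b\<close>, so that
  \<open>y\<^sub>k\<close> (\<open>ygen k\<close> below) kills the lowest weight vectors of the submodule supported on \<open>b\<^sub>k \<ge> 0\<close>.\<close>

definition eigen :: "exponent \<Rightarrow> (nat \<Rightarrow> int) \<Rightarrow> 'k" where
  "eigen a b = (\<Prod>k<n. (\<beta> k * q powi b k) powi ue a k)"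

definition act :: "(exponent \<Rightarrow>\<^sub>0 'k) \<Rightarrow> ((nat \<Rightarrow> int) \<Rightarrow> 'k) \<Rightarrow> (nat \<Rightarrow> int) \<Rightarrow> 'k" where
  "act f v b = (\<Sum>a\<in>keys f. lookup f a * eigen a b * v (\<lambda>k. b k - xe a k))"

lemma eigen_nonzero: "eigen a b \<noteq> 0"
  by (auto simp: eigen_def \<beta>_nonzero)

text \<open>The module axiom on monomials: moving the shift of \<open>a\<close> past the diagonal
  part of \<open>a'\<close> costs the power of \<open>q\<close> recorded in
  \<open>tw\<close>.\<close>

lemma eigen_cocycle: "eigen (a + a') b * tw a a' = eigen a b * eigen a' (\<lambda>k. b k - xe a k)"
proof -
  have "(\<beta> k * q powi (b k - xe a k)) powi ue a' k = (\<beta> k * q powi b k) powi ue a' k * q powi (- (xe a k * ue a' k))"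
    if "k < n" for k
    using \<beta>_nonzero[OF that]
    by (simp add: power_int_diff power_int_mult power_int_minus power_int_divide_distrib divide_inverse power_int_mult_distrib power_int_inverse)
  then have "eigen a' (\<lambda>k. b k - xe a k) = (\<Prod>k<n. (\<beta> k * q powi b k) powi ue a' k) * (\<Prod>k<n. q powi (- (xe a k * ue a' k)))"
    unfolding eigen_def by (simp add: prod.distrib)
  also have "(\<Prod>k<n. q powi (- (xe a k * ue a' k))) = tw a a'"
  proof -
    have "(\<Prod>k<m. q powi (- (xe a k * ue a' k))) = q powi (- (\<Sum>k<m. xe a k * ue a' k))" for m
      by (induction m) (simp_all add: power_int_add power_int_diff power_int_minus field_simps)
    then show ?thesis by (simp add: tw_def)
  qed
  finally show ?thesis
    using \<beta>_nonzero by (simp add: eigen_def power_int_add prod.distrib)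
qed

lemma act_superset:
  "finite A \<Longrightarrow> keys f \<subseteq> A \<Longrightarrow>
    act f v b = (\<Sum>a\<in>A. lookup f a * eigen a b * v (\<lambda>k. b k - xe a k))"
  unfolding act_def by (intro sum.mono_neutral_left) (auto simp: in_keys_iff)

lemma act_add: "act (f + g) v b = act f v b + act g v b"
  by (simp add: act_superset[of "keys f \<union> keys g"] Poly_Mapping.keys_add lookup_add distrib_right sum.distrib)

lemma act_zero [simp]: "act 0 v b = 0" "act f (\<lambda>_. 0) b = 0"
  by (simp_all add: act_def)

lemma act_add_right: "act f (\<lambda>b. v b + w b) b = act f v b + act f w b"
  by (simp add: act_def distrib_left sum.distrib)

lemma act_single [simp]: "act (single a c) v b = c * eigen a b * v (\<lambda>k. b k - xe a k)"
  by (simp add: act_superset[of "{a}"])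

lemma act_diff: "act (f - g) v b = act f v b - act g v b"
  using act_add[of "f - g" g v b] by simp

lemma act_tmul: "act (f \<star> g) v b = act f (act g v) b"
proof (induction f rule: poly_mapping_additive_induct)
  case (single a c)
  show ?case
  proof (induction g rule: poly_mapping_additive_induct)
    case (single a' d)
    have "c * d * (tw a a' * eigen (a + a') b) * v (\<lambda>k. b k - (xe a k + xe a' k)) =
      c * d * (eigen a b * eigen a' (\<lambda>k. b k - xe a k)) * v (\<lambda>k. b k - (xe a k + xe a' k))"
      using eigen_cocycle[of a a' b] by (simp add: mult.commute)
    then show ?case by (simp add: algebra_simps)
  next
    case (add g h)
    have "act (g + h) v = (\<lambda>b. act g v b + act h v b)" by (auto simp: act_add)
    with add show ?case by (simp only: tmul_add_right act_add act_add_right)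
  qed (auto simp: fun_eq_iff)
qed (auto simp: tmul_add_left act_add)

section \<open>Half-lattice submodules and the subalgebra that preserves them\<close>

definition supported :: "nat \<Rightarrow> ((nat \<Rightarrow> int) \<Rightarrow> 'k) \<Rightarrow> bool" where
  "supported k v \<longleftrightarrow> (\<forall>b. b k < 0 \<longrightarrow> v b = 0)"

text \<open>A subalgebra of the torus that contains the images of all generators of the target
  algebra (\<open>gen_image_preserving\<close>) but no nonzero monomial of negative degree in some
  \<open>x_k\<close> (\<open>preserving_monomial_degree\<close>).\<close>

definition preserving :: "(exponent \<Rightarrow>\<^sub>0 'k) set" where
  "preserving = {f. keys f \<subseteq> rank_le n \<and> (\<forall>k<n. \<forall>v. supported k v \<longrightarrow> supported k (act f v))}"

lemma preserving_add: "f \<in> preserving \<Longrightarrow> g \<in> preserving \<Longrightarrow> f + g \<in> preserving"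
  using Poly_Mapping.keys_add[of f g] by (auto simp: preserving_def supported_def act_add)

lemma preserving_tmul:
  assumes "f \<in> preserving" "g \<in> preserving"
  shows "f \<star> g \<in> preserving"
proof -
  have "keys (f \<star> g) \<subseteq> rank_le n"
    using keys_tmul[of f g] assms by (force simp: preserving_def)
  moreover have "supported k (act (f \<star> g) v)" if "k < n" "supported k v" for k v
  proof -
    have "act (f \<star> g) v = act f (act g v)" by (auto simp: act_tmul)
    with that assms show ?thesis by (simp add: preserving_def)
  qed
  ultimately show ?thesis by (simp add: preserving_def)
qed

lemma preserving_single:
  "a \<in> rank_le n \<Longrightarrow> (\<And>k. k < n \<Longrightarrow> xe a k \<ge> 0) \<Longrightarrow> single a c \<in> preserving"
  by (force simp: preserving_def supported_def)

text \<open>The solution \<open>y\<close> of \<open>u = (q - 1) x y + \<beta>\<close> in the torus,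
  namely \<open>x^-1 (u - \<beta>) / (q - 1)\<close>. Writing \<open>u\<close> to the left turns
  \<open>x^-1 u\<close> into \<open>q u x^-1\<close>, whence the factor \<open>q\<close>.\<close>

definition ygen :: "nat \<Rightarrow> (exponent \<Rightarrow>\<^sub>0 'k)" where
  "ygen k = single (\<mu> k - \<xi> k) (q / (q - 1)) - single (- \<xi> k) (\<beta> k / (q - 1))"

lemma preserving_ygen:
  assumes k: "k < n"
  shows "ygen k \<in> preserving"
proof -
  have "keys (ygen k) \<subseteq> rank_le n"
    unfolding ygen_def by (rule order_trans[OF keys_diff]) (use k in auto)
  moreover have "supported l (act (ygen k) v)" if l: "l < n" and v: "supported l v" for l v
  proof -
    have "act (ygen k) v b = 0" if b: "b l < 0" for b
    proof (cases "l = k \<and> b k = -1")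
      \<comment> \<open>Only here does the operator read a value from inside the half-lattice while
        computing one outside. The eigenvalue of \<open>u_k\<close> is \<open>\<beta> k / q\<close>,
        and the two terms of \<open>ygen k\<close> cancel.\<close>
      case True
      have "eigen (\<mu> k - \<xi> k) b = (\<Prod>j<n. if j = k then \<beta> k * q powi b k else 1)"
        unfolding eigen_def by (intro prod.cong) auto
      also have "\<dots> = \<beta> k * q powi b k" using k by simp
      finally have "eigen (\<mu> k - \<xi> k) b = \<beta> k / q" using True by (simp add: divide_inverse)
      moreover have "eigen (- \<xi> k) b = 1" by (simp add: eigen_def)
      ultimately show ?thesis by (simp add: ygen_def act_diff)
    next
      case False
      then have "b l - xe (\<mu> k - \<xi> k) l < 0" "b l - xe (- \<xi> k) l < 0" using b by auto
      with v show ?thesis by (simp add: ygen_def act_diff supported_def del: exponent_simps)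
    qed
    then show ?thesis by (simp add: supported_def)
  qed
  ultimately show ?thesis by (simp add: preserving_def)
qed

text \<open>Monomials act by a shift and nonzero eigenvalues, so one of negative degree would carry
  the indicator function of the half-lattice across its boundary.\<close>

lemma preserving_monomial_degree:
  assumes "single a c \<in> preserving" "c \<noteq> 0" "k < n"
  shows "xe a k \<ge> 0"
proof (rule ccontr)
  assume neg: "\<not> xe a k \<ge> 0"
  let ?v = "\<lambda>b. if b k < (0::int) then 0 else (1::'k)"
  have "supported k (act (single a c) ?v)"
    using assms unfolding preserving_def by (auto simp: supported_def simp del: act_single)
  then have "act (single a c) ?v (\<lambda>_. -1) = 0" unfolding supported_def by (auto simp del: act_single)
  with neg \<open>c \<noteq> 0\<close> show False by (simp add: eigen_nonzero)
qed

text \<open>At points with \<open>b k = -1\<close> a homogeneous \<open>f\<close> of negative degree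
  reads \<open>v\<close> only inside the half-lattice. Cutting \<open>v\<close> off outside changes
  nothing there, and the cut-off function has an image supported in the half-lattice.\<close>

lemma vanishing_of_negative_degree:
  assumes "f \<in> preserving" "k < n" and hom: "\<And>a j. a \<in> keys f \<Longrightarrow> xe a j = D j" and "D k < 0" "b k = -1"
  shows "act f v b = 0"
proof -
  let ?w = "\<lambda>b. if b k < 0 then 0 else v b"
  have "supported k (act f ?w)" using assms by (auto simp: preserving_def supported_def)
  then have "act f ?w b = 0" using \<open>b k = -1\<close> by (simp add: supported_def)
  moreover have "act f ?w b = act f v b"
    unfolding act_def by (intro sum.cong refl) (use assms in auto)
  ultimately show ?thesis by simp
qed

text \<open>On the hyperplane \<open>b k = -1\<close> the product acts by zero, so the eigenvalue of
  the monomial \<open>m\<close> is constant there. Letting \<open>b l\<close> vary kills the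
  exponent of \<open>u_l\<close> for \<open>l \<noteq> k\<close>; the surviving eigenvalue gives the
  equation.\<close>

lemma vanishing_binomial:
  assumes f: "f \<in> preserving" "k < n" "\<And>a j. a \<in> keys f \<Longrightarrow> xe a j = D j" "D k < 0"
    and fg: "f \<star> g = single m c - single 0 d" and m: "\<And>j. xe m j = 0" and "c \<noteq> 0" "d \<noteq> 0"
  shows "l < n \<Longrightarrow> l \<noteq> k \<Longrightarrow> ue m l = 0" and "c * (\<beta> k / q) powi ue m k = d"
proof -
  have eq: "c * eigen m b = d" if b: "b k = -1" for b
  proof -
    have "act (f \<star> g) (\<lambda>_. 1) b = 0"
      unfolding act_tmul by (rule vanishing_of_negative_degree[of f k D]) (use f b in auto)
    moreover have "eigen 0 b = 1" by (simp add: eigen_def)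
    ultimately show ?thesis by (simp add: fg act_diff)
  qed
  have zero: "ue m l = 0" if l: "l < n" "l \<noteq> k" for l
  proof -
    \<comment> \<open>Two points of the hyperplane, \<open>z = 0\<close> and \<open>z = 1\<close>,
      that differ only in coordinate \<open>l\<close>; their eigenvalues differ by the factor
      \<open>q powi ue m l\<close>.\<close>
    let ?b = "\<lambda>z j. if j = k then -1 else if j = l then z else (0::int)"
    define P where "P = (\<Prod>j\<in>{..<n} - {l}. (\<beta> j * q powi ?b 0 j) powi ue m j)"
    have b: "eigen m (?b z) = (\<beta> l * q powi z) powi ue m l * P" for z
    proof -
      have "eigen m (?b z) = (\<beta> l * q powi ?b z l) powi ue m l *
          (\<Prod>j\<in>{..<n} - {l}. (\<beta> j * q powi ?b z j) powi ue m j)"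
        unfolding eigen_def by (rule prod.remove) (use l in auto)
      also have "(\<Prod>j\<in>{..<n} - {l}. (\<beta> j * q powi ?b z j) powi ue m j) = P"
        unfolding P_def by (rule prod.cong) auto
      finally show ?thesis using l by simp
    qed
    have "c * eigen m (?b 0) = c * eigen m (?b 1)"
      by (subst (1 2) eq) auto
    then have "eigen m (?b 0) = eigen m (?b 1)" using \<open>c \<noteq> 0\<close> by simp
    moreover have "P \<noteq> 0" unfolding P_def using \<beta>_nonzero by auto
    ultimately have "\<beta> l powi ue m l = (\<beta> l * q) powi ue m l"
      unfolding b by simp
    then have "q powi ue m l = 1" using \<beta>_nonzero[OF l(1)] by (simp add: power_int_mult_distrib)
    then show ?thesis by (simp add: q_power_int_eq_1)
  qed
  show "l < n \<Longrightarrow> l \<noteq> k \<Longrightarrow> ue m l = 0" by (rule zero)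
  have "eigen m (\<lambda>_. -1) = (\<Prod>j<n. if j = k then (\<beta> k / q) powi ue m k else 1)"
    unfolding eigen_def by (intro prod.cong refl) (auto simp: zero divide_inverse)
  also have "\<dots> = (\<beta> k / q) powi ue m k" using \<open>k < n\<close> by simp
  finally show "c * (\<beta> k / q) powi ue m k = d" using eq[of "\<lambda>_. -1"] by simp
qed

end

section \<open>Scalar multiplication\<close>

context scalar_ring
begin

definition smul :: "'k \<Rightarrow> 'a \<Rightarrow> 'a" (infixr \<open>\<odot>\<close> 80) where
  "c \<odot> x = sc c \<otimes> x"

lemma smul_closed [simp]: "x \<in> carrier R \<Longrightarrow> c \<odot> x \<in> carrier R"
  by (simp add: smul_def)

lemma sc_zero [simp]: "sc 0 = \<zero>"
  using sc_add[of 0 0] by (metis add.l_cancel_one' add_0 sc_closed)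

lemma smul_simps [simp]:
  "x \<in> carrier R \<Longrightarrow> 1 \<odot> x = x" "x \<in> carrier R \<Longrightarrow> 0 \<odot> x = \<zero>" "c \<odot> \<zero> = \<zero>"
  "x \<in> carrier R \<Longrightarrow> c \<odot> d \<odot> x = (c * d) \<odot> x"
  by (simp_all add: smul_def sc_one sc_mult m_assoc)

lemma smul_add: "x \<in> carrier R \<Longrightarrow> y \<in> carrier R \<Longrightarrow> c \<odot> (x \<oplus> y) = c \<odot> x \<oplus> c \<odot> y"
  by (simp add: smul_def r_distr)

lemma add_smul: "x \<in> carrier R \<Longrightarrow> (c + d) \<odot> x = c \<odot> x \<oplus> d \<odot> x"
  by (simp add: smul_def sc_add l_distr)

lemma smul_mult_left: "x \<in> carrier R \<Longrightarrow> y \<in> carrier R \<Longrightarrow> (c \<odot> x) \<otimes> y = c \<odot> (x \<otimes> y)"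
  by (simp add: smul_def m_assoc)

lemma smul_mult_right: "x \<in> carrier R \<Longrightarrow> y \<in> carrier R \<Longrightarrow> x \<otimes> (c \<odot> y) = c \<odot> (x \<otimes> y)"
  unfolding smul_def by (metis m_assoc sc_central sc_closed)

lemma sc_eq_smul: "sc c = c \<odot> \<one>"
  by (simp add: smul_def)

lemma smul_collect:
  "x \<in> carrier R \<Longrightarrow> c \<odot> x \<oplus> d \<odot> x = (c + d) \<odot> x"
  "x \<in> carrier R \<Longrightarrow> z \<in> carrier R \<Longrightarrow> c \<odot> x \<oplus> (d \<odot> x \<oplus> z) = (c + d) \<odot> x \<oplus> z"
  "x \<in> carrier R \<Longrightarrow> x \<oplus> d \<odot> x = (1 + d) \<odot> x"
  by (simp_all add: add_smul a_assoc)

lemmas smul_distribs = smul_add smul_mult_left smul_mult_right l_distr r_distr m_assoc a_assoc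

lemma uminus_eq_smul: "x \<in> carrier R \<Longrightarrow> \<ominus> x = (-1) \<odot> x"
  by (rule minus_equality) (use smul_collect(1)[of x "-1" 1] in auto)

lemma add_eq_zero_smul: "x \<in> carrier R \<Longrightarrow> y \<in> carrier R \<Longrightarrow> x \<oplus> c \<odot> y = \<zero> \<Longrightarrow> x = (- c) \<odot> y"
  using minus_equality[of "x" "c \<odot> y"] by (simp add: uminus_eq_smul)

end

section \<open>A single tensor factor\<close>

locale qweyl_factor = scalar_ring R sc for R (structure) and sc :: "'k::field \<Rightarrow> 'a" +
  fixes q \<alpha> :: 'k and x y e :: 'a
  assumes closed [simp]: "x \<in> carrier R" "y \<in> carrier R" "e \<in> carrier R"
    and params [simp]: "q \<noteq> 0" "q \<noteq> 1" "q + 1 \<noteq> 0" "\<alpha> \<noteq> 0"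
    and ex: "e \<otimes> x = inverse q \<odot> (x \<otimes> e)"
    and yx: "y \<otimes> x = q \<odot> (x \<otimes> y) \<oplus> \<alpha> \<odot> \<one>"
    and ye: "y \<otimes> e = inverse q \<odot> (e \<otimes> y) \<oplus> (- inverse q) \<odot> x"
    and xx: "x \<otimes> x \<oplus> ((q\<^sup>2 - 1) \<odot> (x \<otimes> (e \<otimes> y)) \<oplus> (\<alpha> * q * (q + 1)) \<odot> e) = \<zero>"
begin

lemma q_cancel [simp]: "inverse q * (q * z) = z" "q * (inverse q * z) = z"
  by (simp_all add: mult.assoc[symmetric])

text \<open>The \<open>q\<close>-central element \<open>e\<^sub>2 e\<^sub>3 - e\<^sub>3 e\<^sub>2\<close>, for \<open>x = e\<^sub>3\<close>, \<open>y = e\<^sub>2\<close>, \<open>e = e\<^sub>1\<close>.\<close>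

definition u :: 'a where "u = (q - 1) \<odot> (x \<otimes> y) \<oplus> \<alpha> \<odot> \<one>"

lemma u_closed [simp]: "u \<in> carrier R"
  by (simp add: u_def)

lemma ux: "u \<otimes> x = q \<odot> (x \<otimes> u)"
proof -
  have "u \<otimes> x = (q - 1) \<odot> (x \<otimes> (y \<otimes> x)) \<oplus> \<alpha> \<odot> x"
    by (simp add: u_def smul_distribs)
  also have "\<dots> = ((q - 1) * q) \<odot> (x \<otimes> (x \<otimes> y)) \<oplus> ((q - 1) * \<alpha> + \<alpha>) \<odot> x"
    by (simp add: yx smul_distribs smul_collect)
  also have "\<dots> = q \<odot> (x \<otimes> u)"
    by (simp add: u_def smul_distribs algebra_simps)
  finally show ?thesis .
qed

lemma yu: "y \<otimes> u = q \<odot> (u \<otimes> y)"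
proof -
  have "y \<otimes> u = (q - 1) \<odot> ((y \<otimes> x) \<otimes> y) \<oplus> \<alpha> \<odot> y"
    by (simp add: u_def smul_distribs)
  also have "\<dots> = ((q - 1) * q) \<odot> (x \<otimes> (y \<otimes> y)) \<oplus> ((q - 1) * \<alpha> + \<alpha>) \<odot> y"
    by (simp add: yx smul_distribs smul_collect)
  also have "\<dots> = q \<odot> (u \<otimes> y)"
    by (simp add: u_def smul_distribs algebra_simps)
  finally show ?thesis .
qed

lemma uy: "u \<otimes> y = inverse q \<odot> (y \<otimes> u)"
  by (simp add: yu)

lemma xu: "x \<otimes> u = inverse q \<odot> (u \<otimes> x)"
  by (simp add: ux)

lemma xy: "x \<otimes> y = inverse (q - 1) \<odot> u \<oplus> (- (inverse (q - 1) * \<alpha>)) \<odot> \<one>"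
  by (simp add: u_def smul_distribs smul_collect)

lemma yx': "y \<otimes> x = (inverse (q - 1) * q) \<odot> u \<oplus> (- (inverse (q - 1) * \<alpha>)) \<odot> \<one>"
proof -
  have "- (q * (inverse (q - 1) * \<alpha>)) + \<alpha> = - (inverse (q - 1) * \<alpha>)"
    by (simp add: field_simps)
  then show ?thesis
    unfolding yx xy by (simp add: smul_distribs smul_collect mult.commute)
qed

text \<open>Once \<open>x\<close> is moved past \<open>e\<close>, the last two terms of the fourth
  relation have the common factor \<open>q * (q + 1)\<close> and combine to
  \<open>e \<otimes> u\<close>.\<close>

lemma xx_eq: "x \<otimes> x = (- (q * (q + 1))) \<odot> (e \<otimes> u)"
proof -
  have exy: "x \<otimes> (e \<otimes> y) = q \<odot> (e \<otimes> (x \<otimes> y))"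
    using ex by (simp add: m_assoc[symmetric] smul_mult_left)
  have "(q * (q + 1)) \<odot> (e \<otimes> u) = (q\<^sup>2 - 1) \<odot> (x \<otimes> (e \<otimes> y)) \<oplus> (\<alpha> * q * (q + 1)) \<odot> e"
    unfolding exy by (simp add: u_def smul_distribs algebra_simps power2_eq_square)
  then show ?thesis using xx by (intro add_eq_zero_smul) auto
qed

lemma ue: "u \<otimes> e = q\<^sup>2 \<odot> (e \<otimes> u)"
proof -
  have exy: "x \<otimes> (e \<otimes> y) = q \<odot> (e \<otimes> (x \<otimes> y))"
    using ex by (simp add: m_assoc[symmetric] smul_mult_left)
  have "u \<otimes> e = (q - 1) \<odot> (x \<otimes> (y \<otimes> e)) \<oplus> \<alpha> \<odot> e"
    by (simp add: u_def smul_distribs)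
  also have "\<dots> = (q - 1) \<odot> (e \<otimes> (x \<otimes> y)) \<oplus> ((- ((q - 1) * inverse q)) \<odot> (x \<otimes> x) \<oplus> \<alpha> \<odot> e)"
    by (simp add: ye smul_distribs exy)
  also have "\<dots> = e \<otimes> u \<oplus> (- ((q - 1) * inverse q)) \<odot> (x \<otimes> x)"
    by (simp add: u_def smul_distribs a_comm a_lcomm)
  also have "\<dots> = (1 + (q - 1) * (q + 1)) \<odot> (e \<otimes> u)"
    by (simp add: xx_eq smul_collect mult_ac)
  finally show ?thesis by (simp add: power2_eq_square algebra_simps)
qed

text \<open>The coefficients result from solving the identity \<open>eq\<close> in
  \<open>u_uinv\<close> for its constant term: every other term there has a factor \<open>u\<close>,
  and the identity is divided by \<open>\<alpha>\<^sup>2 / (q - 1)\<^sup>2\<close>.\<close>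

definition uinv :: 'a where
  "uinv = (- ((q - 1)\<^sup>2 * inverse q * (q + 1) * inverse (\<alpha>\<^sup>2))) \<odot> (e \<otimes> (y \<otimes> y)) \<oplus>
    ((- (inverse q * inverse (\<alpha>\<^sup>2))) \<odot> u \<oplus> ((inverse q + 1) * inverse \<alpha>) \<odot> \<one>)"

lemma uinv_closed [simp]: "uinv \<in> carrier R"
  by (simp add: uinv_def)

lemma uy_left: "z \<in> carrier R \<Longrightarrow> u \<otimes> (y \<otimes> z) = inverse q \<odot> (y \<otimes> (u \<otimes> z))"
  using uy by (simp add: m_assoc[symmetric] smul_mult_left)

text \<open>Conjugation by \<open>u\<close> scales \<open>e\<close> by \<open>q\<^sup>2\<close> and
  \<open>y\<close> by \<open>inverse q\<close>, so the powers of \<open>q\<close> cancel in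
  \<open>e y y\<close>.\<close>

lemma uz: "u \<otimes> (e \<otimes> (y \<otimes> y)) = e \<otimes> (y \<otimes> (y \<otimes> u))"
proof -
  have "u \<otimes> (e \<otimes> (y \<otimes> y)) = (u \<otimes> e) \<otimes> (y \<otimes> y)" by (simp add: m_assoc)
  also have "\<dots> = q\<^sup>2 \<odot> (e \<otimes> (u \<otimes> (y \<otimes> y)))"
    unfolding ue by (simp add: smul_distribs)
  also have "\<dots> = e \<otimes> (y \<otimes> (y \<otimes> u))"
    by (simp add: uy_left uy smul_distribs power2_eq_square mult_ac)
  finally show ?thesis .
qed

lemma uinv_commute: "uinv \<otimes> u = u \<otimes> uinv"
  by (simp add: uinv_def smul_distribs uz)

text \<open>Computing \<open>x\<^sup>2 y\<^sup>2\<close> once from \<open>xy\<close> and once from \<open>xx_eq\<close> exhibits \<open>\<alpha>\<^sup>2\<close> as a multiple of \<open>u\<close>.\<close>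

lemma u_uinv: "u \<otimes> uinv = \<one>"
proof -
  let ?r = "inverse (q - 1)" and ?z = "e \<otimes> (y \<otimes> y)"
  have "x \<otimes> (x \<otimes> (y \<otimes> y)) = (- (inverse q * (q + 1))) \<odot> (u \<otimes> ?z)"
  proof -
    have "x \<otimes> (x \<otimes> (y \<otimes> y)) = (- (q * (q + 1))) \<odot> (e \<otimes> (u \<otimes> (y \<otimes> y)))"
      using xx_eq by (simp add: m_assoc[symmetric] smul_mult_left)
    also have "\<dots> = (- (inverse q * (q + 1))) \<odot> (u \<otimes> ?z)"
      by (simp add: uy_left uy uz smul_distribs mult_ac)
    finally show ?thesis .
  qed
  moreover have "x \<otimes> (x \<otimes> (y \<otimes> y)) =
      (?r\<^sup>2 * inverse q) \<odot> (u \<otimes> u) \<oplus> ((- (?r\<^sup>2 * (inverse q + 1) * \<alpha>)) \<odot> u \<oplus> (?r\<^sup>2 * \<alpha>\<^sup>2) \<odot> \<one>)"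
  proof -
    have "x \<otimes> (x \<otimes> (y \<otimes> y)) = x \<otimes> ((x \<otimes> y) \<otimes> y)" by (simp add: m_assoc)
    also have "\<dots> = ?r \<odot> ((x \<otimes> u) \<otimes> y) \<oplus> (- (?r * \<alpha>)) \<odot> (x \<otimes> y)"
      by (subst xy) (simp add: smul_distribs)
    also have "\<dots> = (?r * inverse q) \<odot> (u \<otimes> (x \<otimes> y)) \<oplus> (- (?r * \<alpha>)) \<odot> (x \<otimes> y)"
      unfolding xu by (simp add: smul_distribs)
    also have "\<dots> = (?r * inverse q * ?r) \<odot> (u \<otimes> u) \<oplus>
       ((- (?r * inverse q * (?r * \<alpha>)) + - (?r * \<alpha> * ?r)) \<odot> u \<oplus> (?r * \<alpha> * (?r * \<alpha>)) \<odot> \<one>)"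
      unfolding xy by (simp add: smul_distribs smul_collect)
    finally show ?thesis by (simp add: power2_eq_square algebra_simps)
  qed
  ultimately have eq: "(- (inverse q * (q + 1))) \<odot> (u \<otimes> ?z) =
     (?r\<^sup>2 * inverse q) \<odot> (u \<otimes> u) \<oplus> ((- (?r\<^sup>2 * (inverse q + 1) * \<alpha>)) \<odot> u \<oplus> (?r\<^sup>2 * \<alpha>\<^sup>2) \<odot> \<one>)"
    by simp
  have "u \<otimes> uinv = ((q - 1)\<^sup>2 * inverse (\<alpha>\<^sup>2)) \<odot> ((- (inverse q * (q + 1))) \<odot> (u \<otimes> ?z)) \<oplus>
    ((- (inverse q * inverse (\<alpha>\<^sup>2))) \<odot> (u \<otimes> u) \<oplus> ((inverse q + 1) * inverse \<alpha>) \<odot> u)"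
    by (simp add: uinv_def smul_distribs mult_ac)
  \<comment> \<open>Substituting \<open>eq\<close> turns its constant term into
    \<open>\<one>\<close>; the remaining summands are set up to cancel in pairs.\<close>
  also have "\<dots> = (inverse q * inverse (\<alpha>\<^sup>2)) \<odot> (u \<otimes> u) \<oplus>
      ((- ((inverse q + 1) * inverse \<alpha>)) \<odot> u \<oplus> (\<one> \<oplus>
      ((- (inverse q * inverse (\<alpha>\<^sup>2))) \<odot> (u \<otimes> u) \<oplus> ((inverse q + 1) * inverse \<alpha>) \<odot> u)))"
  proof -
    have "(q - 1)\<^sup>2 * inverse (\<alpha>\<^sup>2) * (?r\<^sup>2 * inverse q) = inverse q * inverse (\<alpha>\<^sup>2)"
      "(q - 1)\<^sup>2 * inverse (\<alpha>\<^sup>2) * (- (?r\<^sup>2 * (inverse q + 1) * \<alpha>)) = - ((inverse q + 1) * inverse \<alpha>)"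
      "(q - 1)\<^sup>2 * inverse (\<alpha>\<^sup>2) * (?r\<^sup>2 * \<alpha>\<^sup>2) = 1"
    proof -
      have p: "(q - 1)\<^sup>2 * ?r\<^sup>2 = 1"
        by (simp flip: power_mult_distrib)
      have a: "inverse (\<alpha>\<^sup>2) * \<alpha> = inverse \<alpha>"
        by (simp add: power2_eq_square)
      have "(q - 1)\<^sup>2 * inverse (\<alpha>\<^sup>2) * (?r\<^sup>2 * inverse q) = ((q - 1)\<^sup>2 * ?r\<^sup>2) * (inverse q * inverse (\<alpha>\<^sup>2))"
        by (simp only: mult_ac)
      then show "(q - 1)\<^sup>2 * inverse (\<alpha>\<^sup>2) * (?r\<^sup>2 * inverse q) = inverse q * inverse (\<alpha>\<^sup>2)"
        unfolding p by simp
      have "(q - 1)\<^sup>2 * inverse (\<alpha>\<^sup>2) * (?r\<^sup>2 * (inverse q + 1) * \<alpha>) =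
          ((q - 1)\<^sup>2 * ?r\<^sup>2) * ((inverse q + 1) * (inverse (\<alpha>\<^sup>2) * \<alpha>))"
        by (simp only: mult_ac)
      then show "(q - 1)\<^sup>2 * inverse (\<alpha>\<^sup>2) * (- (?r\<^sup>2 * (inverse q + 1) * \<alpha>)) = - ((inverse q + 1) * inverse \<alpha>)"
        unfolding p a by simp
      have "(q - 1)\<^sup>2 * inverse (\<alpha>\<^sup>2) * (?r\<^sup>2 * \<alpha>\<^sup>2) = ((q - 1)\<^sup>2 * ?r\<^sup>2) * (inverse (\<alpha>\<^sup>2) * \<alpha>\<^sup>2)"
        by (simp only: mult_ac)
      then show "(q - 1)\<^sup>2 * inverse (\<alpha>\<^sup>2) * (?r\<^sup>2 * \<alpha>\<^sup>2) = 1"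
        unfolding p by simp
    qed
    then show ?thesis
      unfolding eq by (simp only: smul_add smul_simps smul_closed m_closed one_closed u_closed a_closed a_assoc)
  qed
  also have "\<dots> = ((inverse q * inverse (\<alpha>\<^sup>2)) \<odot> (u \<otimes> u) \<oplus> (- (inverse q * inverse (\<alpha>\<^sup>2))) \<odot> (u \<otimes> u)) \<oplus>
      (((- ((inverse q + 1) * inverse \<alpha>)) \<odot> u \<oplus> ((inverse q + 1) * inverse \<alpha>) \<odot> u) \<oplus> \<one>)"
    by (simp only: a_ac smul_closed m_closed one_closed u_closed a_closed)
  also have "\<dots> = \<one>"
    by (simp add: smul_collect)
  finally show ?thesis .
qed

lemma uinv_u: "uinv \<otimes> u = \<one>"
  using uinv_commute u_uinv by simp

text \<open>Removes \<open>e\<close> from normal forms, and dictates the image of \<open>e\<close>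
  in the torus.\<close>

lemma e_eq: "e = (- inverse (q * (q + 1))) \<odot> (x \<otimes> (x \<otimes> uinv))"
proof -
  have "x \<otimes> (x \<otimes> uinv) = (- (q * (q + 1))) \<odot> e"
    using xx_eq u_uinv by (simp add: m_assoc[symmetric] smul_mult_left) (simp add: m_assoc)
  moreover have "inverse (q * (q + 1)) * (q * (q + 1)) = 1" by (rule left_inverse) simp
  ultimately show ?thesis by (simp del: inverse_mult_distrib)
qed

lemma uinv_x: "uinv \<otimes> x = inverse q \<odot> (x \<otimes> uinv)"
proof -
  have "uinv \<otimes> x = uinv \<otimes> ((x \<otimes> u) \<otimes> uinv)" by (simp add: m_assoc u_uinv)
  also have "\<dots> = inverse q \<odot> ((uinv \<otimes> u) \<otimes> (x \<otimes> uinv))"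
    unfolding xu by (simp add: smul_distribs)
  finally show ?thesis by (simp add: uinv_u)
qed

lemma uinv_y: "uinv \<otimes> y = q \<odot> (y \<otimes> uinv)"
proof -
  have "uinv \<otimes> y = uinv \<otimes> ((y \<otimes> u) \<otimes> uinv)" by (simp add: m_assoc u_uinv)
  also have "\<dots> = q \<odot> ((uinv \<otimes> u) \<otimes> (y \<otimes> uinv))"
    unfolding yu by (simp add: smul_distribs)
  finally show ?thesis by (simp add: uinv_u)
qed

section \<open>Normal monomials of one factor\<close>

definition upow :: "int \<Rightarrow> 'a" where
  "upow m = (if m \<ge> 0 then u [^] nat m else uinv [^] nat (- m))"

text \<open>The factor is graded with \<open>x\<close> in degree 1 and \<open>y\<close> in degree
  -1. Since \<open>x y\<close> and \<open>y x\<close> are polynomials in \<open>u\<close>, one power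
  per degree is enough.\<close>

definition vpow :: "int \<Rightarrow> 'a" where
  "vpow d = (if d \<ge> 0 then x [^] nat d else y [^] nat (- d))"

lemma pow_closed [simp]: "upow m \<in> carrier R" "vpow d \<in> carrier R"
  by (simp_all add: upow_def vpow_def del: pow_nat)

lemma pow_0 [simp]: "upow 0 = \<one>" "vpow 0 = \<one>"
  by (simp_all add: upow_def vpow_def)

lemma u_upow: "u \<otimes> upow m = upow (m + 1)"
proof (cases "m \<ge> 0")
  case True
  then show ?thesis by (simp add: upow_def nat_add_distrib nat_pow_Suc2[symmetric] del: nat_pow_Suc pow_nat)
next
  case False
  then obtain k where m: "m = - int (Suc k)" by (metis int_cases nat_int not_le negative_zle of_nat_0_le_iff)
  have "u \<otimes> uinv [^] Suc k = uinv [^] k"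
    unfolding nat_pow_Suc2[OF uinv_closed] by (simp add: m_assoc[symmetric] u_uinv)
  moreover have "upow m = uinv [^] Suc k" "upow (m + 1) = uinv [^] k"
    by (auto simp: upow_def m nat_add_distrib simp del: nat_pow_Suc pow_nat)
  ultimately show ?thesis by (simp only:)
qed

lemma uinv_upow: "uinv \<otimes> upow m = upow (m - 1)"
  using u_upow[of "m - 1"] by (metis m_assoc diff_add_cancel l_one pow_closed(1) u_closed uinv_closed uinv_u)

lemma x_upow: "x \<otimes> upow m = (q powi (- m)) \<odot> (upow m \<otimes> x)"
proof (induction m rule: int_induct[where k = 0])
  case base
  then show ?case by simp
next
  case (step1 m)
  have "x \<otimes> upow (m + 1) = (x \<otimes> u) \<otimes> upow m" by (simp add: u_upow[symmetric] m_assoc)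
  also have "\<dots> = (inverse q * q powi (- m)) \<odot> (u \<otimes> (upow m \<otimes> x))"
    unfolding xu by (simp add: smul_distribs step1)
  also have "u \<otimes> (upow m \<otimes> x) = upow (m + 1) \<otimes> x" by (simp add: u_upow[symmetric] m_assoc)
  finally show ?case by (simp add: power_int_diff power_int_minus power_int_add divide_inverse mult.commute)
next
  case (step2 m)
  have "x \<otimes> upow (m - 1) = (x \<otimes> uinv) \<otimes> upow m" by (simp add: uinv_upow[symmetric] m_assoc)
  also have "\<dots> = (q * q powi (- m)) \<odot> (uinv \<otimes> (upow m \<otimes> x))"
  proof -
    have "x \<otimes> uinv = q \<odot> (uinv \<otimes> x)" by (simp add: uinv_x)
    then show ?thesis by (simp add: smul_distribs step2)
  qed
  also have "uinv \<otimes> (upow m \<otimes> x) = upow (m - 1) \<otimes> x" by (simp add: uinv_upow[symmetric] m_assoc)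
  finally show ?case by (simp add: power_int_diff power_int_minus power_int_add divide_inverse)
qed

lemma y_upow: "y \<otimes> upow m = (q powi m) \<odot> (upow m \<otimes> y)"
proof (induction m rule: int_induct[where k = 0])
  case base
  then show ?case by simp
next
  case (step1 m)
  have "y \<otimes> upow (m + 1) = (y \<otimes> u) \<otimes> upow m" by (simp add: u_upow[symmetric] m_assoc)
  also have "\<dots> = (q * q powi m) \<odot> (u \<otimes> (upow m \<otimes> y))"
    unfolding yu by (simp add: smul_distribs step1)
  also have "u \<otimes> (upow m \<otimes> y) = upow (m + 1) \<otimes> y" by (simp add: u_upow[symmetric] m_assoc)
  finally show ?case by (simp add: power_int_add mult.commute)
next
  case (step2 m)
  have "y \<otimes> upow (m - 1) = (y \<otimes> uinv) \<otimes> upow m" by (simp add: uinv_upow[symmetric] m_assoc)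
  also have "\<dots> = (inverse q * q powi m) \<odot> (uinv \<otimes> (upow m \<otimes> y))"
  proof -
    have "y \<otimes> uinv = inverse q \<odot> (uinv \<otimes> y)" by (simp add: uinv_y)
    then show ?thesis by (simp add: smul_distribs step2)
  qed
  also have "uinv \<otimes> (upow m \<otimes> y) = upow (m - 1) \<otimes> y" by (simp add: uinv_upow[symmetric] m_assoc)
  finally show ?case by (simp add: power_int_diff divide_inverse mult.commute)
qed

lemma upow_u: "upow m \<otimes> u = upow (m + 1)"
proof -
  have "upow m \<otimes> u = u \<otimes> upow m"
  proof (induction m rule: int_induct[where k = 0])
    case (step1 m)
    have "upow (m + 1) \<otimes> u = u \<otimes> (upow m \<otimes> u)" by (simp add: u_upow[symmetric] m_assoc)
    then show ?case by (simp add: step1 u_upow)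
  next
    case (step2 m)
    have "upow (m - 1) \<otimes> u = uinv \<otimes> (upow m \<otimes> u)" by (simp add: uinv_upow[symmetric] m_assoc)
    then show ?case by (simp add: step2 u_upow uinv_upow)
  qed simp
  then show ?thesis by (simp add: u_upow)
qed

definition fbasis :: "int \<Rightarrow> int \<Rightarrow> 'a" where
  "fbasis m d = upow m \<otimes> vpow d"

lemma fbasis_closed [simp]: "fbasis m d \<in> carrier R"
  by (simp add: fbasis_def)

lemma uinv_fbasis: "uinv \<otimes> fbasis m d = fbasis (m - 1) d"
  by (simp add: fbasis_def m_assoc[symmetric] uinv_upow)

lemma x_vpow_nonneg: "d \<ge> 0 \<Longrightarrow> x \<otimes> vpow d = vpow (d + 1)"
  by (simp add: vpow_def nat_add_distrib nat_pow_Suc2[symmetric] del: nat_pow_Suc pow_nat)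

lemma y_vpow_nonpos: "d \<le> 0 \<Longrightarrow> y \<otimes> vpow d = vpow (d - 1)"
proof (cases "d = 0")
  case True
  then show ?thesis by (simp add: vpow_def)
next
  case False
  assume "d \<le> 0"
  with False have "nat (1 - d) = Suc (nat (- d))" by simp
  with False \<open>d \<le> 0\<close> show ?thesis by (simp add: vpow_def nat_pow_Suc2[symmetric] del: nat_pow_Suc pow_nat)
qed

text \<open>In negative degree the new \<open>x\<close> meets a \<open>y\<close>, and the binomial
  \<open>xy\<close> in \<open>u\<close> produces two terms of the same degree.\<close>

lemma x_fbasis:
  "\<exists>c c' m' d'. x \<otimes> fbasis m d = c \<odot> fbasis m' d' \<oplus> c' \<odot> fbasis m d'"
proof (cases "d \<ge> 0")
  case True
  have "x \<otimes> fbasis m d = (x \<otimes> upow m) \<otimes> vpow d" by (simp add: fbasis_def m_assoc)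
  \<comment> \<open>The summand with coefficient 0 pads the result to the two-term shape of the
    other case.\<close>
  also have "\<dots> = (q powi (- m)) \<odot> fbasis m (d + 1) \<oplus> 0 \<odot> fbasis m (d + 1)"
    unfolding x_upow using True by (simp add: fbasis_def smul_distribs x_vpow_nonneg)
  finally show ?thesis by blast
next
  case False
  let ?r = "inverse (q - 1)"
  have "vpow d = y \<otimes> vpow (d + 1)" using False by (subst y_vpow_nonpos) auto
  then have "x \<otimes> vpow d = (x \<otimes> y) \<otimes> vpow (d + 1)" by (simp add: m_assoc)
  also have "\<dots> = ?r \<odot> (u \<otimes> vpow (d + 1)) \<oplus> (- (?r * \<alpha>)) \<odot> vpow (d + 1)"
    unfolding xy by (simp add: smul_distribs)
  finally have xv: "x \<otimes> vpow d = ?r \<odot> (u \<otimes> vpow (d + 1)) \<oplus> (- (?r * \<alpha>)) \<odot> vpow (d + 1)" .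
  have uu: "upow m \<otimes> (u \<otimes> vpow (d + 1)) = fbasis (m + 1) (d + 1)"
    by (simp add: m_assoc[symmetric] upow_u fbasis_def)
  have "x \<otimes> fbasis m d = (x \<otimes> upow m) \<otimes> vpow d" by (simp add: fbasis_def m_assoc)
  also have "\<dots> = (q powi (- m)) \<odot> (upow m \<otimes> (x \<otimes> vpow d))"
    unfolding x_upow by (simp add: smul_distribs)
  also have "\<dots> = (q powi (- m) * ?r) \<odot> fbasis (m + 1) (d + 1) \<oplus> (q powi (- m) * (- (?r * \<alpha>))) \<odot> fbasis m (d + 1)"
    unfolding xv using uu by (simp add: smul_distribs fbasis_def)
  finally show ?thesis by blast
qed

lemma y_fbasis:
  "\<exists>c c' m' d'. y \<otimes> fbasis m d = c \<odot> fbasis m' d' \<oplus> c' \<odot> fbasis m d'"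
proof (cases "d \<le> 0")
  case True
  have "y \<otimes> fbasis m d = (y \<otimes> upow m) \<otimes> vpow d" by (simp add: fbasis_def m_assoc)
  also have "\<dots> = (q powi m) \<odot> fbasis m (d - 1) \<oplus> 0 \<odot> fbasis m (d - 1)"
    unfolding y_upow using True by (simp add: fbasis_def smul_distribs y_vpow_nonpos)
  finally show ?thesis by blast
next
  case False
  let ?r = "inverse (q - 1)"
  have "vpow d = x \<otimes> vpow (d - 1)" using False by (subst x_vpow_nonneg) auto
  then have "y \<otimes> vpow d = (y \<otimes> x) \<otimes> vpow (d - 1)" by (simp add: m_assoc)
  also have "\<dots> = (?r * q) \<odot> (u \<otimes> vpow (d - 1)) \<oplus> (- (?r * \<alpha>)) \<odot> vpow (d - 1)"
    unfolding yx' by (simp add: smul_distribs)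
  finally have xv: "y \<otimes> vpow d = (?r * q) \<odot> (u \<otimes> vpow (d - 1)) \<oplus> (- (?r * \<alpha>)) \<odot> vpow (d - 1)" .
  have uu: "upow m \<otimes> (u \<otimes> vpow (d - 1)) = fbasis (m + 1) (d - 1)"
    by (simp add: m_assoc[symmetric] upow_u fbasis_def)
  have "y \<otimes> fbasis m d = (y \<otimes> upow m) \<otimes> vpow d" by (simp add: fbasis_def m_assoc)
  also have "\<dots> = (q powi m) \<odot> (upow m \<otimes> (y \<otimes> vpow d))"
    unfolding y_upow by (simp add: smul_distribs)
  also have "\<dots> = (q powi m * (?r * q)) \<odot> fbasis (m + 1) (d - 1) \<oplus> (q powi m * (- (?r * \<alpha>))) \<odot> fbasis m (d - 1)"
    unfolding xv using uu by (simp add: smul_distribs fbasis_def)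
  finally show ?thesis by blast
qed

end

section \<open>Spanning monomials of the tensor product\<close>

context scalar_ring
begin

definition comm_with :: "'a \<Rightarrow> 'a set" where
  "comm_with z = {t \<in> carrier R. z \<otimes> t = t \<otimes> z}"

lemma comm_with_simps:
  assumes "z \<in> carrier R"
  shows "\<one> \<in> comm_with z" "a \<in> comm_with z \<Longrightarrow> b \<in> comm_with z \<Longrightarrow> a \<oplus> b \<in> comm_with z"
    "a \<in> comm_with z \<Longrightarrow> b \<in> comm_with z \<Longrightarrow> a \<otimes> b \<in> comm_with z"
    "a \<in> comm_with z \<Longrightarrow> c \<odot> a \<in> comm_with z"
proof -
  show mult: "a \<otimes> b \<in> comm_with z" if "a \<in> comm_with z" "b \<in> comm_with z" for a b
  proof -
    have "z \<otimes> (a \<otimes> b) = (a \<otimes> z) \<otimes> b"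
      using that assms by (simp add: comm_with_def m_assoc[symmetric])
    also have "\<dots> = (a \<otimes> b) \<otimes> z" using that assms by (simp add: comm_with_def m_assoc)
    finally show ?thesis using that assms by (simp add: comm_with_def)
  qed
qed (use assms in \<open>auto simp: comm_with_def l_distr r_distr smul_mult_left smul_mult_right\<close>)

lemma comm_with_pow: "z \<in> carrier R \<Longrightarrow> a \<in> comm_with z \<Longrightarrow> a [^] (k::nat) \<in> comm_with z"
  by (induction k) (auto intro: comm_with_simps)

fun oprod :: "(nat \<Rightarrow> 'a) \<Rightarrow> nat \<Rightarrow> 'a" where
  "oprod f 0 = \<one>"
| "oprod f (Suc m) = oprod f m \<otimes> f m"

lemma oprod_closed [simp]: "(\<And>i. i < m \<Longrightarrow> f i \<in> carrier R) \<Longrightarrow> oprod f m \<in> carrier R"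
  by (induction m) auto

lemma oprod_cong: "(\<And>i. i < m \<Longrightarrow> f i = g i) \<Longrightarrow> oprod f m = oprod g m"
  by (induction m) auto

lemma oprod_mult_left:
  assumes "z \<in> carrier R" "\<And>i. i < m \<Longrightarrow> f i \<in> carrier R" "j < m"
    and "\<And>i. i < m \<Longrightarrow> i \<noteq> j \<Longrightarrow> f i \<in> comm_with z"
  shows "z \<otimes> oprod f m = oprod (f(j := z \<otimes> f j)) m"
  using assms(2-)
proof (induction m)
  case (Suc m)
  show ?case
  proof (cases "j = m")
    case True
    have "oprod f k \<in> comm_with z" if "k \<le> m" for k
      using that by (induction k) (use Suc.prems True assms(1) in \<open>auto intro!: comm_with_simps\<close>)
    then have "z \<otimes> oprod f m = oprod f m \<otimes> z" by (simp add: comm_with_def)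
    moreover have "oprod (f(j := z \<otimes> f j)) m = oprod f m"
      using True by (intro oprod_cong) auto
    ultimately show ?thesis using True assms(1) Suc.prems
      by (simp add: m_assoc[symmetric] fun_upd_same fun_upd_other del: fun_upd_apply)
  next
    case False
    with Suc have "z \<otimes> oprod f m = oprod (f(j := z \<otimes> f j)) m"
      by (simp del: fun_upd_apply)
    with False assms(1) Suc.prems show ?thesis
      by (simp add: m_assoc[symmetric] fun_upd_other del: fun_upd_apply)
  qed
qed simp

lemma oprod_slot_linear:
  assumes "j < m" "\<And>i. i < m \<Longrightarrow> f i \<in> carrier R" "g \<in> carrier R" "g' \<in> carrier R"
  shows "oprod (f(j := c \<odot> g \<oplus> c' \<odot> g')) m = c \<odot> oprod (f(j := g)) m \<oplus> c' \<odot> oprod (f(j := g')) m"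
  using assms(1,2)
proof (induction m)
  case (Suc m)
  have closed: "oprod (f(j := h)) m \<in> carrier R" if "h \<in> carrier R" for h
    using Suc.prems that by (intro oprod_closed) auto
  show ?case
  proof (cases "j = m")
    case True
    have "oprod (f(j := h)) m = oprod f m" for h
      using True by (intro oprod_cong) auto
    with True show ?thesis using Suc.prems assms(3,4)
      by (simp add: smul_mult_right r_distr add: fun_upd_same del: fun_upd_apply)
  next
    case False
    with Suc have "oprod (f(j := c \<odot> g \<oplus> c' \<odot> g')) m = c \<odot> oprod (f(j := g)) m \<oplus> c' \<odot> oprod (f(j := g')) m"
      by (simp del: fun_upd_apply)
    with False Suc.prems assms(3,4) closed show ?thesis
      by (simp add: l_distr smul_mult_left fun_upd_other del: fun_upd_apply)
  qed
qed simp

end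

lemma (in qweyl_factor) comm_with_closure:
  assumes "z \<in> carrier R" "x \<in> comm_with z" "y \<in> comm_with z" "e \<in> comm_with z"
  shows "u \<in> comm_with z" "uinv \<in> comm_with z" "fbasis m d \<in> comm_with z"
proof -
  show u: "u \<in> comm_with z"
    unfolding u_def by (intro comm_with_simps assms)
  show ui: "uinv \<in> comm_with z"
    unfolding uinv_def by (intro comm_with_simps assms u)
  show "fbasis m d \<in> comm_with z"
    unfolding fbasis_def upow_def vpow_def
    using u ui assms by (auto intro!: comm_with_simps comm_with_pow simp del: pow_nat)
qed

text \<open>Generation by the \<open>x i\<close>, \<open>y i\<close>, \<open>e i\<close> is assumed
  as an induction rule, the form in which it is used. Freeness is not assumed.\<close>

locale qweyl_tensor = scalar_ring R sc for R (structure) and sc :: "'k::field \<Rightarrow> 'a" +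
  fixes n :: nat and q :: 'k and \<alpha> :: "nat \<Rightarrow> 'k" and x y e :: "nat \<Rightarrow> 'a"
  assumes factor: "i < n \<Longrightarrow> qweyl_factor R sc q (\<alpha> i) (x i) (y i) (e i)"
    and commute: "i < n \<Longrightarrow> j < n \<Longrightarrow> i \<noteq> j \<Longrightarrow> a \<in> {x i, y i, e i} \<Longrightarrow> b \<in> {x j, y j, e j} \<Longrightarrow>
      a \<otimes> b = b \<otimes> a"
    and generated [consumes 1, case_names scal x y e add mult]:
      "s \<in> carrier R \<Longrightarrow> (\<And>c. P (sc c)) \<Longrightarrow> (\<And>i. i < n \<Longrightarrow> P (x i)) \<Longrightarrow>
      (\<And>i. i < n \<Longrightarrow> P (y i)) \<Longrightarrow> (\<And>i. i < n \<Longrightarrow> P (e i)) \<Longrightarrow>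
      (\<And>s t. s \<in> carrier R \<Longrightarrow> t \<in> carrier R \<Longrightarrow> P s \<Longrightarrow> P t \<Longrightarrow> P (s \<oplus> t)) \<Longrightarrow>
      (\<And>s t. s \<in> carrier R \<Longrightarrow> t \<in> carrier R \<Longrightarrow> P s \<Longrightarrow> P t \<Longrightarrow> P (s \<otimes> t)) \<Longrightarrow> P s"
begin

abbreviation U :: "nat \<Rightarrow> 'a" where "U i \<equiv> qweyl_factor.u R sc q (\<alpha> i) (x i) (y i)"
abbreviation Uinv :: "nat \<Rightarrow> 'a" where "Uinv i \<equiv> qweyl_factor.uinv R sc q (\<alpha> i) (x i) (y i) (e i)"
abbreviation fb :: "nat \<Rightarrow> int \<Rightarrow> int \<Rightarrow> 'a" where
  "fb i \<equiv> qweyl_factor.fbasis R sc q (\<alpha> i) (x i) (y i) (e i)"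

lemma gens_closed [simp]:
  assumes "i < n"
  shows "x i \<in> carrier R" "y i \<in> carrier R" "e i \<in> carrier R"
    "U i \<in> carrier R" "Uinv i \<in> carrier R" "fb i m d \<in> carrier R"
proof -
  interpret qweyl_factor R sc q "\<alpha> i" "x i" "y i" "e i" using assms by (rule factor)
  show "x i \<in> carrier R" "y i \<in> carrier R" "e i \<in> carrier R"
    "U i \<in> carrier R" "Uinv i \<in> carrier R" "fb i m d \<in> carrier R" by simp_all
qed

lemma factors_commute:
  assumes "i < n" "j < n" "i \<noteq> j" "a \<in> {x i, y i, e i, U i, Uinv i, fb i m d}"
    "b \<in> {x j, y j, e j, U j, Uinv j, fb j m' d'}"
  shows "a \<in> comm_with b"
proof -
  interpret i: qweyl_factor R sc q "\<alpha> i" "x i" "y i" "e i" using assms(1) by (rule factor)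
  interpret j: qweyl_factor R sc q "\<alpha> j" "x j" "y j" "e j" using assms(2) by (rule factor)
  have sym: "s \<in> comm_with t \<longleftrightarrow> t \<in> comm_with s" if "s \<in> carrier R" "t \<in> carrier R" for s t
    using that by (auto simp: comm_with_def)
  have gen: "a \<in> comm_with b" if "a \<in> {x i, y i, e i}" "b \<in> {x j, y j, e j}" for a b
    using commute[OF assms(1-3) that] that by (auto simp: comm_with_def)
  have left: "a \<in> comm_with b" if "b \<in> {x j, y j, e j}" for b
  proof -
    have b: "b \<in> carrier R" using that by auto
    note cl = i.comm_with_closure[OF b gen[OF _ that] gen[OF _ that] gen[OF _ that]]
    show ?thesis using assms(4) cl gen[OF _ that] by auto
  qed
  have a: "a \<in> carrier R" using assms(4) by auto
  have left': "b \<in> comm_with a" if "b \<in> {x j, y j, e j}" for b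
    using left[OF that] that a by (subst sym) auto
  have "b \<in> comm_with a"
    using assms(5) j.comm_with_closure[OF a left' left' left'] left' by auto
  then show ?thesis using a by (subst sym) (auto simp: comm_with_def)
qed

text \<open>PBW monomials share the index type of torus monomials: the label records a power of each
  \<open>u_i\<close> and a degree in each factor.\<close>

definition bas :: "exponent \<Rightarrow> 'a" where
  "bas g = oprod (\<lambda>i. fb i (ue g i) (xe g i)) n"

lemma bas_closed [simp]: "bas g \<in> carrier R"
  by (simp add: bas_def)

definition lincomb :: "(exponent \<Rightarrow>\<^sub>0 'k) \<Rightarrow> 'a" where
  "lincomb p = (\<Oplus>g\<in>keys p. lookup p g \<odot> bas g)"

lemma lincomb_closed [simp]: "lincomb p \<in> carrier R"
  by (simp add: lincomb_def finsum_closed)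

lemma lincomb_superset:
  assumes "finite A" "keys p \<subseteq> A"
  shows "lincomb p = (\<Oplus>g\<in>A. lookup p g \<odot> bas g)"
  unfolding lincomb_def
  by (rule add.finprod_mono_neutral_cong_left) (use assms in \<open>auto simp: in_keys_iff\<close>)

lemma lincomb_add: "lincomb (p + p') = lincomb p \<oplus> lincomb p'"
proof -
  have "lincomb (p + p') = (\<Oplus>g\<in>keys p \<union> keys p'. lookup p g \<odot> bas g \<oplus> lookup p' g \<odot> bas g)"
    using Poly_Mapping.keys_add[of p p']
    by (subst lincomb_superset[of "keys p \<union> keys p'"]) (auto simp: lookup_add add_smul intro!: finsum_cong)
  also have "\<dots> = lincomb p \<oplus> lincomb p'"
    by (subst (1 2) lincomb_superset[of "keys p \<union> keys p'"]) (auto simp: finsum_addf)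
  finally show ?thesis .
qed

lemma lincomb_zero [simp]: "lincomb 0 = \<zero>"
  by (simp add: lincomb_def finsum_empty)

lemma lincomb_single [simp]: "lincomb (single g c) = c \<odot> bas g"
  by (subst lincomb_superset[of "{g}"]) (auto simp: finsum_singleton)

definition spn :: "'a set" where
  "spn = lincomb ` {p. keys p \<subseteq> rank_le n}"

lemma spn_closed: "t \<in> spn \<Longrightarrow> t \<in> carrier R"
  by (auto simp: spn_def)

lemma spn_bas: "g \<in> rank_le n \<Longrightarrow> c \<odot> bas g \<in> spn"
  unfolding spn_def by (rule image_eqI[of _ _ "single g c"]) auto

lemma spn_zero: "\<zero> \<in> spn"
  unfolding spn_def by (rule image_eqI[of _ _ 0]) auto

lemma spn_add: "s \<in> spn \<Longrightarrow> t \<in> spn \<Longrightarrow> s \<oplus> t \<in> spn"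
  unfolding spn_def using Poly_Mapping.keys_add by (force simp: lincomb_add[symmetric])

lemma spn_induct [consumes 1, case_names zero bas add]:
  assumes "t \<in> spn" "P \<zero>" "\<And>g c. g \<in> rank_le n \<Longrightarrow> P (c \<odot> bas g)"
    "\<And>s t. s \<in> carrier R \<Longrightarrow> t \<in> carrier R \<Longrightarrow> P s \<Longrightarrow> P t \<Longrightarrow> P (s \<oplus> t)"
  shows "P t"
proof -
  obtain p where p: "keys p \<subseteq> rank_le n" "t = lincomb p" using assms(1) by (auto simp: spn_def)
  have "P (lincomb p)"
    by (induction p rule: poly_mapping_additive_induct) (use p assms in \<open>auto simp: lincomb_add\<close>)
  with p show ?thesis by simp
qed

text \<open>The elements whose left multiplication preserves the span form a subring. Once it
  contains the generators it is everything, and applying it to \<open>\<one>\<close>, which lies in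
  the span, proves spanning.\<close>

definition stab :: "'a set" where
  "stab = {z \<in> carrier R. \<forall>t\<in>spn. z \<otimes> t \<in> spn}"

lemma stab_sc: "sc c \<in> stab"
proof -
  have "sc c \<otimes> t \<in> spn" if "t \<in> spn" for t
    using that
  proof (induction t rule: spn_induct)
    case (bas g d)
    have "sc c \<otimes> d \<odot> bas g = (c * d) \<odot> bas g" by (simp add: smul_def sc_mult m_assoc)
    with bas spn_bas show ?case by simp
  qed (auto simp: spn_zero r_distr intro: spn_add)
  then show ?thesis by (simp add: stab_def)
qed

lemma stab_add: "s \<in> stab \<Longrightarrow> t \<in> stab \<Longrightarrow> s \<oplus> t \<in> stab"
  by (auto simp: stab_def l_distr spn_closed intro: spn_add)

lemma stab_mult: "s \<in> stab \<Longrightarrow> t \<in> stab \<Longrightarrow> s \<otimes> t \<in> stab"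
  by (auto simp: stab_def m_assoc spn_closed)

lemma stab_smul: "s \<in> stab \<Longrightarrow> c \<odot> s \<in> stab"
  unfolding smul_def by (rule stab_mult[OF stab_sc])

text \<open>As \<open>z\<close> commutes with the other factors, it acts on the \<open>j\<close>-th
  slot of a monomial only, so a two-term rule for that slot is enough.\<close>

lemma stabI:
  assumes j: "j < n" and z: "z \<in> {x j, y j, U j, Uinv j}"
    and step: "\<And>m d. \<exists>c c' m' d' m'' d''. z \<otimes> fb j m d = c \<odot> fb j m' d' \<oplus> c' \<odot> fb j m'' d''"
  shows "z \<in> stab"
proof -
  have zc: "z \<in> carrier R" using z j by auto
  have bas: "z \<otimes> bas g \<in> spn" if g: "g \<in> rank_le n" for g
  proof -
    let ?f = "\<lambda>i. fb i (ue g i) (xe g i)"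
    obtain c c' m' d' m'' d'' where s: "z \<otimes> ?f j = c \<odot> fb j m' d' \<oplus> c' \<odot> fb j m'' d''"
      using step by blast
    have upd: "oprod (?f(j := fb j m d)) n \<in> (\<lambda>g. bas g) ` rank_le n" for m d
    proof (rule image_eqI)
      \<comment> \<open>The label \<open>g\<close> with the two coordinates of factor
        \<open>j\<close> reset to \<open>m\<close> and \<open>d\<close>.\<close>
      let ?g = "g + (single (2 * j) (m - ue g j) + single (Suc (2 * j)) (d - xe g j))"
      show "oprod (?f(j := fb j m d)) n = bas ?g"
        unfolding bas_def by (rule oprod_cong) auto
      show "?g \<in> rank_le n" using g j by simp
    qed
    have "z \<otimes> bas g = oprod (?f(j := z \<otimes> ?f j)) n"
      unfolding bas_def
    proof (rule oprod_mult_left[OF zc _ j])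
      show "?f i \<in> comm_with z" if "i < n" "i \<noteq> j" for i
        by (rule factors_commute[OF that(1) j that(2)]) (use z in auto)
    qed simp
    also have "\<dots> = c \<odot> oprod (?f(j := fb j m' d')) n \<oplus> c' \<odot> oprod (?f(j := fb j m'' d'')) n"
      unfolding s by (rule oprod_slot_linear) (use j in auto)
    also have "\<dots> \<in> spn"
      using upd[of m' d'] upd[of m'' d''] by (auto intro!: spn_add spn_bas)
    finally show ?thesis .
  qed
  have "z \<otimes> t \<in> spn" if "t \<in> spn" for t
    using that
  proof (induction t rule: spn_induct)
    case (bas g c)
    then have "sc c \<otimes> (z \<otimes> bas g) \<in> spn" using stab_sc \<open>\<And>g. g \<in> rank_le n \<Longrightarrow> z \<otimes> bas g \<in> spn\<close>
      by (simp add: stab_def)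
    moreover have "z \<otimes> c \<odot> bas g = sc c \<otimes> (z \<otimes> bas g)"
      using zc by (simp add: smul_mult_right smul_def[symmetric])
    ultimately show ?case by simp
  qed (use zc in \<open>auto simp: spn_zero r_distr intro: spn_add\<close>)
  with zc show ?thesis by (simp add: stab_def)
qed

lemma stab_gens:
  assumes j: "j < n"
  shows "x j \<in> stab" "y j \<in> stab" "e j \<in> stab"
proof -
  interpret qweyl_factor R sc q "\<alpha> j" "x j" "y j" "e j" using j by (rule factor)
  show xs: "x j \<in> stab" using x_fbasis by (intro stabI[OF j]) blast+
  show "y j \<in> stab" using y_fbasis by (intro stabI[OF j]) blast+
  have "uinv \<otimes> fbasis m d = 1 \<odot> fbasis (m - 1) d \<oplus> 0 \<odot> fbasis m d" for m d
    by (simp add: uinv_fbasis)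
  then have "uinv \<in> stab" by (intro stabI[OF j]) blast+
  with xs show "e j \<in> stab" by (subst e_eq) (intro stab_smul stab_mult)
qed

theorem spanning:
  assumes "s \<in> carrier R"
  obtains p where "keys p \<subseteq> rank_le n" "s = lincomb p"
proof -
  have "s \<in> stab" using assms
    by (induction s rule: generated) (auto intro: stab_sc stab_gens stab_add stab_mult)
  moreover have "\<one> \<in> spn"
  proof -
    have "oprod (\<lambda>i. fb i 0 0) m = \<one>" if "m \<le> n" for m
      using that
    proof (induction m)
      case (Suc m)
      then interpret qweyl_factor R sc q "\<alpha> m" "x m" "y m" "e m" by (intro factor) simp
      show ?case using Suc by (simp add: fbasis_def)
    qed simp
    then have "bas 0 = \<one>" by (simp add: bas_def)
    with spn_bas[of 0 1] show ?thesis by simp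
  qed
  ultimately have "s \<otimes> \<one> \<in> spn" unfolding stab_def by blast
  with assms that show ?thesis by (auto simp: spn_def)
qed

end

section \<open>Homomorphisms to the quantum torus are injective\<close>

text \<open>Needed twice in the theorem: for the map of the target algebra to the torus, and for
  \<open>h\<close> followed by that map.\<close>

locale torus_hom = qweyl_tensor R sc n q \<alpha> x y e + quantum_torus q n
  for R (structure) and sc :: "'k::field \<Rightarrow> 'a" and n q \<alpha> x y e +
  fixes \<psi> :: "'a \<Rightarrow> exponent \<Rightarrow>\<^sub>0 'k"
  assumes \<psi>_hom: "\<psi> \<in> ring_hom R tring" and \<psi>_sc: "\<psi> (sc c) = single 0 c"
begin

lemma \<psi>_mult: "s \<in> carrier R \<Longrightarrow> t \<in> carrier R \<Longrightarrow> \<psi> (s \<otimes> t) = \<psi> s \<star> \<psi> t"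
  and \<psi>_add: "s \<in> carrier R \<Longrightarrow> t \<in> carrier R \<Longrightarrow> \<psi> (s \<oplus> t) = \<psi> s + \<psi> t"
  and \<psi>_one: "\<psi> \<one> = single 0 1"
  using ring_hom_mult[OF \<psi>_hom] ring_hom_add[OF \<psi>_hom] ring_hom_one[OF \<psi>_hom] by simp_all

lemma \<psi>_smul: "s \<in> carrier R \<Longrightarrow> \<psi> (c \<odot> s) = single 0 c \<star> \<psi> s"
  by (simp add: smul_def \<psi>_mult \<psi>_sc)

lemmas \<psi>_simps = \<psi>_mult \<psi>_add \<psi>_one \<psi>_smul

text \<open>The image of \<open>U i\<close> is a monomial by \<open>\<psi>_U\<close>, so this is its
  only exponent.\<close>

definition M :: "nat \<Rightarrow> exponent" where "M i = lead (\<psi> (U i))"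

lemma \<psi>_Uinv: "i < n \<Longrightarrow> \<psi> (U i) \<star> \<psi> (Uinv i) = single 0 1"
  using qweyl_factor.u_uinv[OF factor, of i] by (simp add: \<psi>_mult[symmetric] \<psi>_one)

lemma \<psi>_U:
  assumes "i < n"
  obtains c where "c \<noteq> 0" "\<psi> (U i) = single (M i) c"
proof -
  obtain a c where "c \<noteq> 0" "\<psi> (U i) = single a c"
    using unit_is_monomial[OF \<psi>_Uinv[OF assms]] by blast
  with that show ?thesis by (simp add: M_def)
qed

text \<open>If \<open>x i\<close> or \<open>y i\<close> were killed, the relation for
  \<open>y x\<close> would make the nonzero scalar \<open>\<alpha> i\<close> vanish.\<close>

lemma \<psi>_nonzero:
  assumes i: "i < n"
  shows "\<psi> (x i) \<noteq> 0" "\<psi> (y i) \<noteq> 0" "\<psi> (U i) \<noteq> 0" "\<psi> (Uinv i) \<noteq> 0"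
proof -
  interpret qweyl_factor R sc q "\<alpha> i" "x i" "y i" "e i" using i by (rule factor)
  have one: "single 0 c \<noteq> (0 :: exponent \<Rightarrow>\<^sub>0 'k)" if "c \<noteq> 0" for c
    using that by (metis lookup_single_eq lookup_zero)
  have yx: "\<psi> (y i) \<star> \<psi> (x i) = single 0 q \<star> (\<psi> (x i) \<star> \<psi> (y i)) + single 0 (\<alpha> i)"
    using arg_cong[OF yx, of \<psi>] by (simp add: \<psi>_simps)
  show "\<psi> (x i) \<noteq> 0" "\<psi> (y i) \<noteq> 0" using yx one[of "\<alpha> i"] by auto
  show "\<psi> (U i) \<noteq> 0" "\<psi> (Uinv i) \<noteq> 0" using \<psi>_Uinv[OF i] one[of 1] by auto
qed

lemma U_commutation:
  assumes i: "i < n" and j: "j < n"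
  shows "U i \<otimes> x j = (q powi (if i = j then 1 else 0)) \<odot> (x j \<otimes> U i)"
    and "U i \<otimes> y j = (q powi (if i = j then -1 else 0)) \<odot> (y j \<otimes> U i)"
    and "U i \<otimes> U j = U j \<otimes> U i"
proof -
  interpret i: qweyl_factor R sc q "\<alpha> i" "x i" "y i" "e i" using i by (rule factor)
  have "a \<in> comm_with (U i)" if "i \<noteq> j" "a \<in> {x j, y j, U j}" for a
    by (rule factors_commute[OF j i]) (use that in auto)
  then show "U i \<otimes> x j = (q powi (if i = j then 1 else 0)) \<odot> (x j \<otimes> U i)"
    "U i \<otimes> y j = (q powi (if i = j then -1 else 0)) \<odot> (y j \<otimes> U i)"
    "U i \<otimes> U j = U j \<otimes> U i"
    using i j i.ux i.uy by (auto simp: comm_with_def)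
qed

text \<open>Under the skew form the \<open>M i\<close> are dual to the exponents of the images of
  the \<open>x j\<close> and isotropic among themselves. All later control of exponents rests on
  this.\<close>

lemma omega_M:
  assumes i: "i < n" and j: "j < n"
  shows "a \<in> keys (\<psi> (x j)) \<Longrightarrow> omega (M i) a = (if i = j then 1 else 0)"
    and "a \<in> keys (\<psi> (y j)) \<Longrightarrow> omega (M i) a = (if i = j then -1 else 0)"
    and "omega (M i) (M j) = 0"
proof -
  obtain c where c: "c \<noteq> 0" "\<psi> (U i) = single (M i) c" using \<psi>_U[OF i] by blast
  have conv: "single (M i) c \<star> \<psi> t = single 0 (q powi z) \<star> (\<psi> t \<star> single (M i) c)"
    if "U i \<otimes> t = (q powi z) \<odot> (t \<otimes> U i)" "t \<in> carrier R" for t z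
    using arg_cong[OF that(1), of \<psi>] that(2) i c(2) by (simp add: \<psi>_simps)
  show "omega (M i) a = (if i = j then 1 else 0)" if "a \<in> keys (\<psi> (x j))"
    using omega_eq_of_q_commute[OF conv[OF U_commutation(1)[OF i j]] c(1) that] j by simp
  show "omega (M i) a = (if i = j then -1 else 0)" if "a \<in> keys (\<psi> (y j))"
    using omega_eq_of_q_commute[OF conv[OF U_commutation(2)[OF i j]] c(1) that] j by simp
  have "U i \<otimes> U j = (q powi 0) \<odot> (U j \<otimes> U i)" using U_commutation(3)[OF i j] i j by simp
  moreover have "M j \<in> keys (\<psi> (U j))" unfolding M_def by (rule lead_in_keys) (rule \<psi>_nonzero[OF j])
  ultimately show "omega (M i) (M j) = 0"
    using omega_eq_of_q_commute[OF conv c(1), of "U j" 0] j by simp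
qed

lemma lead_pow:
  assumes "s \<in> carrier R" "\<psi> s \<noteq> 0"
  shows "\<psi> (s [^] k) \<noteq> 0 \<and> lead (\<psi> (s [^] k)) = of_nat k * lead (\<psi> s)"
proof (induction k)
  case 0
  have "single 0 1 \<noteq> (0 :: exponent \<Rightarrow>\<^sub>0 'k)" by (metis lookup_single_eq lookup_zero zero_neq_one)
  then show ?case by (simp add: \<psi>_one)
next
  case (Suc k)
  then show ?case using assms by (simp add: \<psi>_mult tmul_nonzero lead_tmul algebra_simps)
qed

definition lam1 :: "nat \<Rightarrow> int \<Rightarrow> int \<Rightarrow> exponent" where
  "lam1 i m d = of_int m * M i +
    (if d \<ge> 0 then of_int d * lead (\<psi> (x i)) else of_int (- d) * lead (\<psi> (y i)))"

lemma lead_fb: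
  assumes i: "i < n"
  shows "\<psi> (fb i m d) \<noteq> 0 \<and> lead (\<psi> (fb i m d)) = lam1 i m d"
proof -
  interpret qweyl_factor R sc q "\<alpha> i" "x i" "y i" "e i" using i by (rule factor)
  note nz = \<psi>_nonzero[OF i]
  have "M i + lead (\<psi> (Uinv i)) = 0"
    using lead_tmul[OF nz(3,4)] \<psi>_Uinv[OF i] by (simp add: M_def)
  then have ui: "lead (\<psi> (Uinv i)) = - M i" by (metis add_eq_0_iff)
  have up: "\<psi> (upow m) \<noteq> 0 \<and> lead (\<psi> (upow m)) = of_int m * M i"
    using lead_pow[OF u_closed nz(3), of "nat m"] lead_pow[OF uinv_closed nz(4), of "nat (- m)"]
    by (auto simp: upow_def ui M_def simp del: pow_nat)
  have vp: "\<psi> (vpow d) \<noteq> 0 \<and> lead (\<psi> (vpow d)) =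
      (if d \<ge> 0 then of_int d * lead (\<psi> (x i)) else of_int (- d) * lead (\<psi> (y i)))"
    using lead_pow[OF closed(1) nz(1), of "nat d"] lead_pow[OF closed(2) nz(2), of "nat (- d)"]
    by (auto simp: vpow_def simp del: pow_nat)
  show ?thesis using up vp by (simp add: fbasis_def \<psi>_mult tmul_nonzero lead_tmul lam1_def)
qed

definition lam :: "exponent \<Rightarrow> exponent" where
  "lam g = (\<Sum>i<n. lam1 i (ue g i) (xe g i))"

lemma lead_bas: "\<psi> (bas g) \<noteq> 0 \<and> lead (\<psi> (bas g)) = lam g"
proof -
  have "\<psi> (oprod (\<lambda>i. fb i (ue g i) (xe g i)) m) \<noteq> 0 \<and>
    lead (\<psi> (oprod (\<lambda>i. fb i (ue g i) (xe g i)) m)) = (\<Sum>i<m. lam1 i (ue g i) (xe g i))" if "m \<le> n" for m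
    using that
  proof (induction m)
    case 0
    have "single 0 1 \<noteq> (0 :: exponent \<Rightarrow>\<^sub>0 'k)" by (metis lookup_single_eq lookup_zero zero_neq_one)
    then show ?case by (simp add: \<psi>_one)
  next
    case (Suc m)
    then show ?case using lead_fb[of m "ue g m" "xe g m"]
      by (simp add: \<psi>_mult tmul_nonzero lead_tmul)
  qed
  then show ?thesis by (simp add: bas_def lam_def)
qed

lemma omega_uminus: "omega a (- b) = - omega a b" "omega (- a) b = - omega a b"
  using omega_simps(2)[of a b "- b"] omega_simps(1)[of a "- a" b] by (auto simp: omega_simps(3,4))

lemma omega_of_int: "omega a (of_int z * b) = z * omega a b" "omega (of_int z * a) b = z * omega a b"
proof -
  have nat: "omega a (of_nat k * b) = int k * omega a b" "omega (of_nat k * a) b = int k * omega a b" for k a b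
    by (induction k) (auto simp: omega_simps distrib_right)
  have "omega a (of_int z * b) = z * omega a b \<and> omega (of_int z * a) b = z * omega a b"
    by (cases z rule: int_cases2) (simp_all add: nat omega_uminus)
  then show "omega a (of_int z * b) = z * omega a b" "omega (of_int z * a) b = z * omega a b"
    by simp_all
qed

lemma omega_sum: "omega a (\<Sum>i\<in>A. f i) = (\<Sum>i\<in>A. omega a (f i))" "omega (\<Sum>i\<in>A. f i) a = (\<Sum>i\<in>A. omega (f i) a)"
  by (induction A rule: infinite_finite_induct) (auto simp: omega_simps)

text \<open>\<open>lam\<close> is not additive in the degrees because of the sign distinction, so a
  label is recovered in two stages. Pairing with \<open>M j\<close> yields the degrees; after their
  contribution is removed, pairing with the leading exponent of the image of \<open>x j\<close>
  yields the powers of \<open>u_j\<close>.\<close>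

lemma inj_lam: "inj_on lam (rank_le n)"
proof (rule inj_onI)
  fix g h assume g: "g \<in> rank_le n" "h \<in> rank_le n" "lam g = lam h"
  have lx: "lead (\<psi> (x j)) \<in> keys (\<psi> (x j))" "lead (\<psi> (y j)) \<in> keys (\<psi> (y j))" if "j < n" for j
    using \<psi>_nonzero[OF that] by (auto intro: lead_in_keys)
  have "omega (M j) (lam g) = xe g j" if j: "j < n" for g j
  proof -
    have "omega (M j) (lam1 i (ue g i) (xe g i)) = (if i = j then xe g j else 0)" if "i < n" for i
      using omega_M(1)[OF j that lx(1)[OF that]] omega_M(2)[OF j that lx(2)[OF that]] omega_M(3)[OF j that]
      by (cases "i = j") (auto simp: lam1_def omega_simps omega_of_int omega_uminus)
    with j show ?thesis by (simp add: lam_def omega_sum)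
  qed
  with g(3) have xe: "xe g j = xe h j" if "j < n" for j using that by metis
  define N where "N g = (\<Sum>i<n. of_int (ue g i) * M i)" for g
  define V where "V g = (\<Sum>i<n. if xe g i \<ge> 0 then of_int (xe g i) * lead (\<psi> (x i))
      else of_int (- xe g i) * lead (\<psi> (y i)))" for g
  have lam: "lam g = N g + V g" for g
    by (simp add: lam_def lam1_def N_def V_def sum.distrib)
  have "V g = V h" unfolding V_def by (intro sum.cong refl) (simp add: xe)
  with g(3) have "N g = N h" by (simp add: lam)
  moreover have "omega (N g) (lead (\<psi> (x j))) = ue g j" if j: "j < n" for g j
  proof -
    have "omega (of_int (ue g i) * M i) (lead (\<psi> (x j))) = (if i = j then ue g j else 0)" if "i < n" for i
      using omega_M(1)[OF that j lx(1)[OF j]] by (auto simp: omega_of_int)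
    with j show ?thesis by (simp add: N_def omega_sum)
  qed
  ultimately have "ue g j = ue h j" if "j < n" for j using that by metis
  with xe g(1,2) show "g = h" by (intro rank_le_eqI)
qed

lemma \<psi>_lincomb: "\<psi> (lincomb p) = (\<Sum>g\<in>keys p. single 0 (lookup p g) \<star> \<psi> (bas g))"
proof -
  have sup: "(\<Sum>g\<in>keys p. single 0 (lookup p g) \<star> \<psi> (bas g)) = (\<Sum>g\<in>A. single 0 (lookup p g) \<star> \<psi> (bas g))"
    if "finite A" "keys p \<subseteq> A" for p :: "exponent \<Rightarrow>\<^sub>0 'k" and A
    using that by (intro sum.mono_neutral_left) (auto simp: in_keys_iff)
  show ?thesis
  proof (induction p rule: poly_mapping_additive_induct)
    case zero
    have "\<psi> \<zero> = 0" by (metis \<psi>_add add_cancel_right_right r_zero zero_closed)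
    then show ?case by simp
  next
    case (single g c)
    show ?case by (subst sup[of "{g}"]) (auto simp: \<psi>_smul)
  next
    case (add p p')
    let ?A = "keys p \<union> keys p'"
    have "\<psi> (lincomb (p + p')) =
        (\<Sum>g\<in>keys p. single 0 (lookup p g) \<star> \<psi> (bas g)) + (\<Sum>g\<in>keys p'. single 0 (lookup p' g) \<star> \<psi> (bas g))"
      by (simp add: lincomb_add \<psi>_add add)
    also have "\<dots> = (\<Sum>g\<in>?A. single 0 (lookup p g) \<star> \<psi> (bas g)) + (\<Sum>g\<in>?A. single 0 (lookup p' g) \<star> \<psi> (bas g))"
      by (intro arg_cong2[of _ _ _ _ "(+)"] sup) auto
    also have "\<dots> = (\<Sum>g\<in>?A. single 0 (lookup (p + p') g) \<star> \<psi> (bas g))"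
      by (simp add: lookup_add single_add tmul_add_left sum.distrib)
    also have "\<dots> = (\<Sum>g\<in>keys (p + p'). single 0 (lookup (p + p') g) \<star> \<psi> (bas g))"
      by (rule sup[symmetric]) (use Poly_Mapping.keys_add[of p p'] in auto)
    finally show ?case .
  qed
qed

theorem \<psi>_injective: "inj_on \<psi> (carrier R)"
proof (rule inj_onI)
  fix s t assume st: "s \<in> carrier R" "t \<in> carrier R" "\<psi> s = \<psi> t"
  have "\<psi> (s \<oplus> (-1) \<odot> t) = 0"
  proof -
    have "\<psi> (s \<oplus> (-1) \<odot> t) = \<psi> s + single 0 (-1) \<star> \<psi> t" using st by (simp add: \<psi>_simps)
    also have "single 0 (-1) \<star> \<psi> t = - \<psi> t" by (rule poly_mapping_eqI) simp
    finally show ?thesis using st by simp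
  qed
  moreover obtain p where p: "keys p \<subseteq> rank_le n" "s \<oplus> (-1) \<odot> t = lincomb p"
    using spanning[of "s \<oplus> (-1) \<odot> t"] st by auto
  ultimately have "(\<Sum>g\<in>keys p. single 0 (lookup p g) \<star> \<psi> (bas g)) = 0"
    by (simp add: \<psi>_lincomb)
  moreover have "(\<Sum>g\<in>keys p. single 0 (lookup p g) \<star> \<psi> (bas g)) \<noteq> 0" if "p \<noteq> 0"
    using that
  proof (rule nonzero_of_distinct_leads)
    show "inj_on (\<lambda>g. lead (\<psi> (bas g))) (keys p)"
      using inj_on_subset[OF inj_lam p(1)] lead_bas by (auto simp: inj_on_def)
  qed (use lead_bas in blast)
  ultimately have "p = 0" by blast
  with p(2) have "s \<oplus> (-1) \<odot> t = \<zero>" by simp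
  then have "s = (- (- 1)) \<odot> t" using st by (intro add_eq_zero_smul)
  then show "s = t" using st by simp
qed

end

section \<open>The image of a homomorphism\<close>

lemma xe_sum: "xe (\<Sum>i\<in>A. f i) k = (\<Sum>i\<in>A. xe (f i) k)"
  and ue_sum: "ue (\<Sum>i\<in>A. f i) k = (\<Sum>i\<in>A. ue (f i) k)"
  by (induction A rule: infinite_finite_induct) auto

context torus_module
begin

lemma tw_eq_1: "(\<And>k. xe a k = 0) \<Longrightarrow> tw a b = 1" "(\<And>k. ue b k = 0) \<Longrightarrow> tw a b = 1"
  by (simp_all add: tw_def)

lemma ygen_tmul: "k < n \<Longrightarrow> ygen k \<star> single (\<xi> k) 1 = single (\<mu> k) (q / (q - 1)) - single 0 (\<beta> k / (q - 1))"
  by (simp add: ygen_def tmul_diff_left tw_eq_1(2))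

text \<open>\<open>P\<close> is the factor of negative degree in \<open>x_k\<close>. Vanishing puts
  \<open>m\<close> on the coordinate \<open>k\<close>, and \<open>unit\<close> then forces
  \<open>D k = -1\<close> and an exponent of size 1. So \<open>P \<star> Q\<close> has width 1 in
  direction \<open>u_k\<close> and 0 in all others; \<open>P\<close> uses up that width, and
  \<open>Q\<close> is left a monomial.\<close>

lemma binomial_factor:
  assumes P: "P \<in> preserving" "\<And>a j. a \<in> keys P \<Longrightarrow> xe a j = D j"
    and Q: "Q \<in> preserving" "\<And>a j. a \<in> keys Q \<Longrightarrow> xe a j = - D j"
    and PQ: "P \<star> Q = single m c - single 0 d" and QP: "Q \<star> P = single m c' - single 0 d"
    and m: "m \<in> rank_le n" "\<And>j. xe m j = 0" and nz: "c \<noteq> 0" "c' \<noteq> 0" "d \<noteq> 0"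
    and k: "k < n" "D k < 0" and unit: "\<bar>\<Sum>l<n. D l * ue m l\<bar> = 1"
  shows "\<exists>g a s. a \<noteq> 0 \<and> Q = single g a \<and> g \<in> rank_le n \<and> (\<forall>l. xe g l = (if l = k then 1 else 0)) \<and>
    s \<in> {1, -1} \<and> m = single (2 * k) s \<and> c * (\<beta> k / q) powi s = d"
proof -
  define s where "s = ue m k"
  have off: "ue m l = 0" if "l < n" "l \<noteq> k" for l
    by (rule vanishing_binomial(1)[OF P(1) k(1) P(2) k(2) PQ m(2)]) (use nz that in auto)
  have eqd: "c * (\<beta> k / q) powi s = d"
    unfolding s_def by (rule vanishing_binomial(2)[OF P(1) k(1) P(2) k(2) PQ m(2)]) (use nz in auto)
  have "(\<Sum>l<n. D l * ue m l) = (\<Sum>l<n. if l = k then D k * s else 0)"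
    by (rule sum.cong) (auto simp: off s_def)
  with unit k(1) have Ds: "\<bar>D k * s\<bar> = 1" by simp
  then have "\<bar>D k\<bar> = 1" "\<bar>s\<bar> = 1" by (auto simp: abs_mult zmult_eq_1_iff)
  with k(2) have Dk: "D k = -1" and s: "s \<in> {1, -1}" by auto
  have Dl: "D l = 0" if "l < n" "l \<noteq> k" for l
  proof (rule ccontr)
    assume "D l \<noteq> 0"
    \<comment> \<open>A nonzero degree at \<open>l\<close> makes \<open>P\<close> or
      \<open>Q\<close> negative there, and vanishing at \<open>l\<close> instead of \<open>k\<close>
      would kill the coordinate \<open>k\<close> of \<open>m\<close>.\<close>
    then consider "D l < 0" | "- D l < 0" by linarith
    then have "ue m k = 0"
    proof cases
      case 1
      show ?thesis
        by (rule vanishing_binomial(1)[OF P(1) that(1) P(2) 1 PQ m(2)]) (use nz that k in auto)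
    next
      case 2
      show ?thesis
        by (rule vanishing_binomial(1)[of Q l "\<lambda>j. - D j" P m c' d k]) (use nz that k m Q QP 2 in auto)
    qed
    with s show False by (auto simp: s_def)
  qed
  have m_eq: "m = single (2 * k) s"
    by (rule rank_le_eqI[OF m(1)]) (use k(1) m(2) off s_def in auto)
  have "P \<star> Q \<noteq> 0"
  proof
    assume "P \<star> Q = 0"
    then have "single m c = single 0 d" by (simp add: PQ)
    then have "m = 0" using nz by (metis lookup_single_eq lookup_single_not_eq)
    with s m_eq show False by (metis exponent_simps(7) s_def insertE singletonD zero_neq_one zero_neq_neg_one)
  qed
  then have nzPQ: "P \<noteq> 0" "Q \<noteq> 0" by auto
  have keysPQ: "keys (P \<star> Q) \<subseteq> {m, 0}"
    unfolding PQ using keys_diff[of "single m c" "single 0 d"] by (auto split: if_splits)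
  have keysP: "a \<in> rank_le n" if "a \<in> keys P" for a using P(1) that by (auto simp: preserving_def)
  have keysQ: "a \<in> rank_le n" if "a \<in> keys Q" for a using Q(1) that by (auto simp: preserving_def)
  have const: "ue a l = ue a' l \<and> ue b l = ue b' l"
    if "a \<in> keys P" "a' \<in> keys P" "b \<in> keys Q" "b' \<in> keys Q" "l \<noteq> k" for a a' b b' l
  proof -
    have le: "(ue a l - ue a' l) + (ue b l - ue b' l) \<le> 0 - 0"
      if "a \<in> keys P" "a' \<in> keys P" "b \<in> keys Q" "b' \<in> keys Q" for a a' b b'
      by (rule span_tmul_le[of "\<lambda>a. ue a l" P Q 0 0])
        (use keysPQ m_eq \<open>l \<noteq> k\<close> that in auto)
    show ?thesis
      using le[OF that(1,2,3,3)] le[OF that(2,1,3,3)] le[OF that(1,1,3,4)] le[OF that(1,1,4,3)] by simp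
  qed
  \<comment> \<open>\<open>P\<close> has constant exponents in all other directions, so if it were
    constant in \<open>u_k\<close> too, it would be a monomial of negative degree, which is not
    \<open>preserving\<close>.\<close>
  obtain a a' where a: "a \<in> keys P" "a' \<in> keys P" "ue a k > ue a' k"
  proof -
    obtain a where a: "a \<in> keys P" using nzPQ by (metis keys_eq_empty ex_in_conv)
    have "\<exists>a'\<in>keys P. ue a' k \<noteq> ue a k"
    proof (rule ccontr)
      assume *: "\<not> ?thesis"
      obtain b where b: "b \<in> keys Q" using nzPQ by (metis keys_eq_empty ex_in_conv)
      have "a' = a" if a': "a' \<in> keys P" for a'
      proof (rule exponent_eqI)
        show "ue a' l = ue a l" for l
          using * a' const[OF a' a b b, of l] by (cases "l = k") auto
        show "xe a' l = xe a l" for l using P(2) a a' by simp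
      qed
      then have "keys P = {a}" using a by blast
      then have "P = single a (lookup P a)" using sum_single_lookup[of P] by simp
      moreover have "lookup P a \<noteq> 0" using a by (simp add: in_keys_iff)
      moreover have "xe a k < 0" using P(2)[OF a] k by simp
      ultimately show False
        using preserving_monomial_degree[of a "lookup P a" k] P(1) k(1) by simp
    qed
    with a that show ?thesis by (metis linorder_neqE)
  qed
  \<comment> \<open>The gap between \<open>a\<close> and \<open>a'\<close> is an integer, hence at
    least 1, and exhausts the width available for the product.\<close>
  have constQ: "ue b k = ue b' k" if b: "b \<in> keys Q" "b' \<in> keys Q" for b b'
  proof -
    have le: "(ue a k - ue a' k) + (ue b k - ue b' k) \<le> 1" if "b \<in> keys Q" "b' \<in> keys Q" for b b'
    proof (cases "s = 1")
      case True
      have "(ue a k - ue a' k) + (ue b k - ue b' k) \<le> 1 - 0"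
        by (rule span_tmul_le[of "\<lambda>a. ue a k" P Q 0 1]) (use keysPQ m_eq True that a in auto)
      then show ?thesis by simp
    next
      case False
      have "(ue a k - ue a' k) + (ue b k - ue b' k) \<le> 0 - (- 1)"
        by (rule span_tmul_le[of "\<lambda>a. ue a k" P Q "-1" 0]) (use keysPQ m_eq False s that a in auto)
      then show ?thesis by simp
    qed
    show ?thesis using le[OF b] le[OF b(2,1)] a(3) by simp
  qed
  obtain g where g: "g \<in> keys Q" using nzPQ by (metis keys_eq_empty ex_in_conv)
  have "b = g" if "b \<in> keys Q" for b
  proof (rule exponent_eqI)
    show "ue b l = ue g l" for l
      using const[OF a(1,1) that g, of l] constQ[OF that g] by (cases "l = k") auto
    show "xe b l = xe g l" for l using Q(2) that g by simp
  qed
  then have "keys Q = {g}" using g by blast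
  then have Qg: "Q = single g (lookup Q g)" using sum_single_lookup[of Q] by simp
  have "xe g l = (if l = k then 1 else 0)" for l
    using Q(2)[OF g, of l] Dk Dl[of l] rank_leD(2)[OF keysQ[OF g], of l] by (cases "l < n") auto
  moreover have "lookup Q g \<noteq> 0" using g by (simp add: in_keys_iff)
  ultimately show ?thesis
    using Qg keysQ[OF g] s m_eq eqd by blast
qed

text \<open>The equation on \<open>c\<close> and \<open>d\<close> gives the binomials for
  \<open>P \<star> Q\<close> and \<open>y_k x_k\<close> the same root, so they agree up to a
  monomial in \<open>u_k\<close>. Cancelling the monomials \<open>Q\<close> and \<open>x_k\<close>
  on the right leaves \<open>P\<close> and \<open>ygen k\<close>.\<close>

lemma ygen_from_factorization:
  assumes PQ: "P \<star> Q = single m c - single 0 d" and Q: "Q = single g a" "a \<noteq> 0"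
    and s: "s \<in> {1, -1}" "m = single (2 * k) s" "c * (\<beta> k / q) powi s = d" "c \<noteq> 0" "k < n"
  shows "\<exists>b b' z. ygen k = single z b \<star> P \<star> single (g - \<xi> k) b' \<and> z \<in> rank_le n \<and> (\<forall>l. xe z l = 0)"
proof -
  let ?X = "single (\<xi> k) 1" and ?Xi = "single (- \<xi> k) 1"
  have X: "?X \<star> ?Xi = single 0 1" by (simp add: tw_eq_1)
  have QX: "Q \<star> ?Xi = single (g - \<xi> k) a" by (simp add: Q tw_eq_1)
  have "\<exists>z b. ygen k \<star> ?X = single z b \<star> (P \<star> Q) \<and> z \<in> rank_le n \<and> (\<forall>l. xe z l = 0)"
  proof (cases "s = 1")
    case True
    let ?b = "q / (c * (q - 1))"
    have "?b * c = q / (q - 1)" "?b * d = \<beta> k / (q - 1)"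
      using s True by (auto simp: field_simps)
    then have "ygen k \<star> ?X = single 0 ?b \<star> (P \<star> Q)"
      using s True by (simp add: ygen_tmul PQ tmul_diff_right)
    then show ?thesis by (intro exI[of _ 0] exI[of _ ?b]) auto
  next
    case False
    with s have s': "s = -1" by simp
    \<comment> \<open>For \<open>s = -1\<close> multiplication by \<open>u_k\<close> exchanges the
      constant and the nonconstant term; \<open>b\<close> matches the constant term of
      \<open>y_k x_k\<close>.\<close>
    define b where "b = - (\<beta> k / (c * (q - 1)))"
    have d: "d = c * q / \<beta> k" using s s' by (simp add: power_int_minus field_simps)
    have b: "b * c = - (\<beta> k / (q - 1))" "b * d = - (q / (q - 1))"
      using s \<beta>_nonzero[of k] by (auto simp: b_def d field_simps)
    have m: "\<mu> k + m = 0" using s s' by (simp flip: single_add)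
    have "single (\<mu> k) b \<star> (P \<star> Q) = single 0 (b * c) - single (\<mu> k) (b * d)"
      by (simp add: PQ tmul_diff_right tw_eq_1(1) m)
    also have "\<dots> = ygen k \<star> ?X"
      unfolding b ygen_tmul[OF s(5)] by (simp only: single_uminus) simp
    finally show ?thesis using s(5) by (intro exI[of _ "\<mu> k"] exI[of _ b]) auto
  qed
  then obtain z b where z: "ygen k \<star> ?X = single z b \<star> (P \<star> Q)" "z \<in> rank_le n" "\<And>l. xe z l = 0"
    by blast
  have "ygen k = (ygen k \<star> ?X) \<star> ?Xi" by (simp add: tmul_assoc X del: tmul_single)
  also have "\<dots> = single z b \<star> P \<star> single (g - \<xi> k) a"
    unfolding z by (simp add: tmul_assoc QX del: tmul_single)
  finally show ?thesis using z by blast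
qed

end

text \<open>\<alpha> belongs to the source and \<beta> to the target: \<open>preserving\<close> is
  formed with \<beta>.\<close>

locale torus_endo = torus_hom R sc n q \<alpha> x y e \<psi> + torus_module q n \<beta>
  for R (structure) and sc :: "'k::field \<Rightarrow> 'a" and n q \<alpha> x y e \<psi> \<beta> +
  assumes \<psi>_preserving: "s \<in> carrier R \<Longrightarrow> \<psi> s \<in> preserving"
begin

definition img :: "(exponent \<Rightarrow>\<^sub>0 'k) set" where "img = \<psi> ` carrier R"

lemma img_tmul: "f \<in> img \<Longrightarrow> g \<in> img \<Longrightarrow> f \<star> g \<in> img"
  unfolding img_def using \<psi>_mult by (metis (no_types, lifting) image_iff m_closed)

lemma img_scalar: "single 0 c \<in> img"
  unfolding img_def using \<psi>_sc by (metis imageI sc_closed)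

lemma img_single: "single g c \<in> img \<Longrightarrow> c \<noteq> 0 \<Longrightarrow> single g d \<in> img"
  using img_tmul[OF img_scalar, of "single g c" "d / c"] by simp

text \<open>Both the image of \<open>U i\<close> and its inverse are \<open>preserving\<close>
  monomials, so their degrees in each \<open>x_k\<close> are nonnegative and opposite, hence
  zero.\<close>

lemma M_facts:
  assumes i: "i < n"
  shows "M i \<in> rank_le n" "xe (M i) k = 0" "single (M i) c \<in> img" "single (- M i) c \<in> img"
proof -
  interpret qweyl_factor R sc q "\<alpha> i" "x i" "y i" "e i" using i by (rule factor)
  obtain c0 where c0: "c0 \<noteq> 0" "\<psi> (U i) = single (M i) c0" using \<psi>_U[OF i] by blast
  have "\<psi> (Uinv i) \<star> \<psi> (U i) = single 0 1"
    using uinv_u by (simp add: \<psi>_mult[symmetric] \<psi>_one)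
  then obtain b d where b: "d \<noteq> 0" "\<psi> (Uinv i) = single b d" by (rule unit_is_monomial)
  have "single (M i + b) (c0 * d * tw (M i) b) = single 0 1"
    using \<psi>_Uinv[OF i] by (simp add: c0 b)
  then have "M i + b = 0" by (metis lookup_single_eq lookup_single_not_eq zero_neq_one)
  then have b': "b = - M i" by (metis add_eq_0_iff)
  have pres: "single (M i) c0 \<in> preserving" "single (- M i) d \<in> preserving"
    using \<psi>_preserving[of "U i"] \<psi>_preserving[of "Uinv i"] c0 b b' i by auto
  then show M: "M i \<in> rank_le n" using c0 by (auto simp: preserving_def)
  show "xe (M i) k = 0"
  proof (cases "k < n")
    case True
    then show ?thesis
      using preserving_monomial_degree[OF pres(1) c0(1) True]
        preserving_monomial_degree[OF pres(2) b(1) True] by simp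
  qed (use rank_leD(2)[OF M] in auto)
  have "single (M i) c0 \<in> img" "single (- M i) d \<in> img"
    unfolding img_def using i c0 b b' by (metis gens_closed(4,5) imageI)+
  then show "single (M i) c \<in> img" "single (- M i) c \<in> img"
    using img_single c0 b by blast+
qed

text \<open>\<open>k\<close> is the tensor factor of the target that contains the image of the \<open>i\<close>-th factor, up to
  unit monomials.\<close>

definition matched :: "nat \<Rightarrow> nat \<Rightarrow> bool" where
  "matched i k \<longleftrightarrow> k < n \<and> (\<exists>s\<in>{1, -1}. M i = single (2 * k) s) \<and>
    (\<forall>a\<in>keys (\<psi> (x i)). \<bar>xe a k\<bar> = 1) \<and>
    (\<exists>g a. a \<noteq> 0 \<and> single g a \<in> img \<and> g \<in> rank_le n \<and> (\<forall>l. xe g l = (if l = k then 1 else 0)) \<and>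
      (\<exists>b b' z f. ygen k = single z b \<star> f \<star> single (g - \<xi> k) b' \<and> f \<in> img \<and> z \<in> rank_le n \<and> (\<forall>l. xe z l = 0)))"

lemma matched_exists:
  assumes i: "i < n"
  shows "\<exists>k. matched i k"
proof -
  interpret qweyl_factor R sc q "\<alpha> i" "x i" "y i" "e i" using i by (rule factor)
  let ?X = "\<psi> (x i)" and ?Y = "\<psi> (y i)" and ?r = "inverse (q - 1)"
  note M = M_facts[OF i]
  obtain c where c: "c \<noteq> 0" "\<psi> (U i) = single (M i) c" using \<psi>_U[OF i] by blast
  have XY: "?X \<star> ?Y = single (M i) (?r * c) - single 0 (?r * \<alpha> i)"
    using arg_cong[OF xy, of \<psi>] by (simp add: \<psi>_simps c single_uminus)
  have YX: "?Y \<star> ?X = single (M i) (?r * q * c) - single 0 (?r * \<alpha> i)"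
    using arg_cong[OF yx', of \<psi>] by (simp add: \<psi>_simps c single_uminus)
  have pres: "?X \<in> preserving" "?Y \<in> preserving" by (auto intro: \<psi>_preserving)
  have img: "?X \<in> img" "?Y \<in> img" by (auto simp: img_def)
  define D where "D = xe (lead ?X)"
  have X0: "?X \<noteq> 0" and Y0: "?Y \<noteq> 0" by (rule \<psi>_nonzero[OF i])+
  note lX = lead_in_keys[OF X0] and lY = lead_in_keys[OF Y0]
  have keysXY: "keys (?X \<star> ?Y) \<subseteq> {M i, 0}"
    unfolding XY by (rule order_trans[OF keys_diff]) auto
  \<comment> \<open>Both terms of the product have degree zero in \<open>x_l\<close>, so neither
    factor has any width in that direction: both are homogeneous.\<close>
  have le: "(xe a l - xe a' l) + (xe b l - xe b' l) \<le> 0 - 0"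
    if "a \<in> keys ?X" "a' \<in> keys ?X" "b \<in> keys ?Y" "b' \<in> keys ?Y" for a a' b b' l
    by (rule span_tmul_le[of "\<lambda>a. xe a l" ?X ?Y 0 0]) (use keysXY M(2) that in auto)
  have DX: "xe a l = D l" if a: "a \<in> keys ?X" for a l
    using le[OF a lX lY lY, of l] le[OF lX a lY lY, of l] by (simp add: D_def)
  have "lead ?X + lead ?Y = M i \<or> lead ?X + lead ?Y = 0"
    using lead_tmul_in_keys[OF X0 Y0] keysXY by blast
  then have "xe (lead ?X + lead ?Y) l = 0" for l
    by (elim disjE) (simp_all only: M(2) exponent_simps(8))
  then have "xe (lead ?Y) l = - D l" for l by (simp add: D_def eq_neg_iff_add_eq_0 add.commute)
  then have DY: "xe a l = - D l" if a: "a \<in> keys ?Y" for a l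
    using le[OF lX lX a lY, of l] le[OF lX lX lY a, of l] by simp
  \<comment> \<open>As \<open>M i\<close> involves no \<open>x_l\<close>, the skew form reduces to
    the pairing of \<open>D\<close> with the exponents of \<open>M i\<close>.\<close>
  have "omega (M i) (lead ?X) = 1" using omega_M(1)[OF i i lX] by simp
  then have unit: "(\<Sum>l<n. D l * ue (M i) l) = 1" by (simp add: omega_def M(2) D_def)
  then obtain k where k: "k < n" "D k \<noteq> 0"
    by (metis (no_types, lifting) lessThan_iff mult_zero_left sum.neutral zero_neq_one)
  have nz: "?r * c \<noteq> 0" "?r * q * c \<noteq> 0" "?r * \<alpha> i \<noteq> 0" using c by auto
  show ?thesis
  proof (cases "D k < 0")
    case True
    have unit': "\<bar>\<Sum>l<n. D l * ue (M i) l\<bar> = 1" using unit by simp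
    obtain g a s where g: "a \<noteq> 0" "?Y = single g a" "g \<in> rank_le n" "\<And>l. xe g l = (if l = k then 1 else 0)"
      "s \<in> {1, -1}" "M i = single (2 * k) s" "(?r * c) * (\<beta> k / q) powi s = ?r * \<alpha> i"
      using binomial_factor[OF pres(1) DX pres(2) DY XY YX M(1,2) nz k(1) True unit'] by blast
    obtain b b' z where "ygen k = single z b \<star> ?X \<star> single (g - \<xi> k) b'" "z \<in> rank_le n" "\<And>l. xe z l = 0"
      using ygen_from_factorization[OF XY g(2,1,5,6,7) nz(1) k(1)] by blast
    moreover have "\<bar>xe a k\<bar> = 1" if "a \<in> keys ?X" for a
      using DX[OF that, of k] DY[of g k] g(1,2,4) by simp
    moreover have "single g a \<in> img" using img g(2) by simp
    ultimately have "matched i k" unfolding matched_def using k(1) g(1,3-6) img(1) by blast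
    then show ?thesis ..
  next
    \<comment> \<open>The roles are exchanged: now \<open>?Y\<close> is the factor of negative
      degree and \<open>?X\<close> the monomial.\<close>
    case False
    with k have neg: "- D k < 0" by simp
    have unit': "\<bar>\<Sum>l<n. - D l * ue (M i) l\<bar> = 1" using unit by (simp add: sum_negf)
    have DX': "xe a l = - (- D l)" if "a \<in> keys ?X" for a l using DX[OF that] by simp
    obtain g a s where g: "a \<noteq> 0" "?X = single g a" "g \<in> rank_le n" "\<And>l. xe g l = (if l = k then 1 else 0)"
      "s \<in> {1, -1}" "M i = single (2 * k) s" "(?r * q * c) * (\<beta> k / q) powi s = ?r * \<alpha> i"
      using binomial_factor[of ?Y "\<lambda>l. - D l" ?X, OF pres(2) DY pres(1) DX' YX XY M(1,2) nz(2,1,3) k(1) neg unit'] by blast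
    obtain b b' z where "ygen k = single z b \<star> ?Y \<star> single (g - \<xi> k) b'" "z \<in> rank_le n" "\<And>l. xe z l = 0"
      using ygen_from_factorization[OF YX g(2,1,5,6,7) nz(2) k(1)] by blast
    moreover have "\<bar>xe a k\<bar> = 1" if "a \<in> keys ?X" for a
      using that g(1,2,4) by simp
    moreover have "single g a \<in> img" using img g(2) by simp
    ultimately have "matched i k" unfolding matched_def using k(1) g(1,3-6) img(2) by blast
    then show ?thesis ..
  qed
qed

lemma img_unit_monomials:
  assumes gen: "\<And>k. k < n \<Longrightarrow> single (\<mu> k) 1 \<in> img \<and> single (- \<mu> k) 1 \<in> img"
    and g: "g \<in> rank_le n" "\<And>l. xe g l = 0"
  shows "single g c \<in> img"
proof -
  have pow: "single (single (2 * k) z) 1 \<in> img" if k: "k < n" for k z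
  proof (induction z rule: int_induct[where k = 0])
    case base
    show ?case using img_scalar[of 1] by simp
  next
    case (step1 z)
    then show ?case using img_tmul[OF step1(2) conjunct1[OF gen[OF k]]] by (simp add: tw_eq_1 single_add)
  next
    case (step2 z)
    then show ?case using img_tmul[OF step2(2) conjunct2[OF gen[OF k]]] by (simp add: tw_eq_1 single_diff)
  qed
  have "single (\<Sum>k<m. single (2 * k) (ue g k)) 1 \<in> img" if "m \<le> n" for m
    using that
  proof (induction m)
    case 0
    show ?case using img_scalar[of 1] by simp
  next
    case (Suc m)
    then have "single (\<Sum>k<m. single (2 * k) (ue g k)) 1 \<star> single (single (2 * m) (ue g m)) 1 \<in> img"
      by (intro img_tmul pow) auto
    then show ?case by (simp add: tw_eq_1 xe_sum)
  qed
  moreover have "(\<Sum>k<n. single (2 * k) (ue g k)) = g"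
  proof (rule exponent_eqI)
    show "ue (\<Sum>k<n. single (2 * k) (ue g k)) l = ue g l" for l
      using rank_leD(1)[OF g(1), of l] by (cases "l < n") (auto simp: ue_sum)
    show "xe (\<Sum>k<n. single (2 * k) (ue g k)) l = xe g l" for l by (simp add: xe_sum g(2))
  qed
  ultimately have "single g 1 \<in> img" by (metis order_refl)
  then show ?thesis by (rule img_single) simp
qed

text \<open>If distinct \<open>i\<close> and \<open>j\<close> were matched with the same
  \<open>k\<close>, then \<open>M i\<close> would pair to 1 or -1 with the image of
  \<open>x j\<close>, although \<open>U i\<close> commutes with \<open>x j\<close>. So the matching
  is a permutation, and every target factor is reached.\<close>

theorem img_generators:
  assumes "k < n"
  shows "single (\<xi> k) 1 \<in> img" "ygen k \<in> img" "single (- \<mu> k) 1 \<in> img"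
proof -
  obtain \<kappa> where \<kappa>: "\<And>i. i < n \<Longrightarrow> matched i (\<kappa> i)"
    using matched_exists by metis
  have "inj_on \<kappa> {..<n}"
  proof (rule inj_onI, rule ccontr)
    fix i j assume ij: "i \<in> {..<n}" "j \<in> {..<n}" "\<kappa> i = \<kappa> j" "i \<noteq> j"
    let ?a = "lead (\<psi> (x j))"
    have a: "?a \<in> keys (\<psi> (x j))" using ij \<psi>_nonzero by (auto intro: lead_in_keys)
    obtain s where s: "s \<in> {1, -1 :: int}" "M i = single (2 * \<kappa> i) s"
      using \<kappa>[of i] ij unfolding matched_def by auto
    have "\<kappa> i < n" using \<kappa>[of i] ij by (simp add: matched_def)
    moreover have "omega (M i) ?a = 0" using omega_M(1)[OF _ _ a, of i] ij by simp
    moreover have "omega (M i) ?a = (\<Sum>l<n. if l = \<kappa> i then xe ?a (\<kappa> i) * s else 0)"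
      unfolding omega_def s(2) by (simp add: if_distrib[of "(*) _"] cong: if_cong)
    ultimately have "xe ?a (\<kappa> i) * s = 0" by simp
    moreover have "\<bar>xe ?a (\<kappa> i)\<bar> = 1" using \<kappa>[of j] ij a by (simp add: matched_def)
    ultimately show False using s by auto
  qed
  moreover have "\<kappa> ` {..<n} \<subseteq> {..<n}" using \<kappa> by (auto simp: matched_def)
  ultimately have surj: "\<kappa> ` {..<n} = {..<n}" by (intro endo_inj_surj) auto
  then have ex: "\<exists>i<n. matched i k" if "k < n" for k
    using that \<kappa> by (metis (no_types, lifting) image_iff lessThan_iff)
  have units: "single (\<mu> k) 1 \<in> img \<and> single (- \<mu> k) 1 \<in> img" if k: "k < n" for k
  proof -
    obtain i s where i: "i < n" "s \<in> {1, -1}" "M i = single (2 * k) s"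
      using ex[OF k] by (auto simp: matched_def)
    then show ?thesis using M_facts(3,4)[OF i(1), of 1] by (auto simp: single_uminus)
  qed
  then show "single (- \<mu> k) 1 \<in> img" using assms by blast
  obtain i where "matched i k" using ex[OF assms] by blast
  then obtain g a b b' z f where *: "a \<noteq> 0" "single g a \<in> img" "g \<in> rank_le n" "\<And>l. xe g l = (if l = k then 1 else 0)"
    "ygen k = single z b \<star> f \<star> single (g - \<xi> k) b'" "f \<in> img" "z \<in> rank_le n" "\<And>l. xe z l = 0"
    unfolding matched_def by blast
  note mono = img_unit_monomials[OF units]
  \<comment> \<open>\<open>g\<close> has the same degrees as \<open>\<xi> k\<close>, so the
    correcting monomial involves only the \<open>u_l\<close> and lies in the image.\<close>
  have "single (\<xi> k - g) 1 \<star> single g a \<in> img"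
    by (rule img_tmul[OF mono *(2)]) (use * assms in auto)
  then have "single (\<xi> k) (a * tw (\<xi> k - g) g) \<in> img" by simp
  then show "single (\<xi> k) 1 \<in> img" by (rule img_single) (use * in simp)
  show "ygen k \<in> img"
    unfolding *(5) by (rule img_tmul[OF img_tmul[OF mono *(6)] mono]) (use * assms in auto)
qed

end

section \<open>The algebras of the theorem\<close>

context presentation
begin

lemma cls_eq_of_diff_rel:
  assumes "a \<in> carrier F" "b \<in> carrier F" "a \<ominus>\<^bsub>F\<^esub> b \<in> Rels"
  shows "cls a = cls b"
proof -
  have "cls a \<oplus>\<^bsub>pres_alg X Rels\<^esub> (\<ominus>\<^bsub>pres_alg X Rels\<^esub> cls b) = \<zero>\<^bsub>pres_alg X Rels\<^esub>"
    using cls_rel[OF assms(3)] assms(1,2) by (simp only: a_minus_def cls.hom_add F.a_inv_closed cls.hom_a_inv)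
  then have "\<ominus>\<^bsub>pres_alg X Rels\<^esub> (\<ominus>\<^bsub>pres_alg X Rels\<^esub> cls b) = cls a"
    by (rule cls.S.minus_equality) (simp_all only: assms(1,2) cls.S.a_inv_closed cls.hom_closed)
  then show ?thesis
    by (simp only: assms(2) cls.S.minus_minus cls.hom_closed)
qed

end

lemma tens_gens_iff: "(i, j) \<in> tens_gens n \<longleftrightarrow> i < n \<and> j \<in> {1, 2, 3}"
  by (auto simp: tens_gens_def)

lemma E_closed: "i < n \<Longrightarrow> j \<in> {1, 2, 3} \<Longrightarrow> E i j \<in> carrier (free_alg (tens_gens n))"
  unfolding E_def by (rule gen_closed) (simp add: tens_gens_iff)

lemma presentation_tens: "presentation (tens_gens n) (tens_rels n \<alpha> q)"
proof
  interpret F: ring "free_alg (tens_gens n) :: ((nat \<times> nat) list \<Rightarrow> 'a) ring" by (rule ring_free_alg)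
  have "A_rels (tens_gens n) i (\<alpha> i) q \<subseteq> carrier (free_alg (tens_gens n))" if "i < n" for i
    using E_closed[OF that, of 1] E_closed[OF that, of 2] E_closed[OF that, of 3]
    by (auto simp: A_rels_def Let_def)
  moreover have "gen x \<otimes>\<^bsub>free_alg (tens_gens n)\<^esub> gen y \<ominus>\<^bsub>free_alg (tens_gens n)\<^esub> gen y \<otimes>\<^bsub>free_alg (tens_gens n)\<^esub> gen x
      \<in> carrier (free_alg (tens_gens n) :: ((nat \<times> nat) list \<Rightarrow> 'a) ring)" if "x \<in> tens_gens n" "y \<in> tens_gens n" for x y
    using gen_closed[OF that(1)] gen_closed[OF that(2)] by auto
  ultimately show "tens_rels n \<alpha> q \<subseteq> carrier (free_alg (tens_gens n))"
    by (auto simp: tens_rels_def Let_def)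
qed

abbreviation tens_cls :: "nat \<Rightarrow> (nat \<Rightarrow> 'k::field) \<Rightarrow> 'k \<Rightarrow> ((nat \<times> nat) list \<Rightarrow> 'k) \<Rightarrow> ((nat \<times> nat) list \<Rightarrow> 'k) set" where
  "tens_cls n \<alpha> q f \<equiv> genideal (free_alg (tens_gens n)) (tens_rels n \<alpha> q) +>\<^bsub>free_alg (tens_gens n)\<^esub> f"

abbreviation tens_scal :: "nat \<Rightarrow> (nat \<Rightarrow> 'k::field) \<Rightarrow> 'k \<Rightarrow> 'k \<Rightarrow> ((nat \<times> nat) list \<Rightarrow> 'k) set" where
  "tens_scal n \<alpha> q \<equiv> pres_scal (tens_gens n) (tens_rels n \<alpha> q)"

lemma qweyl_tensor_tens_A:
  assumes "quantum_torus q" and \<alpha>: "\<And>i. i < n \<Longrightarrow> \<alpha> i \<noteq> (0::'k::field)"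
  shows "qweyl_tensor (tens_A n \<alpha> q) (tens_scal n \<alpha> q) n q \<alpha>
    (\<lambda>i. tens_cls n \<alpha> q (E i 3)) (\<lambda>i. tens_cls n \<alpha> q (E i 2)) (\<lambda>i. tens_cls n \<alpha> q (E i 1))"
proof -
  interpret quantum_torus q n by fact
  interpret P: presentation "tens_gens n" "tens_rels n \<alpha> q" by (rule presentation_tens)
  interpret S: scalar_ring "tens_A n \<alpha> q" "tens_scal n \<alpha> q"
    unfolding tens_A_def by (rule P.scalar_ring_pres_alg)
  let ?S = "tens_A n \<alpha> q" and ?c = "tens_cls n \<alpha> q"
  have hom: "?c (f \<otimes>\<^bsub>P.F\<^esub> g) = ?c f \<otimes>\<^bsub>?S\<^esub> ?c g" "?c (f \<oplus>\<^bsub>P.F\<^esub> g) = ?c f \<oplus>\<^bsub>?S\<^esub> ?c g"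
    "?c (f \<ominus>\<^bsub>P.F\<^esub> g) = ?c f \<ominus>\<^bsub>?S\<^esub> ?c g"
    if "f \<in> carrier P.F" "g \<in> carrier P.F" for f g
    using that unfolding tens_A_def
    by (simp_all only: a_minus_def P.cls.hom_mult P.cls.hom_add P.cls.hom_a_inv P.F.a_inv_closed)
  have scal: "?c (scal c) = tens_scal n \<alpha> q c" for c
    by (simp only: pres_scal_def)
  have c_closed: "?c f \<in> carrier ?S" if "f \<in> carrier P.F" for f
    unfolding tens_A_def using that by (rule P.cls.hom_closed)
  have rel: "?c r = \<zero>\<^bsub>?S\<^esub>" if "r \<in> tens_rels n \<alpha> q" for r
    unfolding tens_A_def using that by (rule P.cls_rel)
  have eq: "?c f = ?c g" if "f \<in> carrier P.F" "g \<in> carrier P.F" "f \<ominus>\<^bsub>P.F\<^esub> g \<in> tens_rels n \<alpha> q" for f g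
    using that by (rule P.cls_eq_of_diff_rel)
  have commE: "?c (E i a) \<otimes>\<^bsub>?S\<^esub> ?c (E j b) = ?c (E j b) \<otimes>\<^bsub>?S\<^esub> ?c (E i a)"
    if "i < n" "j < n" "i \<noteq> j" "a \<in> {1, 2, 3}" "b \<in> {1, 2, 3}" for i j a b
  proof -
    have "?c (E i a \<otimes>\<^bsub>P.F\<^esub> E j b) = ?c (E j b \<otimes>\<^bsub>P.F\<^esub> E i a)"
    proof (rule eq)
      show "E i a \<otimes>\<^bsub>P.F\<^esub> E j b \<ominus>\<^bsub>P.F\<^esub> E j b \<otimes>\<^bsub>P.F\<^esub> E i a \<in> tens_rels n \<alpha> q"
        unfolding tens_rels_def E_def Let_def using that tens_gens_iff by (intro UnI2 CollectI exI conjI) auto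
    qed (use that E_closed in auto)
    then show ?thesis using that by (simp only: hom E_closed)
  qed
  have fac: "qweyl_factor ?S (tens_scal n \<alpha> q) q (\<alpha> i) (?c (E i 3)) (?c (E i 2)) (?c (E i 1))" if i: "i < n" for i
  proof -
    note Ec = E_closed[OF i, of 1] E_closed[OF i, of 2] E_closed[OF i, of 3]
    have Ec': "E i 1 \<in> carrier P.F" "E i 2 \<in> carrier P.F" "E i 3 \<in> carrier P.F" using Ec by auto
    have cc: "?c (E i 1) \<in> carrier ?S" "?c (E i 2) \<in> carrier ?S" "?c (E i 3) \<in> carrier ?S"
      using Ec' by (auto intro: c_closed)
    have rels: "A_rels (tens_gens n) i (\<alpha> i) q \<subseteq> tens_rels n \<alpha> q"
      using i by (auto simp: tens_rels_def Let_def)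
    note mem = subsetD[OF rels, unfolded A_rels_def Let_def]
    note cl = P.F.m_closed P.F.a_closed P.F.minus_closed scal_closed Ec'
    have r1: "?c (E i 1 \<otimes>\<^bsub>P.F\<^esub> E i 3) = ?c (scal (inverse q) \<otimes>\<^bsub>P.F\<^esub> E i 3 \<otimes>\<^bsub>P.F\<^esub> E i 1)"
      by (rule eq) (auto intro!: cl mem simp del: One_nat_def)
    have r2: "?c (E i 2 \<otimes>\<^bsub>P.F\<^esub> E i 3) = ?c (scal q \<otimes>\<^bsub>P.F\<^esub> E i 3 \<otimes>\<^bsub>P.F\<^esub> E i 2 \<oplus>\<^bsub>P.F\<^esub> scal (\<alpha> i))"
      by (rule eq) (auto intro!: cl mem simp del: One_nat_def)
    have r3: "?c (E i 2 \<otimes>\<^bsub>P.F\<^esub> E i 1) = ?c (scal (inverse q) \<otimes>\<^bsub>P.F\<^esub> E i 1 \<otimes>\<^bsub>P.F\<^esub> E i 2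
        \<ominus>\<^bsub>P.F\<^esub> scal (inverse q) \<otimes>\<^bsub>P.F\<^esub> E i 3)"
      by (rule eq) (auto intro!: cl mem simp del: One_nat_def)
    have r4: "?c (E i 3 \<otimes>\<^bsub>P.F\<^esub> E i 3 \<oplus>\<^bsub>P.F\<^esub> scal (q ^ 2 - 1) \<otimes>\<^bsub>P.F\<^esub> E i 3 \<otimes>\<^bsub>P.F\<^esub> E i 1 \<otimes>\<^bsub>P.F\<^esub> E i 2
         \<oplus>\<^bsub>P.F\<^esub> scal (\<alpha> i * q * (q + 1)) \<otimes>\<^bsub>P.F\<^esub> E i 1) = \<zero>\<^bsub>?S\<^esub>"
      by (rule rel) (auto intro!: mem simp del: One_nat_def)
    note tr = hom cl scal S.smul_def[symmetric] S.smul_mult_left cc S.m_closed S.smul_closed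
    show ?thesis
    proof
      show "?c (E i 1) \<otimes>\<^bsub>?S\<^esub> ?c (E i 3) = S.smul (inverse q) (?c (E i 3) \<otimes>\<^bsub>?S\<^esub> ?c (E i 1))"
        using r1 by (simp only: tr)
      show "?c (E i 2) \<otimes>\<^bsub>?S\<^esub> ?c (E i 3) = S.smul q (?c (E i 3) \<otimes>\<^bsub>?S\<^esub> ?c (E i 2)) \<oplus>\<^bsub>?S\<^esub> S.smul (\<alpha> i) \<one>\<^bsub>?S\<^esub>"
        using r2 by (simp only: tr S.sc_eq_smul[of "\<alpha> i"])
      show "?c (E i 2) \<otimes>\<^bsub>?S\<^esub> ?c (E i 1) = S.smul (inverse q) (?c (E i 1) \<otimes>\<^bsub>?S\<^esub> ?c (E i 2)) \<oplus>\<^bsub>?S\<^esub>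
          S.smul (- inverse q) (?c (E i 3))"
        using r3 by (simp only: tr a_minus_def[of ?S] S.uminus_eq_smul S.smul_simps) simp
      show "?c (E i 3) \<otimes>\<^bsub>?S\<^esub> ?c (E i 3) \<oplus>\<^bsub>?S\<^esub> (S.smul (q\<^sup>2 - 1) (?c (E i 3) \<otimes>\<^bsub>?S\<^esub> (?c (E i 1) \<otimes>\<^bsub>?S\<^esub> ?c (E i 2))) \<oplus>\<^bsub>?S\<^esub>
          S.smul (\<alpha> i * q * (q + 1)) (?c (E i 1))) = \<zero>\<^bsub>?S\<^esub>"
        using r4 by (simp only: tr S.m_assoc S.a_assoc)
    qed (use cc \<alpha>[OF i] in auto)
  qed
  show ?thesis
  proof (intro qweyl_tensor.intro qweyl_tensor_axioms.intro, goal_cases)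
    case 1
    show ?case by (rule S.scalar_ring_axioms)
  next
    case (2 i)
    then show ?case by (rule fac)
  next
    case (3 i j a b)
    then show ?case using commE by auto
  next
    case (4 s Q)
    have s: "s \<in> carrier (pres_alg (tens_gens n) (tens_rels n \<alpha> q))" using 4(1) by (simp only: tens_A_def)
    show ?case
      using s
    proof (induction s rule: P.pres_alg_gen_induct)
      case (gen x)
      then obtain i j where "x = (i, j)" "i < n" "j \<in> {1, 2, 3}" by (auto simp: tens_gens_def)
      then show ?case using 4(3-5)[of i] unfolding E_def by blast
    next
      case (scal c)
      show ?case by (rule 4(2))
    next
      case (add s t)
      then show ?case by (rule 4(6)[unfolded tens_A_def])
    next
      case (mult s t)
      then show ?case by (rule 4(7)[unfolded tens_A_def])
    qed
  qed
qed

lemma exponent_double [simp]: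
  "ue (2 * a) k = 2 * ue a k" "xe (2 * a) k = 2 * xe a k" "a \<in> rank_le n \<Longrightarrow> 2 * a \<in> rank_le n"
  unfolding mult_2 by (simp_all only: exponent_simps rank_le_simps)

text \<open>Here \<open>k\<close> is the coefficient of the image of \<open>e_1\<close> and
  \<open>r = 1 / (q - 1)\<close>. The first identity is the third defining relation; the others are
  the coefficients of the two monomials in the fourth.\<close>

lemma coefficient_identities:
  fixes k r q b :: "'k::field"
  assumes kq: "k * (q + 1) = - q" and rq: "r * (q - 1) = 1" and q [simp]: "q \<noteq> 0"
  shows "q * r * k * inverse q = inverse q * k * (q * r) * (inverse q * inverse q) - inverse q"
  and "1 + (q\<^sup>2 - 1) * k * q * (q * r) * (inverse q * inverse q * inverse q) = 0"
  and "(q\<^sup>2 - 1) * k * q * (b * r) = b * q * (q + 1) * k"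
proof -
  have "r * k * (q * q - 1) = (r * (q - 1)) * (k * (q + 1))" by (simp add: algebra_simps)
  then have f: "r * k * (q * q - 1) = - q" by (simp only: kq rq) simp
  then have "k * r - q = r * k * (q * q)" by (simp add: algebra_simps)
  moreover have "inverse q * k * (q * r) * (inverse q * inverse q) - inverse q = (k * r - q) * (inverse q * inverse q)"
      by (simp add: field_simps)
  ultimately show "q * r * k * inverse q = inverse q * k * (q * r) * (inverse q * inverse q) - inverse q"
    by (simp add: field_simps)
  have "(q\<^sup>2 - 1) * k * q * (q * r) * (inverse q * inverse q * inverse q) = (r * k * (q * q - 1)) * inverse q"
    by (simp add: power2_eq_square field_simps)
  then show "1 + (q\<^sup>2 - 1) * k * q * (q * r) * (inverse q * inverse q * inverse q) = 0"
    unfolding f by simp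
  have "(q\<^sup>2 - 1) * k * q * (b * r) = (r * (q - 1)) * (b * q * (q + 1) * k)"
      by (simp add: algebra_simps power2_eq_square)
  then show "(q\<^sup>2 - 1) * k * q * (b * r) = b * q * (q + 1) * k" unfolding rq by simp
qed

section \<open>The map of the target algebra to the torus\<close>

context torus_module
begin

text \<open>The image of \<open>e_1\<close> is forced by \<open>e_eq\<close>: it is
  \<open>- 1 / (q * (q + 1))\<close> times \<open>x^2 u^-1\<close>, and moving \<open>u^-1\<close>
  to the left contributes \<open>q\<^sup>2\<close>.\<close>

definition gen_image :: "nat \<times> nat \<Rightarrow> exponent \<Rightarrow>\<^sub>0 'k" where
  "gen_image p = (if snd p = 3 then single (\<xi> (fst p)) 1 else if snd p = 2 then ygen (fst p)
    else single (2 * \<xi> (fst p) - \<mu> (fst p)) (- (q / (q + 1))))"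

lemma gen_image_simps:
  "gen_image (i, 3) = single (\<xi> i) 1" "gen_image (i, 2) = ygen i"
  "gen_image (i, 1) = single (2 * \<xi> i - \<mu> i) (- (q / (q + 1)))"
  "gen_image (i, Suc 0) = single (2 * \<xi> i - \<mu> i) (- (q / (q + 1)))"
  by (simp_all add: gen_image_def)

lemma tw_coord: "i < n \<Longrightarrow> (\<And>k. k \<noteq> i \<Longrightarrow> xe a k = 0) \<Longrightarrow> tw a b = q powi (- (xe a i * ue b i))"
proof -
  assume "i < n" "\<And>k. k \<noteq> i \<Longrightarrow> xe a k = 0"
  then have "(\<Sum>k<n. xe a k * ue b k) = (\<Sum>k<n. if k = i then xe a i * ue b i else 0)"
    by (intro sum.cong) auto
  with \<open>i < n\<close> show ?thesis by (simp add: tw_def)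
qed

lemma disjoint_commute:
  assumes "\<And>a b k. a \<in> keys f \<Longrightarrow> b \<in> keys g \<Longrightarrow> xe a k * ue b k = 0 \<and> xe b k * ue a k = 0"
  shows "f \<star> g = g \<star> f"
proof -
  have mono: "single a c \<star> g = g \<star> single a c" if a: "a \<in> keys f" for a c
  proof (induction g rule: poly_mapping_additive_induct)
    case (single b d)
    have "(\<Sum>k<n. xe a k * ue b k) = 0" "(\<Sum>k<n. xe b k * ue a k) = 0"
      using assms[OF a single] by (blast intro: sum.neutral)+
    then have "tw a b = 1" "tw b a = 1" by (simp_all add: tw_def)
    then show ?case by (simp add: add.commute mult.commute)
  qed (simp_all add: tmul_add_left tmul_add_right)
  show ?thesis
    by (induction f rule: poly_mapping_additive_induct) (simp_all add: mono tmul_add_left tmul_add_right)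
qed

lemma keys_gen_image:
  assumes "a \<in> keys (gen_image (i, j))" "k \<noteq> i"
  shows "ue a k = 0" "xe a k = 0"
proof -
  have "keys (ygen i) \<subseteq> {\<mu> i - \<xi> i, - \<xi> i}"
    unfolding ygen_def by (rule order_trans[OF keys_diff]) auto
  then have "a \<in> {\<xi> i, \<mu> i - \<xi> i, - \<xi> i, 2 * \<xi> i - \<mu> i}"
    using assms(1) by (auto simp: gen_image_def split: if_splits)
  then show "ue a k = 0" "xe a k = 0" using assms(2) by auto
qed

lemma gen_image_commute: "i \<noteq> j \<Longrightarrow> gen_image (i, a) \<star> gen_image (j, b) = gen_image (j, b) \<star> gen_image (i, a)"
proof (rule disjoint_commute)
  fix c d k assume "i \<noteq> j" and c: "c \<in> keys (gen_image (i, a))" and d: "d \<in> keys (gen_image (j, b))"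
  then show "xe c k * ue d k = 0 \<and> xe d k * ue c k = 0"
    using keys_gen_image[OF c, of k] keys_gen_image[OF d, of k] by (cases "k = i") auto
qed

lemma gen_image_preserving: "i < n \<Longrightarrow> gen_image (i, j) \<in> preserving"
  unfolding gen_image_def by (auto intro!: preserving_single preserving_ygen)

lemma gen_image_relations:
  assumes i: "i < n"
  defines "X \<equiv> gen_image (i, 3)" and "Y \<equiv> gen_image (i, 2)" and "Z \<equiv> gen_image (i, 1)"
  shows "Z \<star> X = single 0 (inverse q) \<star> X \<star> Z"
    and "Y \<star> X = single 0 q \<star> X \<star> Y + single 0 (\<beta> i)"
    and "Y \<star> Z = single 0 (inverse q) \<star> Z \<star> Y - single 0 (inverse q) \<star> X"
    and "X \<star> X + single 0 (q ^ 2 - 1) \<star> X \<star> Z \<star> Y + single 0 (\<beta> i * q * (q + 1)) \<star> Z = 0"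
proof -
  define k where "k = - (q / (q + 1))"
  define r where "r = inverse (q - 1)"
  define m where "m = \<mu> i"
  define x where "x = \<xi> i"
  define z where "z = 2 * x - m"
  define t where "t = x + z"
  note tw = tw_coord[OF i]
  have X: "X = single x 1" and Z: "Z = single z k"
    and Y: "Y = single (m - x) (q * r) - single (- x) (\<beta> i * r)"
    by (simp_all only: X_def Y_def Z_def gen_image_simps ygen_def k_def z_def m_def x_def r_def divide_inverse)
  have xm [simp]: "ue x j = 0" "xe x i = 1" "ue m i = 1" "xe m j = 0"
    "j \<noteq> i \<Longrightarrow> xe x j = 0" "j \<noteq> i \<Longrightarrow> ue m j = 0" for j
    by (auto simp: x_def m_def)
  have z [simp]: "ue z i = -1" "xe z i = 2" "j \<noteq> i \<Longrightarrow> ue z j = 0" "j \<noteq> i \<Longrightarrow> xe z j = 0" for j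
    by (simp_all add: z_def)
  have t [simp]: "xe t i = 3" "j \<noteq> i \<Longrightarrow> xe t j = 0" for j
    by (simp_all add: t_def)
  \<comment> \<open>All twisting factors that occur in the four relations; with the exponents folded
    into letters they act as rewrite rules.\<close>
  have tws [simp]: "tw z x = 1" "tw x z = q" "tw (m - x) x = 1" "tw (- x) x = 1"
    "tw x (m - x) = inverse q" "tw x (- x) = 1" "tw (m - x) z = inverse q"
    "tw (- x) z = inverse q" "tw z (m - x) = inverse q * inverse q"
    "tw z (- x) = 1" "tw t (m - x) = inverse q * inverse q * inverse q"
    "tw t (- x) = 1" "tw x x = 1"
    by (simp_all add: tw power_int_minus power2_eq_square power3_eq_cube)
  have kq: "k * (q + 1) = - q" by (simp add: k_def)
  have rq: "r * (q - 1) = 1" by (simp add: r_def)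
  have e [simp]: "m - x + z = x" "z + (m - x) = x" "z - x = x - m" "x + z = t" "z + x = t"
    "t + (m - x) = 2 * x" "t - x = z"
    by (simp_all add: z_def t_def)
  have [simp]: "q * w * inverse q = w" "inverse q * w * q = w" for w by (simp_all add: field_simps)
  show "Z \<star> X = single 0 (inverse q) \<star> X \<star> Z"
    by (simp add: X Z)
  have b: "q * (\<beta> i * r) - \<beta> i = \<beta> i * r"
    using rq by (simp add: r_def field_simps)
  show "Y \<star> X = single 0 q \<star> X \<star> Y + single 0 (\<beta> i)"
  proof -
    have "single 0 (\<beta> i * r) = single 0 (q * (\<beta> i * r)) - single (0::exponent) (\<beta> i)"
      by (simp only: b flip: single_diff)
    then show ?thesis by (simp add: X Y tmul_diff_left tmul_diff_right)
  qed
  note c3 = coefficient_identities(1)[OF kq rq q_nonzero] and c4 = coefficient_identities(2)[OF kq rq q_nonzero]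
    and c5 = coefficient_identities(3)[OF kq rq q_nonzero, of "\<beta> i"]
  show "Y \<star> Z = single 0 (inverse q) \<star> Z \<star> Y - single 0 (inverse q) \<star> X"
  proof -
    have "single x (q * r * k * inverse q) = single x (inverse q * k * (q * r) * (inverse q * inverse q)) - single x (inverse q)"
      by (simp only: c3 single_diff)
    then show ?thesis by (simp add: X Y Z tmul_diff_left tmul_diff_right mult_ac)
  qed
  show "X \<star> X + single 0 (q ^ 2 - 1) \<star> X \<star> Z \<star> Y + single 0 (\<beta> i * q * (q + 1)) \<star> Z = 0"
  proof -
    have "single (x + x) 1 + single (x + x) ((q\<^sup>2 - 1) * k * q * (q * r) * (inverse q * inverse q * inverse q)) = 0"
      by (simp only: c4 single_zero flip: single_add)
    then show ?thesis
      by (simp add: X Y Z tmul_diff_left tmul_diff_right c5 add.assoc)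
  qed
qed

text \<open>Existence only needs the relations to hold in the torus; injectivity is obtained
  afterwards from \<open>\<psi>_injective\<close> for the target.\<close>

lemma tens_hom_to_torus:
  "\<exists>\<Phi>. \<Phi> \<in> ring_hom (tens_A n \<beta> q) tring \<and> (\<forall>c. \<Phi> (tens_scal n \<beta> q c) = single 0 c) \<and>
    (\<forall>i<n. \<forall>j\<in>{1, 2, 3}. \<Phi> (tens_cls n \<beta> q (E i j)) = gen_image (i, j))"
proof -
  interpret P: presentation "tens_gens n" "tens_rels n \<beta> q" by (rule presentation_tens)
  interpret H: ring_hom_ring P.F tring "eval_at gen_image"
    by (rule ring_hom_ringI2[OF P.F.ring_axioms ring_tring eval_at_hom])
  have minus: "eval_at gen_image (f \<ominus>\<^bsub>P.F\<^esub> g) = eval_at gen_image f - eval_at gen_image g"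
    if "f \<in> carrier P.F" "g \<in> carrier P.F" for f g
    using that by (simp add: a_minus_def)
  have E: "eval_at gen_image (E i j) = gen_image (i, j)" for i j by (simp add: E_def)
  have "eval_at gen_image r = \<zero>\<^bsub>tring\<^esub>" if "r \<in> tens_rels n \<beta> q" for r
  proof -
    from that consider i where "i < n" "r \<in> A_rels (tens_gens n) i (\<beta> i) q"
      | a b where "a \<in> tens_gens n" "b \<in> tens_gens n" "fst a \<noteq> fst b"
          "r = gen a \<otimes>\<^bsub>P.F\<^esub> gen b \<ominus>\<^bsub>P.F\<^esub> gen b \<otimes>\<^bsub>P.F\<^esub> gen a"
      by (auto simp: tens_rels_def Let_def)
    then show ?thesis
    proof cases
      case (1 i)
      have Ec: "E i 1 \<in> carrier P.F" "E i 2 \<in> carrier P.F" "E i 3 \<in> carrier P.F"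
        using E_closed[OF 1(1)] by auto
      note rels = gen_image_relations[OF 1(1)]
      from 1(2) Ec rels show ?thesis
        unfolding A_rels_def Let_def
        by (elim insertE emptyE) (simp_all only: minus H.hom_mult H.hom_add P.F.m_closed P.F.a_closed P.F.minus_closed scal_closed
            E eval_at_scal tring_simps diff_self)
    next
      case (2 a b)
      then obtain i j i' j' where ab: "a = (i, j)" "b = (i', j')" "i \<noteq> i'" by (cases a; cases b) auto
      have "gen a \<in> carrier P.F" "gen b \<in> carrier P.F" using 2 by (auto intro: gen_closed)
      then have "eval_at gen_image r = gen_image a \<star> gen_image b - gen_image b \<star> gen_image a"
        by (simp add: 2(4) minus)
      then show ?thesis using gen_image_commute[OF ab(3), of j j'] by (simp add: ab)
    qed
  qed
  from P.pres_alg_lift[OF ring_tring eval_at_hom this] obtain \<Phi> where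
    \<Phi>: "\<Phi> \<in> ring_hom (tens_A n \<beta> q) tring" "\<And>f. f \<in> carrier P.F \<Longrightarrow> \<Phi> (P.cls f) = eval_at gen_image f"
    unfolding tens_A_def by blast
  have "\<Phi> (tens_scal n \<beta> q c) = single 0 c" for c
    unfolding pres_scal_def by (subst \<Phi>(2)) simp_all
  moreover have "\<Phi> (tens_cls n \<beta> q (E i j)) = gen_image (i, j)" if "i < n" "j \<in> {1, 2, 3}" for i j
    using that by (subst \<Phi>(2)) (auto simp: E E_closed)
  ultimately show ?thesis using \<Phi>(1) by blast
qed

end

theorem theorem1p3:
  fixes q :: "'k::field" and n :: nat and \<alpha> \<beta> :: "nat \<Rightarrow> 'k"
  assumes "q \<noteq> 0"
    and "\<forall>m::nat. m > 0 \<longrightarrow> q ^ m \<noteq> 1"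
    and "n \<ge> 1"
    and "\<forall>i<n. \<alpha> i \<noteq> 0"
    and "\<forall>i<n. \<beta> i \<noteq> 0"
    and "h \<in> tens_A_hom n \<alpha> \<beta> q"
  shows "\<exists>g \<in> tens_A_hom n \<beta> \<alpha> q.
           (\<forall>x \<in> carrier (tens_A n \<alpha> q). g (h x) = x) \<and>
           (\<forall>y \<in> carrier (tens_A n \<beta> q). h (g y) = y)"
proof -
  interpret torus_module q n \<beta>
    by unfold_locales (use assms in auto)
  let ?S = "tens_A n \<alpha> q" and ?T = "tens_A n \<beta> q"
  let ?s = "tens_scal n \<alpha> q" and ?t = "tens_scal n \<beta> q"
  have h: "h \<in> ring_hom ?S ?T" "\<And>c. h (?s c) = ?t c"
    using assms(6) by (auto simp: tens_A_hom_def pres_alg_hom_def tens_A_def)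
  obtain \<Phi> where \<Phi>: "\<Phi> \<in> ring_hom ?T tring" "\<And>c. \<Phi> (?t c) = single 0 c"
    "\<And>i j. i < n \<Longrightarrow> j \<in> {1, 2, 3} \<Longrightarrow> \<Phi> (tens_cls n \<beta> q (E i j)) = gen_image (i, j)"
    using tens_hom_to_torus by blast
  \<comment> \<open>This makes \<Phi> injective, so the target may be regarded as a subalgebra of
    the torus.\<close>
  interpret T: torus_hom ?T ?t n q \<beta> "\<lambda>i. tens_cls n \<beta> q (E i 3)" "\<lambda>i. tens_cls n \<beta> q (E i 2)"
    "\<lambda>i. tens_cls n \<beta> q (E i 1)" \<Phi>
    by (intro torus_hom.intro torus_hom_axioms.intro qweyl_tensor_tens_A quantum_torus_axioms)
      (use assms \<Phi> in auto)
  have pres: "\<Phi> t \<in> preserving" if "t \<in> carrier ?T" for t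
    using that
  proof (induction t rule: T.generated)
    case (scal c)
    show ?case by (simp add: \<Phi>(2) preserving_single)
  next
    case (add s t)
    then show ?case by (simp add: T.\<psi>_add preserving_add)
  next
    case (mult s t)
    then show ?case by (simp add: T.\<psi>_mult preserving_tmul)
  qed (auto simp: \<Phi>(3) gen_image_preserving)
  interpret S: torus_endo ?S ?s n q \<alpha> "\<lambda>i. tens_cls n \<alpha> q (E i 3)" "\<lambda>i. tens_cls n \<alpha> q (E i 2)"
    "\<lambda>i. tens_cls n \<alpha> q (E i 1)" "\<Phi> \<circ> h" \<beta>
  proof (intro torus_endo.intro torus_endo_axioms.intro torus_hom.intro torus_hom_axioms.intro
      qweyl_tensor_tens_A quantum_torus_axioms torus_module_axioms)
    show "\<Phi> \<circ> h \<in> ring_hom ?S tring" using h(1) \<Phi>(1) by (rule ring_hom_trans)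
    show "(\<Phi> \<circ> h) s \<in> preserving" if "s \<in> carrier ?S" for s
      using pres ring_hom_closed[OF h(1) that] by simp
  qed (use assms h \<Phi> in auto)
  have inj: "inj_on h (carrier ?S)"
    using S.\<psi>_injective by (auto simp: inj_on_def)
  \<comment> \<open>Injectivity of \<Phi> pulls membership in the image of
    \<open>\<Phi> \<circ> h\<close> back to membership in the image of \<open>h\<close>.\<close>
  have lift: "t \<in> h ` carrier ?S" if t: "t \<in> carrier ?T" "\<Phi> t \<in> S.img" for t
  proof -
    obtain s where s: "s \<in> carrier ?S" "\<Phi> t = \<Phi> (h s)" using t(2) by (auto simp: S.img_def)
    then have "t = h s"
      using inj_onD[OF T.\<psi>_injective _ t(1)] ring_hom_closed[OF h(1)] by simp
    with s show ?thesis by blast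
  qed
  have "t \<in> h ` carrier ?S" if "t \<in> carrier ?T" for t
    using that
  proof (induction t rule: T.generated)
    case (scal c)
    show ?case by (rule lift) (auto simp: \<Phi>(2) S.img_scalar)
  next
    case (x i)
    then show ?case using S.img_generators by (intro lift) (auto simp: \<Phi>(3) gen_image_simps)
  next
    case (y i)
    then show ?case using S.img_generators by (intro lift) (auto simp: \<Phi>(3) gen_image_simps)
  next
    case (e i)
    note gens = S.img_generators[OF e]
    \<comment> \<open>The image of \<open>e_1\<close> is a scalar multiple of
      \<open>x^2 u^-1\<close>, whose factors are already known to lie in the image.\<close>
    have "single (\<xi> i) 1 \<star> single (\<xi> i) 1 \<star> single (- \<mu> i) 1 \<in> S.img"
      by (intro S.img_tmul gens)
    then have "single (2 * \<xi> i - \<mu> i) (tw (\<xi> i) (\<xi> i) * tw (\<xi> i + \<xi> i) (- \<mu> i)) \<in> S.img" by simp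
    then have "gen_image (i, 1) \<in> S.img" unfolding gen_image_simps by (rule S.img_single) simp
    moreover have "\<Phi> (tens_cls n \<beta> q (E i 1)) = gen_image (i, 1)" using e by (intro \<Phi>(3)) auto
    ultimately show ?case using T.gens_closed(3)[OF e] by (intro lift) (simp_all only:)
  next
    case (add s t)
    then obtain s' t' where "s' \<in> carrier ?S" "t' \<in> carrier ?S" "s = h s'" "t = h t'" by blast
    then show ?case
      using ring_hom_add[OF h(1), of s' t'] S.a_closed[of s' t'] by (metis image_eqI)
  next
    case (mult s t)
    then obtain s' t' where "s' \<in> carrier ?S" "t' \<in> carrier ?S" "s = h s'" "t = h t'" by blast
    then show ?case
      using ring_hom_mult[OF h(1), of s' t'] S.m_closed[of s' t'] by (metis image_eqI)
  qed
  then have "h ` carrier ?S = carrier ?T"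
    using ring_hom_closed[OF h(1)] by auto
  with inj h(1) have iso: "h \<in> ring_iso ?S ?T"
    by (simp add: ring_iso_def bij_betw_def)
  let ?g = "inv_into (carrier ?S) h"
  have "?g \<in> ring_iso ?T ?S"
    using ring_iso_set_sym[OF S.ring_axioms iso] .
  then have "?g \<in> ring_hom ?T ?S" by (simp add: ring_iso_def)
  moreover have "?g (?t c) = ?s c" for c
    using inv_into_f_f[OF inj, of "?s c"] h(2) by simp
  ultimately have "?g \<in> tens_A_hom n \<beta> \<alpha> q"
    by (simp add: tens_A_hom_def pres_alg_hom_def tens_A_def)
  moreover have "?g (h x) = x" if "x \<in> carrier ?S" for x
    using inj that by (rule inv_into_f_f)
  moreover have "h (?g y) = y" if "y \<in> carrier ?T" for y
    using that \<open>h ` carrier ?S = carrier ?T\<close> by (intro f_inv_into_f) simp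
  ultimately show ?thesis by blast
qed

end
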